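(* Let $K$ be a field, $n\ge 2$, and let $\mathbb{X}\subseteq\mathbb{P}^n_K$ be a reduced $0$-dimensional scheme such that $\binom{n+(\alpha-1)}{n}<\deg(\mathbb{X})<\binom{n+\alpha}{n}$ for some integer $\alpha>1$, where $\operatorname{char}(K)=0$ or $\operatorname{char}(K)>\deg(\mathbb{X})$ and no closed point of $\mathbb{X}$ lies on $\{X_0=0\}$. Assume that the following conditions are satisfied: (i) $\operatorname{HF}_{\mathbb{X}}(\alpha)=\deg(\mathbb{X})$; (ii) $\dim_K(I_{\mathbb{X}})_{\alpha}\ge n$; (iii) there are $n$ linearly independent forms in $(I_{\mathbb{X}})_{\alpha}$ which meet in precisely $\alpha^n$ distinct $L$-rational points in $\mathbb{P}^n_L$ for a field extension $K\subseteq L$. Then $\mathbb{X}$ is in generic position if and only if $\operatorname{HF}_{\vartheta_{\mathbb{X}}}(n\alpha-n-1)=0$, where $\vartheta_{\mathbb{X}}$ is the Kähler different of $\mathbb{X}$.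
   Context: Let $P=K[X_0,\dots,X_n]$ with the standard grading, $I_{\mathbb{X}}\subseteq P$ the (saturated) homogeneous vanishing ideal of $\mathbb{X}$, $R=P/I_{\mathbb{X}}$, and $x_i$ the image of $X_i$ in $R$; $x_0$ is a non-zerodivisor of $R$. For a finitely generated graded $R$-module $M$, $\operatorname{HF}_M(i)=\dim_K M_i$; $\operatorname{HF}_{\mathbb{X}}=\operatorname{HF}_R$. $\mathbb{X}$ is in generic position if $\operatorname{HF}_{\mathbb{X}}(i)=\min\{\deg(\mathbb{X}),\binom{n+i}{n}\}$ for all $i\in\mathbb{Z}$. The Kähler different $\vartheta_{\mathbb{X}}=F_0(\Omega^1_{R/K[x_0]})$ is the homogeneous ideal of $R$ generated by all $n\times n$ minors of $(\partial F_j/\partial x_i)_{i=1,\dots,n;\,j=1,\dots,r}$, where $F_1,\dots,F_r$ is any homogeneous system of generators of $I_{\mathbb{X}}$ and $\partial F_j/\partial x_i$ is the image of $\partial F_j/\partial X_i$ in $R$. *)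

theory Defs
  imports
    "HOL-Algebra.Algebra"
    "HOL-Library.Poly_Mapping"
    "HOL-Computational_Algebra.Computational_Algebra"
    "Jordan_Normal_Form.Determinant"
begin

section \<open>Graded polynomial rings\<close>

text \<open>
  A polynomial is a finitely supported map from exponent vectors to coefficients. The type allows
  countably many indeterminates; \<open>mpoly_ring n\<close> is the subring \<open>P = K[X\<^sub>0,\<dots>,X\<^sub>n]\<close>, packaged as a
  HOL-Algebra ring so that the library's ideals, prime ideals, quotient rings and
  dimensions over a subfield apply to it.
\<close>

type_synonym 'a mpoly = "(nat \<Rightarrow>\<^sub>0 nat) \<Rightarrow>\<^sub>0 'a"

definition Var :: "nat \<Rightarrow> 'a::comm_ring_1 mpoly" where
  "Var i = Poly_Mapping.single (Poly_Mapping.single i 1) 1"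

definition Const :: "'a::comm_ring_1 \<Rightarrow> 'a mpoly" where
  "Const c = Poly_Mapping.single 0 c"

definition mpoly_ring :: "nat \<Rightarrow> 'a::comm_ring_1 mpoly ring" where
  "mpoly_ring n = \<lparr>carrier = {f. \<forall>m\<in>Poly_Mapping.keys f. Poly_Mapping.keys m \<subseteq> {..n}},
     monoid.mult = (*), one = 1, ring.zero = 0, ring.add = (+)\<rparr>"

definition mon_degree :: "(nat \<Rightarrow>\<^sub>0 nat) \<Rightarrow> nat" where
  "mon_degree m = (\<Sum>i\<in>Poly_Mapping.keys m. Poly_Mapping.lookup m i)"

text \<open>
  The graded piece \<open>P\<^sub>i\<close>. The index is an integer because Hilbert functions are
  functions on the integers; for \<open>i < 0\<close> only the zero polynomial qualifies.
\<close>

definition forms :: "nat \<Rightarrow> int \<Rightarrow> 'a::comm_ring_1 mpoly set" where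
  "forms n i = {f \<in> carrier (mpoly_ring n). \<forall>m\<in>Poly_Mapping.keys f. int (mon_degree m) = i}"

definition partial_deriv :: "nat \<Rightarrow> 'a::comm_ring_1 mpoly \<Rightarrow> 'a mpoly" where
  "partial_deriv i f =
     (\<Sum>m\<in>Poly_Mapping.keys f.
        Poly_Mapping.single (m - Poly_Mapping.single i 1)
          (of_nat (Poly_Mapping.lookup m i) * Poly_Mapping.lookup f m))"

lemma lookup_partial_deriv:
  fixes f :: "'a::comm_ring_1 mpoly"
  shows "Poly_Mapping.lookup (partial_deriv i f) m =
    of_nat (Suc (Poly_Mapping.lookup m i)) * Poly_Mapping.lookup f (m + Poly_Mapping.single i 1)"
proof -
  let ?e = "Poly_Mapping.single i (1::nat)"
  have *: "k - ?e = m \<longleftrightarrow> k = m + ?e" if "Poly_Mapping.lookup k i \<noteq> 0" for k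
  proof
    assume "k - ?e = m"
    then show "k = m + ?e"
      using that
      by (intro poly_mapping_eqI)
        (auto simp: lookup_add lookup_minus lookup_single when_def)
  qed simp
  have "Poly_Mapping.lookup (partial_deriv i f) m =
      (\<Sum>k\<in>Poly_Mapping.keys f. if k = m + ?e
         then of_nat (Poly_Mapping.lookup k i) * Poly_Mapping.lookup f k else 0)"
    unfolding partial_deriv_def lookup_sum
  proof (rule sum.cong[OF refl])
    fix k
    show "Poly_Mapping.lookup (Poly_Mapping.single (k - ?e)
        (of_nat (Poly_Mapping.lookup k i) * Poly_Mapping.lookup f k)) m =
      (if k = m + ?e then of_nat (Poly_Mapping.lookup k i) * Poly_Mapping.lookup f k else 0)"
      using *[of k]
      by (cases "Poly_Mapping.lookup k i = 0")
        (auto simp: lookup_single when_def)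
  qed
  also have "\<dots> = of_nat (Suc (Poly_Mapping.lookup m i)) * Poly_Mapping.lookup f (m + ?e)"
    by (auto simp: lookup_add lookup_single not_in_keys_iff_lookup_eq_zero)
  finally show ?thesis .
qed

lemma cring_mpoly_ring: "cring (mpoly_ring n :: 'a::comm_ring_1 mpoly ring)"
proof (rule cringI)
  let ?P = "mpoly_ring n :: 'a mpoly ring"
  have add: "f + g \<in> carrier ?P" if "f \<in> carrier ?P" "g \<in> carrier ?P" for f g
    using that Poly_Mapping.keys_add[of f g] by (fastforce simp: mpoly_ring_def)
  have mult: "f * g \<in> carrier ?P" if "f \<in> carrier ?P" "g \<in> carrier ?P" for f g
  proof -
    have "Poly_Mapping.keys m \<subseteq> {..n}" if m: "m \<in> Poly_Mapping.keys (f * g)" for m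
    proof -
      obtain a b where ab: "m = a + b" "a \<in> Poly_Mapping.keys f" "b \<in> Poly_Mapping.keys g"
        using m Poly_Mapping.keys_mult[of f g] by blast
      have "Poly_Mapping.keys a \<subseteq> {..n}" "Poly_Mapping.keys b \<subseteq> {..n}"
        using \<open>f \<in> carrier ?P\<close> \<open>g \<in> carrier ?P\<close> ab by (simp_all add: mpoly_ring_def)
      then show ?thesis
        using Poly_Mapping.keys_add[of a b] ab(1) by blast
    qed
    then show ?thesis by (simp add: mpoly_ring_def)
  qed
  have zero: "0 \<in> carrier ?P" and one: "1 \<in> carrier ?P"
    by (simp_all add: mpoly_ring_def)
  have neg: "- f \<in> carrier ?P" if "f \<in> carrier ?P" for f
    using that by (simp add: mpoly_ring_def)
  have sel: "monoid.mult ?P = (*)" "monoid.one ?P = 1" "ring.zero ?P = 0" "ring.add ?P = (+)"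
    by (simp_all add: mpoly_ring_def)
  show "abelian_group ?P"
    by (rule abelian_groupI; unfold sel)
      (use add zero neg in \<open>auto simp: add.assoc add.commute intro: bexI[of _ "- f" for f]\<close>)
  show "comm_monoid ?P"
    by (rule comm_monoidI; unfold sel) (use mult one in \<open>auto simp: mult.assoc mult.commute\<close>)
qed (simp add: mpoly_ring_def distrib_right)


section \<open>Projective space and its closed subschemes\<close>

definition homogeneous_ideal :: "nat \<Rightarrow> 'a::comm_ring_1 mpoly set \<Rightarrow> bool" where
  "homogeneous_ideal n I \<longleftrightarrow> ideal I (mpoly_ring n) \<and>
     I = genideal (mpoly_ring n) {f \<in> I. \<exists>d. f \<in> forms n d}"

text \<open>
  The points of the scheme \<open>\<bbbP>\<^sup>n = Proj P\<close> are the homogeneous prime ideals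
  that do not contain all of \<open>X\<^sub>0,\<dots>,X\<^sub>n\<close>. For a set \<open>S\<close> of polynomials, \<open>proj_zeros n S\<close> is the
  closed subset of points containing \<open>S\<close>.
\<close>

definition proj_space :: "nat \<Rightarrow> 'a::field mpoly set set" where
  "proj_space n = {p. homogeneous_ideal n p \<and> primeideal p (mpoly_ring n) \<and>
     (\<exists>i\<le>n. Var i \<notin> p)}"

definition proj_zeros :: "nat \<Rightarrow> 'a::field mpoly set \<Rightarrow> 'a mpoly set set" where
  "proj_zeros n S = {p \<in> proj_space n. S \<subseteq> p}"

definition closed_points :: "'a mpoly set set \<Rightarrow> 'a mpoly set set" where
  "closed_points Z = {p \<in> Z. \<forall>q\<in>Z. p \<subseteq> q \<longrightarrow> q = p}"

text \<open>
  The rational point \<open>(a\<^sub>0 : \<dots> : a\<^sub>n)\<close> is the prime ideal generated by the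
  forms \<open>a\<^sub>i X\<^sub>j - a\<^sub>j X\<^sub>i\<close>.
\<close>

definition rational_point :: "nat \<Rightarrow> 'a::field mpoly set \<Rightarrow> bool" where
  "rational_point n p \<longleftrightarrow> (\<exists>a :: nat \<Rightarrow> 'a. (\<exists>i\<le>n. a i \<noteq> 0) \<and>
     p = genideal (mpoly_ring n)
           {Const (a i) * Var j - Const (a j) * Var i | i j. i \<le> n \<and> j \<le> n})"

text \<open>
  A closed subscheme of \<open>\<bbbP>\<^sup>n\<close> is given by its vanishing ideal: closed subschemes
  correspond bijectively to the saturated homogeneous ideals \<open>I\<close> of \<open>P\<close>. The
  underlying space is \<open>proj_zeros n I\<close>; the scheme is reduced iff the saturated
  ideal \<open>I\<close> is radical; dimension 0 means that the space is nonempty and has no proper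
  specialisations between its points.
\<close>

definition saturated :: "nat \<Rightarrow> 'a::field mpoly set \<Rightarrow> bool" where
  "saturated n I \<longleftrightarrow> (\<forall>f\<in>carrier (mpoly_ring n).
     (\<forall>i\<le>n. \<exists>k. Var i ^ k * f \<in> I) \<longrightarrow> f \<in> I)"

definition closed_subscheme :: "nat \<Rightarrow> 'a::field mpoly set \<Rightarrow> bool" where
  "closed_subscheme n I \<longleftrightarrow> homogeneous_ideal n I \<and> saturated n I"

definition reduced_scheme :: "nat \<Rightarrow> 'a::field mpoly set \<Rightarrow> bool" where
  "reduced_scheme n I \<longleftrightarrow> (\<forall>f\<in>carrier (mpoly_ring n). \<forall>k::nat. f ^ k \<in> I \<longrightarrow> f \<in> I)"

definition zero_dimensional :: "nat \<Rightarrow> 'a::field mpoly set \<Rightarrow> bool" where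
  "zero_dimensional n I \<longleftrightarrow> proj_zeros n I \<noteq> {} \<and>
     (\<forall>p\<in>proj_zeros n I. \<forall>q\<in>proj_zeros n I. p \<subseteq> q \<longrightarrow> p = q)"


section \<open>Homogeneous coordinate ring and Hilbert functions\<close>

definition coord_ring :: "nat \<Rightarrow> 'a::field mpoly set \<Rightarrow> 'a mpoly set ring" where
  "coord_ring n I = mpoly_ring n Quot I"

definition residue_class :: "nat \<Rightarrow> 'a::field mpoly set \<Rightarrow> 'a mpoly \<Rightarrow> 'a mpoly set" where
  "residue_class n I f = I +>\<^bsub>mpoly_ring n\<^esub> f"

definition base_field :: "nat \<Rightarrow> 'a::field mpoly set \<Rightarrow> 'a mpoly set set" where
  "base_field n I = residue_class n I ` Const ` UNIV"

definition coord_ring_piece :: "nat \<Rightarrow> 'a::field mpoly set \<Rightarrow> int \<Rightarrow> 'a mpoly set set" where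
  "coord_ring_piece n I i = residue_class n I ` forms n i"

text \<open>\<open>HF n I M i = dim\<^sub>K M\<^sub>i\<close> for a homogeneous ideal \<open>M\<close> of \<open>R = P / I\<close>.\<close>

definition HF :: "nat \<Rightarrow> 'a::field mpoly set \<Rightarrow> 'a mpoly set set \<Rightarrow> int \<Rightarrow> nat" where
  "HF n I M i =
     ring.dim (coord_ring n I) (base_field n I) (M \<inter> coord_ring_piece n I i)"

definition HF_scheme :: "nat \<Rightarrow> 'a::field mpoly set \<Rightarrow> int \<Rightarrow> nat" where
  "HF_scheme n I i = HF n I (carrier (coord_ring n I)) i"

text \<open>
  The degree of a 0-dimensional scheme is the value of its (constant) Hilbert polynomial,
  i.e. the eventual value of its Hilbert function.
\<close>

definition scheme_degree :: "nat \<Rightarrow> 'a::field mpoly set \<Rightarrow> nat" where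
  "scheme_degree n I = (THE d. \<forall>\<^sub>F i in at_top. HF_scheme n I i = d)"

text \<open>
  For \<open>i < 0\<close> the binomial coefficient below is 0, because its upper
  argument is then smaller than \<open>n\<close>.
\<close>

definition generic_position :: "nat \<Rightarrow> 'a::field mpoly set \<Rightarrow> bool" where
  "generic_position n I \<longleftrightarrow>
     (\<forall>i. HF_scheme n I i = min (scheme_degree n I) (nat (int n + i) choose n))"


section \<open>The Kaehler different\<close>

definition homogeneous_generators :: "nat \<Rightarrow> 'a::field mpoly set \<Rightarrow> 'a mpoly list \<Rightarrow> bool" where
  "homogeneous_generators n I Fs \<longleftrightarrow>
     (\<forall>F\<in>set Fs. \<exists>d. F \<in> forms n d) \<and> I = genideal (mpoly_ring n) (set Fs)"

text \<open>
  The maximal minors of the \<open>n\<close> by \<open>r\<close> matrix with entries \<open>\<partial>F\<^sub>j/\<partial>X\<^sub>i\<close>, where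
  \<open>i\<close> runs from 1 to \<open>n\<close> (not from 0) and \<open>c\<close> selects \<open>n\<close> of the \<open>r\<close> columns.
  They are computed in \<open>P\<close>; taking residue classes is a ring homomorphism, so the
  residue class of a minor is the corresponding minor over \<open>R\<close>.
\<close>

definition jacobian_minors :: "nat \<Rightarrow> 'a::field mpoly list \<Rightarrow> 'a mpoly set" where
  "jacobian_minors n Fs =
     {det (mat n n (\<lambda>(i, k). partial_deriv (Suc i) (Fs ! c k))) | c.
        strict_mono_on {..<n} c \<and> c ` {..<n} \<subseteq> {..<length Fs}}"

text \<open>
  The different depends on the scheme only, not on the homogeneous system of generators
  \<open>Fs\<close> of \<open>I\<close> used to compute it.
\<close>

definition kaehler_different ::
    "nat \<Rightarrow> 'a::field mpoly set \<Rightarrow> 'a mpoly list \<Rightarrow> 'a mpoly set set" where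
  "kaehler_different n I Fs =
     genideal (coord_ring n I) (residue_class n I ` jacobian_minors n Fs)"

end

theory Submission
  imports Defs
begin

text \<open>
  Since \<open>x\<^sub>0\<close> is a non-zerodivisor, \<open>X\<close> is in generic position iff \<open>I\<^sub>\<alpha>\<^sub>-\<^sub>1 = 0\<close>. If this holds, all
  Jacobian minors have degree at least \<open>n(\<alpha> - 1)\<close>, so the different vanishes in degree
  \<open>n\<alpha> - n - 1\<close>. Conversely, let \<open>F \<noteq> 0\<close> be a form of least degree in \<open>I\<close>, of degree below \<open>\<alpha>\<close>,
  and let \<open>J\<close> be the Jacobian determinant of the forms \<open>G\<^sub>1,\<dots>,G\<^sub>n\<close> of condition (iii). Replacing
  a column of \<open>J\<close> by the gradient of \<open>F\<close> gives elements of the different; after multiplication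
  with a power of \<open>x\<^sub>0\<close> they lie in degree \<open>n\<alpha> - n - 1\<close>, hence they vanish. By Cramer's rule
  \<open>J \<cdot> \<partial>F/\<partial>X\<^sub>i \<in> I\<close>. As \<open>J\<close> is a non-zerodivisor modulo \<open>I\<close>, all derivatives of \<open>F\<close> lie in \<open>I\<close>, and
  Euler's identity contradicts the minimality of the degree.

  That \<open>J\<close> is a non-zerodivisor means that the \<open>G\<^sub>k\<close> meet transversally at the points of \<open>X\<close>. This is a
  Bezout bound with multiplicities: the powers \<open>(G\<^sub>1,\<dots>,G\<^sub>n)\<^sup>k\<close> have colength at least
  \<open>(n + k - 1 choose n)\<close> at each zero, and twice as much at a zero where the Jacobian matrix is
  singular, whereas forms of degree \<open>\<alpha>k + c\<close> with a constant \<open>c\<close> already represent all residue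
  classes. For large \<open>k\<close> this rules out \<open>\<alpha>\<^sup>n\<close> zeros one of which is singular.
\<close>


section \<open>Polynomials, ideals and homogeneous components\<close>

text \<open>Multiplicities are measured by counting the monomials of weighted order below
  \<open>2 * k\<close> at each zero. At an ordinary zero all weights are 2. At a singular zero some
  tangent direction is annihilated by all gradients; giving it weight 1 still leaves every form of
  (iii) with weighted order at least 2, while the number of monomials below \<open>2 * k\<close> is
  at least doubled. Asymptotically this confronts a lower bound (\<alpha>^n + 1) k^n / n! with an
  upper bound \<alpha>^n k^n / n!. The shift \<open>c\<close> in the upper bound is not controlled,
  which is why k has to grow.

  The points of X need not be rational over K, so transversality is shown over L. It is brought back
  by a K-linear retraction of L onto K: an f outside I with J f in I would produce, over L, a point
  of the extended scheme off X_0 = 0 and off f = 0, and this point is one of the \<alpha>^n rational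
  zeros.

  The characteristic enters through Euler's identity: the least degree d of a form in I satisfies d
  < \<alpha> < deg(X), so d is invertible in K.\<close>

abbreviation "lookup \<equiv> Poly_Mapping.lookup"
abbreviation "keys \<equiv> Poly_Mapping.keys"
abbreviation "single \<equiv> Poly_Mapping.single"
abbreviation polys :: "nat \<Rightarrow> 'a::comm_ring_1 mpoly set" where
  "polys n \<equiv> carrier (mpoly_ring n)"

lemma mpoly_ring_sel [simp]:
  "monoid.mult (mpoly_ring n) = (*)" "monoid.one (mpoly_ring n) = 1"
  "ring.zero (mpoly_ring n) = 0" "ring.add (mpoly_ring n) = (+)"
  by (simp_all add: mpoly_ring_def)

lemma polys_iff: "f \<in> polys n \<longleftrightarrow> (\<forall>m\<in>keys f. keys m \<subseteq> {..n})"
  by (simp add: mpoly_ring_def)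

lemma polys_closed [simp, intro]:
  fixes f g :: "'a::comm_ring_1 mpoly"
  shows "(0::'a mpoly) \<in> polys n" "(1::'a mpoly) \<in> polys n"
    "f \<in> polys n \<Longrightarrow> g \<in> polys n \<Longrightarrow> f + g \<in> polys n"
    "f \<in> polys n \<Longrightarrow> g \<in> polys n \<Longrightarrow> f * g \<in> polys n"
    "f \<in> polys n \<Longrightarrow> - f \<in> polys n"
    "f \<in> polys n \<Longrightarrow> g \<in> polys n \<Longrightarrow> f - g \<in> polys n"
    "f \<in> polys n \<Longrightarrow> f ^ k \<in> polys n"
proof -
  interpret cring "mpoly_ring n :: 'a mpoly ring" by (rule cring_mpoly_ring)
  show 0: "(0::'a mpoly) \<in> polys n" "(1::'a mpoly) \<in> polys n" using zero_closed one_closed by auto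
  show add: "f \<in> polys n \<Longrightarrow> g \<in> polys n \<Longrightarrow> f + g \<in> polys n" for f g :: "'a mpoly"
    using a_closed[of f g] by simp
  show mult: "f \<in> polys n \<Longrightarrow> g \<in> polys n \<Longrightarrow> f * g \<in> polys n" for f g :: "'a mpoly"
    using m_closed[of f g] by simp
  show neg: "f \<in> polys n \<Longrightarrow> - f \<in> polys n" for f :: "'a mpoly" by (simp add: polys_iff)
  show "f \<in> polys n \<Longrightarrow> g \<in> polys n \<Longrightarrow> f - g \<in> polys n"
    using add[of f "- g"] neg[of g] by simp
  show "f \<in> polys n \<Longrightarrow> f ^ k \<in> polys n" by (induction k) (use 0 mult in auto)
qed

lemma sum_polys [intro]: "(\<And>x. x \<in> A \<Longrightarrow> f x \<in> polys n) \<Longrightarrow> sum f A \<in> polys n"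
  by (induction A rule: infinite_finite_induct) auto

lemma prod_polys [intro]: "(\<And>x. x \<in> A \<Longrightarrow> f x \<in> polys n) \<Longrightarrow> prod f A \<in> polys n"
  by (induction A rule: infinite_finite_induct) auto

lemma single_polys [intro]: "keys m \<subseteq> {..n} \<Longrightarrow> single m c \<in> polys n"
  by (simp add: polys_iff)

lemma Const_polys [simp]: "Const c \<in> polys n" and Var_polys [simp]: "i \<le> n \<Longrightarrow> Var i \<in> polys n"
  by (simp_all add: Const_def Var_def polys_iff)

lemma Const_simps [simp]:
  fixes a b :: "'a::comm_ring_1"
  shows "Const 0 = (0::'a mpoly)" "Const 1 = (1::'a mpoly)" "Const (a + b) = Const a + Const b"
  "Const (a * b) = Const a * Const b" "Const (- a) = - Const a" "Const (a - b) = Const a - Const b"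
  by (simp_all add: Const_def single_add mult_single single_uminus single_diff)

lemma Const_of_nat: "Const (of_nat k) = (of_nat k :: 'a::comm_ring_1 mpoly)"
  by (simp add: Const_def)

lemma lookup_Const_mult [simp]: "lookup (Const c * f) m = c * lookup f m"
  unfolding Const_def mult_map_scale_conv_mult[symmetric] by (simp add: map.rep_eq when_def)

lemma Const_mult_single [simp]: "Const a * single m b = single m (a * b)"
  by (simp add: Const_def mult_single)

lemma mpoly_expand: "f = (\<Sum>m\<in>keys f. single m (lookup f m))"
  by (rule poly_mapping_eqI)
    (simp add: lookup_sum lookup_single when_def not_in_keys_iff_lookup_eq_zero)

lemma mult_expand: "f * g = (\<Sum>a\<in>keys f. \<Sum>b\<in>keys g. single (a + b) (lookup f a * lookup g b))"
  by (subst mpoly_expand[of f], subst mpoly_expand[of g])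
    (simp add: sum_product mult_single)

lemma keys_multE:
  assumes "m \<in> keys (f * g)"
  obtains a b where "m = a + b" "a \<in> keys f" "b \<in> keys g"
  using assms keys_mult[of f g] by blast

lemma keys_addE:
  assumes "m \<in> keys (f + g)" obtains "m \<in> keys f" | "m \<in> keys g"
  using assms Poly_Mapping.keys_add[of f g] by blast

lemma keys_plus_nat: "keys (a + b :: 'x \<Rightarrow>\<^sub>0 nat) = keys a \<union> keys b"
  by (auto simp: in_keys_iff lookup_add)

section \<open>Ideals of the polynomial ring in elementwise form\<close>

lemma ideal_iff:
  fixes I :: "'a::comm_ring_1 mpoly set"
  shows "ideal I (mpoly_ring n) \<longleftrightarrow> I \<subseteq> polys n \<and> 0 \<in> I \<and>
    (\<forall>f\<in>I. \<forall>g\<in>I. f + g \<in> I) \<and> (\<forall>f\<in>I. \<forall>g\<in>polys n. g * f \<in> I)" (is "?L \<longleftrightarrow> ?R")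
proof
  assume ?L
  then interpret ideal I "mpoly_ring n" .
  show ?R using a_subset additive_subgroup.zero_closed[OF is_additive_subgroup]
      additive_subgroup.a_closed[OF is_additive_subgroup] I_l_closed by auto
next
  interpret cring "mpoly_ring n :: 'a mpoly ring" by (rule cring_mpoly_ring)
  assume R: ?R
  have inv: "m_inv (add_monoid (mpoly_ring n)) f = - f" if "f \<in> I" for f
    using that R minus_equality[of "-f" f] by (auto simp: a_inv_def)
  have neg: "- f \<in> I" if "f \<in> I" for f
    using R that bspec[of "polys n" "\<lambda>g. g * f \<in> I" "- 1"] by auto
  show ?L
  proof (rule idealI[OF ring_axioms])
    show "subgroup I (add_monoid (mpoly_ring n))"
    proof (rule group.subgroupI[OF a_group])
      show "m_inv (add_monoid (mpoly_ring n)) f \<in> I" if "f \<in> I" for f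
        using neg[OF that] inv[OF that] by (simp only:)
    qed (use R in auto)
  qed (use R in \<open>auto simp: mult.commute\<close>)
qed

lemma ideal_facts:
  fixes I :: "'a::comm_ring_1 mpoly set"
  assumes "ideal I (mpoly_ring n)"
  shows "f \<in> I \<Longrightarrow> f \<in> polys n" "0 \<in> I" "f \<in> I \<Longrightarrow> g \<in> I \<Longrightarrow> f + g \<in> I"
    "f \<in> I \<Longrightarrow> g \<in> polys n \<Longrightarrow> g * f \<in> I" "f \<in> I \<Longrightarrow> g \<in> polys n \<Longrightarrow> f * g \<in> I"
    "f \<in> I \<Longrightarrow> - f \<in> I" "f \<in> I \<Longrightarrow> g \<in> I \<Longrightarrow> f - g \<in> I"
proof -
  note I = assms[unfolded ideal_iff]
  show "f \<in> I \<Longrightarrow> f \<in> polys n" "0 \<in> I" "f \<in> I \<Longrightarrow> g \<in> polys n \<Longrightarrow> g * f \<in> I"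
    "f \<in> I \<Longrightarrow> g \<in> polys n \<Longrightarrow> f * g \<in> I"
    using I by (auto simp: mult.commute)
  show add: "f \<in> I \<Longrightarrow> g \<in> I \<Longrightarrow> f + g \<in> I" for f g using I by auto
  show neg: "f \<in> I \<Longrightarrow> - f \<in> I" for f
    using I bspec[of "polys n" "\<lambda>g. g * f \<in> I" "- 1"] by auto
  show "f \<in> I \<Longrightarrow> g \<in> I \<Longrightarrow> f - g \<in> I" using add[of f "- g"] neg[of g] by simp
qed

lemma ideal_sum:
  assumes "ideal I (mpoly_ring n)" "\<And>x. x \<in> A \<Longrightarrow> f x \<in> I"
  shows "sum f A \<in> I"
  using assms(2) by (induction A rule: infinite_finite_induct) (auto intro: ideal_facts[OF assms(1)])

lemma ideal_cancel:
  assumes "ideal I (mpoly_ring n)" "g \<in> I"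
  shows "f + g \<in> I \<longleftrightarrow> f \<in> I"
  using ideal_facts(7)[OF assms(1), of "f + g" g] ideal_facts(3)[OF assms(1), of f g] assms(2)
  by auto

lemma genideal_mpoly:
  fixes S :: "'a::comm_ring_1 mpoly set"
  assumes "S \<subseteq> polys n"
  shows "ideal (genideal (mpoly_ring n) S) (mpoly_ring n)" "S \<subseteq> genideal (mpoly_ring n) S"
    "ideal J (mpoly_ring n) \<Longrightarrow> S \<subseteq> J \<Longrightarrow> genideal (mpoly_ring n) S \<subseteq> J"
proof -
  interpret cring "mpoly_ring n :: 'a mpoly ring" by (rule cring_mpoly_ring)
  show "ideal (genideal (mpoly_ring n) S) (mpoly_ring n)" "S \<subseteq> genideal (mpoly_ring n) S"
    "ideal J (mpoly_ring n) \<Longrightarrow> S \<subseteq> J \<Longrightarrow> genideal (mpoly_ring n) S \<subseteq> J"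
    using genideal_ideal[OF assms] genideal_self[OF assms] genideal_minimal by auto
qed

lemma primeideal_iff:
  fixes I :: "'a::comm_ring_1 mpoly set"
  shows "primeideal I (mpoly_ring n) \<longleftrightarrow> ideal I (mpoly_ring n) \<and> 1 \<notin> I \<and>
    (\<forall>f\<in>polys n. \<forall>g\<in>polys n. f * g \<in> I \<longrightarrow> f \<in> I \<or> g \<in> I)" (is "?L \<longleftrightarrow> ?R")
proof -
  have one: "1 \<in> I \<longleftrightarrow> I = polys n" if "ideal I (mpoly_ring n)"
    using ideal_facts[OF that] by (metis polys_closed(2) mult.right_neutral subsetI subset_antisym)
  show ?thesis
    unfolding primeideal_def primeideal_axioms_def using one cring_mpoly_ring
    by (metis mpoly_ring_sel(1))
qed

section \<open>Degrees, forms and homogeneous components\<close>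

lemma mon_degree_wide: "finite A \<Longrightarrow> keys m \<subseteq> A \<Longrightarrow> mon_degree m = (\<Sum>i\<in>A. lookup m i)"
  unfolding mon_degree_def by (rule sum.mono_neutral_left) (auto simp: in_keys_iff)

lemma mon_degree_simps [simp]:
  "mon_degree 0 = 0" "mon_degree (a + b) = mon_degree a + mon_degree b"
  "mon_degree (single i k) = k"
proof -
  have "mon_degree (a + b) = (\<Sum>i\<in>keys a \<union> keys b. lookup (a + b) i)"
    by (rule mon_degree_wide) (auto simp: keys_plus_nat)
  also have "\<dots> = mon_degree a + mon_degree b"
    by (simp add: lookup_add sum.distrib mon_degree_wide[of "keys a \<union> keys b"])
  finally show "mon_degree (a + b) = mon_degree a + mon_degree b" .
qed (auto simp: mon_degree_def)

lemma forms_iff: "f \<in> forms n (int d) \<longleftrightarrow> f \<in> polys n \<and> (\<forall>m\<in>keys f. mon_degree m = d)"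
  by (auto simp: forms_def)

lemma forms_polys: "f \<in> forms n i \<Longrightarrow> f \<in> polys n"
  by (simp add: forms_def)

lemma forms_closed:
  fixes f g :: "'a::comm_ring_1 mpoly"
  shows "0 \<in> forms n i" "f \<in> forms n i \<Longrightarrow> g \<in> forms n i \<Longrightarrow> f + g \<in> forms n i"
    "f \<in> forms n i \<Longrightarrow> - f \<in> forms n i"
    "f \<in> forms n i \<Longrightarrow> g \<in> forms n i \<Longrightarrow> f - g \<in> forms n i"
    "f \<in> forms n i \<Longrightarrow> Const c * f \<in> forms n i"
    "f \<in> forms n i \<Longrightarrow> g \<in> forms n j \<Longrightarrow> f * g \<in> forms n (i + j)"
    "f \<in> forms n i \<Longrightarrow> f ^ k \<in> forms n (int k * i)"
proof -
  show 0: "0 \<in> forms n i" by (simp add: forms_def)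
  show "f \<in> forms n i \<Longrightarrow> g \<in> forms n i \<Longrightarrow> f + g \<in> forms n i"
    "f \<in> forms n i \<Longrightarrow> - f \<in> forms n i"
    by (auto simp: forms_def elim!: keys_addE)
  show "f \<in> forms n i \<Longrightarrow> g \<in> forms n i \<Longrightarrow> f - g \<in> forms n i"
    unfolding forms_def using keys_diff[of f g] by fastforce
  show "f \<in> forms n i \<Longrightarrow> Const c * f \<in> forms n i"
    by (auto simp: forms_def in_keys_iff)
  show mult: "f \<in> forms n i \<Longrightarrow> g \<in> forms n j \<Longrightarrow> f * g \<in> forms n (i + j)"
    for f g :: "'a mpoly" and i j
    by (auto simp: forms_def elim!: keys_multE)
  show "f \<in> forms n i \<Longrightarrow> f ^ k \<in> forms n (int k * i)"
  proof (induction k)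
    case 0 show ?case by (simp add: forms_def)
  next
    case (Suc k) then show ?case using mult[of f i "f ^ k" "int k * i"] by (simp add: algebra_simps)
  qed
qed

lemma forms_neg: "i < 0 \<Longrightarrow> forms n i = {0 :: 'a::comm_ring_1 mpoly}"
proof -
  assume "i < 0"
  then have "keys f = {}" if "f \<in> forms n i" for f :: "'a mpoly"
    using that by (fastforce simp: forms_def)
  then show ?thesis using forms_closed(1) by auto
qed

lemma sum_forms: "(\<And>x. x \<in> A \<Longrightarrow> f x \<in> forms n i) \<Longrightarrow> sum f A \<in> forms n i"
  by (induction A rule: infinite_finite_induct) (auto intro: forms_closed)

lemma prod_forms:
  "(\<And>x. x \<in> A \<Longrightarrow> f x \<in> forms n (d x)) \<Longrightarrow> prod f A \<in> forms n (sum d A)"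
proof (induction A rule: infinite_finite_induct)
  case (insert x A) then show ?case by (auto intro: forms_closed)
qed (simp_all add: forms_def)

lemma Var_forms: "i \<le> n \<Longrightarrow> Var i \<in> forms n 1" and single_forms: "keys m \<subseteq> {..n} \<Longrightarrow> single m c \<in> forms n (int (mon_degree m))"
  by (simp_all add: Var_def forms_def single_polys)

definition hcomp :: "nat \<Rightarrow> 'a::comm_ring_1 mpoly \<Rightarrow> 'a mpoly" where
  "hcomp d f = (\<Sum>m\<in>{m\<in>keys f. mon_degree m = d}. single m (lookup f m))"

lemma lookup_hcomp: "lookup (hcomp d f) m = (if mon_degree m = d then lookup f m else 0)"
  by (simp add: hcomp_def lookup_sum lookup_single when_def in_keys_iff)

lemma hcomp_simps [simp]:
  "hcomp d 0 = 0" "hcomp d (f + g) = hcomp d f + hcomp d g" "hcomp d (- f) = - hcomp d f"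
  "hcomp d (f - g) = hcomp d f - hcomp d g"
  by (auto intro!: poly_mapping_eqI simp: lookup_hcomp lookup_add lookup_minus)

lemma hcomp_sum: "hcomp d (sum f A) = (\<Sum>x\<in>A. hcomp d (f x))"
  by (induction A rule: infinite_finite_induct) auto

lemma keys_hcomp: "keys (hcomp d f) = {m\<in>keys f. mon_degree m = d}"
  by (auto simp: in_keys_iff lookup_hcomp split: if_splits)

lemma hcomp_forms: "f \<in> polys n \<Longrightarrow> hcomp d f \<in> forms n (int d)"
  by (auto simp: forms_iff keys_hcomp polys_iff)

lemma hcomp_polys [intro]: "f \<in> polys n \<Longrightarrow> hcomp d f \<in> polys n"
  using hcomp_forms forms_polys by blast

lemma hcomp_of_form: "f \<in> forms n (int e) \<Longrightarrow> hcomp d f = (if d = e then f else 0)"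
  by (rule poly_mapping_eqI) (auto simp: lookup_hcomp forms_iff in_keys_iff)

text \<open>The inserted 0 gives \<open>Max\<close> a value for the zero polynomial as well.\<close>

definition bound_degree :: "'a::comm_ring_1 mpoly \<Rightarrow> nat" where
  "bound_degree f = Max (insert 0 (mon_degree ` keys f))"

lemma bound_degree: "m \<in> keys f \<Longrightarrow> mon_degree m \<le> bound_degree f"
  by (simp add: bound_degree_def)

lemma hcomp_above: "bound_degree f < d \<Longrightarrow> hcomp d f = 0"
  by (rule poly_mapping_eqI) (metis bound_degree in_keys_iff leD lookup_hcomp lookup_zero)

lemma hcomp_expand: "bound_degree f \<le> N \<Longrightarrow> f = (\<Sum>d\<le>N. hcomp d f)"
proof (rule poly_mapping_eqI)
  fix m assume N: "bound_degree f \<le> N"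
  show "lookup f m = lookup (\<Sum>d\<le>N. hcomp d f) m"
    using bound_degree[of m f] N
    by (cases "lookup f m = 0") (auto simp: lookup_sum lookup_hcomp in_keys_iff)
qed

lemma hcomp_mult_form:
  assumes "g \<in> forms n (int e)" "f \<in> polys n"
  shows "hcomp d (f * g) = (if e \<le> d then hcomp (d - e) f * g else 0)"
proof -
  define N where "N = bound_degree f + d"
  have "hcomp d (f * g) = hcomp d ((\<Sum>i\<le>N. hcomp i f) * g)"
    using hcomp_expand[of f N] by (simp add: N_def)
  also have "\<dots> = (\<Sum>i\<le>N. hcomp d (hcomp i f * g))"
    by (simp add: sum_distrib_right hcomp_sum)
  also have "\<dots> = (\<Sum>i\<le>N. if i + e = d then hcomp i f * g else 0)"
  proof (rule sum.cong[OF refl])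
    fix i
    have "hcomp i f * g \<in> forms n (int (i + e))"
      using forms_closed(6)[OF hcomp_forms[OF assms(2)] assms(1)] by simp
    from hcomp_of_form[OF this] show "hcomp d (hcomp i f * g) = (if i + e = d then hcomp i f * g else 0)"
      by auto
  qed
  also have "\<dots> = (\<Sum>i\<le>N. if i = d - e \<and> e \<le> d then hcomp i f * g else 0)"
    by (rule sum.cong) auto
  also have "\<dots> = (if e \<le> d then hcomp (d - e) f * g else 0)"
    by (auto simp: N_def)
  finally show ?thesis .
qed

lemma hcomp_mult:
  assumes "f \<in> polys n" "g \<in> polys n"
  shows "hcomp d (f * g) = (\<Sum>i\<le>d. hcomp (d - i) f * hcomp i g)"
proof -
  define N where "N = bound_degree g + d"
  have "hcomp d (f * g) = hcomp d (f * (\<Sum>i\<le>N. hcomp i g))"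
    using hcomp_expand[of g N] by (simp add: N_def)
  also have "\<dots> = (\<Sum>i\<le>N. hcomp d (f * hcomp i g))"
    by (simp add: sum_distrib_left hcomp_sum)
  also have "\<dots> = (\<Sum>i\<le>N. if i \<le> d then hcomp (d - i) f * hcomp i g else 0)"
    by (simp add: hcomp_mult_form[OF hcomp_forms[OF assms(2)] assms(1)])
  also have "\<dots> = (\<Sum>i\<in>{..N} \<inter> {i. i \<le> d}. hcomp (d - i) f * hcomp i g)"
    by (simp add: sum.inter_restrict)
  also have "{..N} \<inter> {i. i \<le> d} = {..d}" by (auto simp: N_def)
  finally show ?thesis .
qed

text \<open>The elements of \<open>I\<close> all of whose components lie in \<open>I\<close> form an
  ideal; it contains the homogeneous generators and hence all of \<open>I\<close>. Conversely each
  element is the sum of its components.\<close>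

lemma homogeneous_ideal_iff:
  fixes I :: "'a::comm_ring_1 mpoly set"
  shows "homogeneous_ideal n I \<longleftrightarrow> ideal I (mpoly_ring n) \<and> (\<forall>f\<in>I. \<forall>d. hcomp d f \<in> I)"
    (is "?L \<longleftrightarrow> ?R")
proof
  assume ?L
  then have I: "ideal I (mpoly_ring n)" and
    gen: "I = genideal (mpoly_ring n) {f \<in> I. \<exists>d. f \<in> forms n d}"
    by (auto simp: homogeneous_ideal_def)
  let ?J = "{f \<in> I. \<forall>d. hcomp d f \<in> I}"
  note IF = ideal_facts[OF I]
  have "ideal ?J (mpoly_ring n)"
    unfolding ideal_iff
    by (auto simp: hcomp_mult IF(1) intro: IF intro!: ideal_sum[OF I] IF(4))
  moreover have "hcomp d f \<in> I" if "f \<in> I" "f \<in> forms n e" for d f e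
  proof (cases "e < 0")
    case True
    then show ?thesis using that IF(2) by (simp add: forms_neg)
  next
    case False
    then obtain k where "e = int k" using nonneg_int_cases by (metis not_less)
    then show ?thesis using that by (auto simp: hcomp_of_form IF(2))
  qed
  then have "{f \<in> I. \<exists>d. f \<in> forms n d} \<subseteq> ?J" by auto
  ultimately have "I \<subseteq> ?J"
    using genideal_mpoly(3)[of "{f \<in> I. \<exists>d. f \<in> forms n d}" n ?J] gen IF(1) by auto
  with I show ?R by auto
next
  assume R: ?R
  then have I: "ideal I (mpoly_ring n)" by simp
  note IF = ideal_facts[OF I]
  let ?S = "{f \<in> I. \<exists>d. f \<in> forms n d}"
  have S: "?S \<subseteq> polys n" using IF(1) by auto
  have "f \<in> genideal (mpoly_ring n) ?S" if f: "f \<in> I" for f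
  proof -
    have "hcomp d f \<in> ?S" for d using R f hcomp_forms[OF IF(1)[OF f]] by blast
    then show ?thesis
      using genideal_mpoly(2)[OF S] by (subst hcomp_expand[of f, OF order_refl])
        (rule ideal_sum[OF genideal_mpoly(1)[OF S]], auto)
  qed
  then show ?L using I genideal_mpoly(3)[OF S I] by (auto simp: homogeneous_ideal_def)
qed

lemma homogeneous_not_mem:
  assumes "ideal I (mpoly_ring n)" "f \<notin> I"
  obtains d where "hcomp d f \<notin> I"
  using ideal_sum[OF assms(1), of "{..bound_degree f}" "\<lambda>d. hcomp d f"] hcomp_expand[of f, OF order_refl]
    assms(2) by metis


section \<open>Homogeneous primes\<close>

lemma homogeneous_ideal_Union_chain:
  fixes C :: "'a::comm_ring_1 mpoly set set"
  assumes "C \<noteq> {}" "\<And>q. q \<in> C \<Longrightarrow> homogeneous_ideal n q"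
    "\<And>p q. p \<in> C \<Longrightarrow> q \<in> C \<Longrightarrow> p \<subseteq> q \<or> q \<subseteq> p"
  shows "homogeneous_ideal n (\<Union>C)"
proof -
  have q: "ideal q (mpoly_ring n)" "f \<in> q \<Longrightarrow> hcomp d f \<in> q" if "q \<in> C" for q f d
    using assms(2)[OF that] by (auto simp: homogeneous_ideal_iff)
  have "f + g \<in> \<Union>C" if "f \<in> p" "p \<in> C" "g \<in> q" "q \<in> C" for f g p q
    using assms(3)[OF that(2,4)] that ideal_facts(3)[OF q(1)] by (metis UnionI subsetD)
  moreover have "0 \<in> \<Union>C" using assms(1) ideal_facts(2)[OF q(1)] by blast
  moreover have "\<Union>C \<subseteq> polys n" using ideal_facts(1)[OF q(1)] by blast
  moreover have "g * f \<in> \<Union>C" if "f \<in> \<Union>C" "g \<in> polys n" for f g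
    using that ideal_facts(4)[OF q(1)] by blast
  moreover have "hcomp d f \<in> \<Union>C" if "f \<in> \<Union>C" for f d
    using that q(2) by blast
  ultimately show ?thesis
    unfolding homogeneous_ideal_iff ideal_iff by (meson UnionE)
qed

text \<open>This is the sum of \<open>q\<close> and the principal ideal of \<open>a\<close>. It
  enlarges a maximal ideal in the Zorn argument, and with \<open>a = Var 0\<close> it describes the
  hyperplane section of the scheme.\<close>

lemma homogeneous_ideal_add_principal:
  fixes q :: "'a::comm_ring_1 mpoly set"
  assumes "homogeneous_ideal n q" "a \<in> forms n (int e)"
  shows "homogeneous_ideal n {f + g * a | f g. f \<in> q \<and> g \<in> polys n}" (is "homogeneous_ideal n ?J")
proof -
  have q: "ideal q (mpoly_ring n)" "\<And>f d. f \<in> q \<Longrightarrow> hcomp d f \<in> q"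
    using assms(1) by (auto simp: homogeneous_ideal_iff)
  note qf = ideal_facts[OF q(1)]
  have a: "a \<in> polys n" using assms(2) by (rule forms_polys)
  have 1: "?J \<subseteq> polys n" using a qf(1) by auto
  have "0 + 0 * a \<in> ?J" using qf(2) by blast
  then have 2: "0 \<in> ?J" by simp
  have 3: "x + y \<in> ?J" if xy: "x \<in> ?J" "y \<in> ?J" for x y
  proof -
    obtain f g f' g' where "f \<in> q" "g \<in> polys n" "x = f + g * a" "f' \<in> q" "g' \<in> polys n" "y = f' + g' * a"
      using xy by blast
    then have "x + y = (f + f') + (g + g') * a" "f + f' \<in> q" "g + g' \<in> polys n"
      using qf(3) by (auto simp: algebra_simps)
    then show ?thesis by blast
  qed
  have 4: "r * x \<in> ?J" if xr: "x \<in> ?J" "r \<in> polys n" for x r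
  proof -
    obtain f g where "f \<in> q" "g \<in> polys n" "x = f + g * a" using xr by blast
    then have "r * x = r * f + (r * g) * a" "r * f \<in> q" "r * g \<in> polys n"
      using qf(4) xr by (auto simp: algebra_simps)
    then show ?thesis by blast
  qed
  have 5: "hcomp d x \<in> ?J" if x: "x \<in> ?J" for d x
  proof -
    obtain f g where fg: "f \<in> q" "g \<in> polys n" "x = f + g * a" using x by blast
    have "hcomp d x = hcomp d f + (if e \<le> d then hcomp (d - e) g else 0) * a"
      using fg hcomp_mult_form[OF assms(2) fg(2)] by simp
    moreover have "hcomp d f \<in> q" "(if e \<le> d then hcomp (d - e) g else 0) \<in> polys n"
      using q(2) fg by auto
    ultimately show ?thesis by blast
  qed
  show ?thesis unfolding homogeneous_ideal_iff ideal_iff by (intro conjI ballI allI 1 2 3 4 5)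
qed

text \<open>If f and g are both outside \<open>q\<close>, let d and e be the highest degrees whose
  components are outside \<open>q\<close>. In degree d + e of f g every term except the product of
  these two components lies in \<open>q\<close>, so that product does too.\<close>

lemma homogeneous_primeI:
  fixes q :: "'a::comm_ring_1 mpoly set"
  assumes q: "homogeneous_ideal n q" "1 \<notin> q"
    and prime: "\<And>a b d e. a \<in> forms n (int d) \<Longrightarrow> b \<in> forms n (int e) \<Longrightarrow> a * b \<in> q \<Longrightarrow> a \<in> q \<or> b \<in> q"
  shows "primeideal q (mpoly_ring n)"
proof -
  have I: "ideal q (mpoly_ring n)" and hc: "\<And>f d. f \<in> q \<Longrightarrow> hcomp d f \<in> q"
    using q by (auto simp: homogeneous_ideal_iff)
  note qf = ideal_facts[OF I]
  have "f \<in> q \<or> g \<in> q" if fg: "f \<in> polys n" "g \<in> polys n" "f * g \<in> q" for f g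
  proof (rule ccontr)
    assume "\<not> (f \<in> q \<or> g \<in> q)"
    have top: "\<exists>d. hcomp d f \<notin> q \<and> (\<forall>i>d. hcomp i f \<in> q)" if "f \<notin> q" for f
    proof -
      obtain d where d: "hcomp d f \<notin> q" using homogeneous_not_mem[OF I \<open>f \<notin> q\<close>] by blast
      have "\<And>i. hcomp i f \<notin> q \<Longrightarrow> i < Suc (bound_degree f)"
        using hcomp_above qf(2) by (metis less_Suc_eq_le leI)
      with d have "\<exists>k. hcomp k f \<notin> q \<and> (\<forall>y. hcomp y f \<notin> q \<longrightarrow> y \<le> k)"
        by (intro ex_has_greatest_nat[of _ d _ "Suc (bound_degree f)"]) auto
      then show ?thesis by (meson not_less)
    qed
    obtain d e where d: "hcomp d f \<notin> q" "\<forall>i>d. hcomp i f \<in> q"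
      and e: "hcomp e g \<notin> q" "\<forall>i>e. hcomp i g \<in> q"
      using top \<open>\<not> (f \<in> q \<or> g \<in> q)\<close> by blast
    have "hcomp (d + e) (f * g) = (\<Sum>i\<le>d + e. hcomp (d + e - i) f * hcomp i g)"
      using hcomp_mult fg by blast
    also have "\<dots> = hcomp d f * hcomp e g + (\<Sum>i\<in>{..d + e} - {e}. hcomp (d + e - i) f * hcomp i g)"
      by (subst sum.remove[of _ e]) auto
    finally have eq: "hcomp d f * hcomp e g + (\<Sum>i\<in>{..d + e} - {e}. hcomp (d + e - i) f * hcomp i g) \<in> q"
      using hc[OF fg(3), of "d + e"] by simp
    have "(\<Sum>i\<in>{..d + e} - {e}. hcomp (d + e - i) f * hcomp i g) \<in> q"
    proof (rule ideal_sum[OF I])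
      fix i assume i: "i \<in> {..d + e} - {e}"
      show "hcomp (d + e - i) f * hcomp i g \<in> q"
      proof (cases "i > e")
        case True
        then show ?thesis using e fg qf(4) by blast
      next
        case False
        then have "d + e - i > d" using i by auto
        then show ?thesis using d fg qf(5) by blast
      qed
    qed
    then have "hcomp d f * hcomp e g \<in> q" using eq ideal_cancel[OF I] by blast
    then show False using prime[OF hcomp_forms[OF fg(1)] hcomp_forms[OF fg(2)]] d e by blast
  qed
  then show ?thesis using I q by (simp add: primeideal_iff)
qed

text \<open>A homogeneous ideal that is maximal among those containing \<open>J\<close> and missing
  all powers of \<open>s\<close> is prime. Here \<open>s\<close> may be inhomogeneous; primality is
  tested on forms because adjoining a form keeps the ideal homogeneous. This is the source of all
  points of projective schemes constructed below.\<close>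

lemma homogeneous_prime_avoiding:
  fixes J :: "'a::comm_ring_1 mpoly set"
  assumes J: "homogeneous_ideal n J" and s: "s \<in> polys n" "\<And>k. s ^ k \<notin> J"
  obtains q where "homogeneous_ideal n q" "primeideal q (mpoly_ring n)" "J \<subseteq> q" "s \<notin> q"
proof -
  define A where "A = {q. homogeneous_ideal n q \<and> J \<subseteq> q \<and> (\<forall>k. s ^ k \<notin> q)}"
  have "\<exists>M\<in>A. \<forall>Y\<in>A. M \<subseteq> Y \<longrightarrow> Y = M"
  proof (rule subset_Zorn_nonempty)
    show "A \<noteq> {}" unfolding A_def using assms by blast
    fix C assume C: "C \<noteq> {}" "subset.chain A C"
    have "homogeneous_ideal n (\<Union>C)"
      using C by (intro homogeneous_ideal_Union_chain) (auto simp: subset.chain_def A_def)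
    moreover have "J \<subseteq> \<Union>C" using C by (fastforce simp: subset.chain_def A_def)
    ultimately show "\<Union>C \<in> A" using C by (auto simp: subset.chain_def A_def)
  qed
  then obtain q where "q \<in> A" and max': "\<forall>Y\<in>A. q \<subseteq> Y \<longrightarrow> Y = q" by (elim bexE)
  then have q: "homogeneous_ideal n q" "J \<subseteq> q" "\<And>k. s ^ k \<notin> q" by (auto simp: A_def)
  have max: "Y = q" if "homogeneous_ideal n Y" "J \<subseteq> Y" "\<forall>k. s ^ k \<notin> Y" "q \<subseteq> Y" for Y
    using max' that by (simp add: A_def)
  have I: "ideal q (mpoly_ring n)" using q by (auto simp: homogeneous_ideal_iff)
  note qf = ideal_facts[OF I]
  \<comment> \<open>By maximality of \<open>q\<close>, adjoining a form outside it produces an ideal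
    that contains a power of \<open>s\<close>.\<close>
  have reach: "\<exists>k f g. s ^ k = f + g * a \<and> f \<in> q \<and> g \<in> polys n"
    if a: "a \<in> forms n (int d)" "a \<notin> q" for a d
  proof -
    let ?Y = "{f + g * a | f g. f \<in> q \<and> g \<in> polys n}"
    have "f + 0 * a \<in> ?Y" if "f \<in> q" for f using that polys_closed(1) by blast
    then have sub: "q \<subseteq> ?Y" by (simp add: subset_iff del: mem_Collect_eq)
    have "0 + 1 * a \<in> ?Y" using qf(2) polys_closed(2) by blast
    then have "a \<in> ?Y" by (simp del: mem_Collect_eq)
    then have "?Y \<noteq> q" using a(2) by metis
    then have "\<not> (\<forall>k. s ^ k \<notin> ?Y)"
      using max[OF homogeneous_ideal_add_principal[OF q(1) a(1)] order_trans[OF q(2) sub] _ sub]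
      by (rule contrapos_nn)
    then show ?thesis by blast
  qed
  have "a \<in> q \<or> b \<in> q" if ab: "a \<in> forms n (int d)" "b \<in> forms n (int e)" "a * b \<in> q" for a b d e
  proof (rule ccontr)
    assume "\<not> (a \<in> q \<or> b \<in> q)"
    then obtain k f g l f' g' where *: "s ^ k = f + g * a" "f \<in> q" "g \<in> polys n"
      "s ^ l = f' + g' * b" "f' \<in> q" "g' \<in> polys n"
      using reach ab by metis
    have a: "a \<in> polys n" "b \<in> polys n" using ab forms_polys by auto
    have "s ^ (k + l) = f * (f' + g' * b) + (g * a) * f' + (g * g') * (a * b)"
      unfolding power_add * by (simp add: algebra_simps)
    also have "\<dots> \<in> q"
      by (rule qf(3)[OF qf(3)[OF qf(5) qf(4)] qf(4)]) (use * a ab(3) qf(1) in auto)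
    finally show False using q(3) by blast
  qed
  moreover have "1 \<notin> q" using q(3)[of 0] by simp
  ultimately have "primeideal q (mpoly_ring n)" using homogeneous_primeI[OF q(1)] by blast
  moreover have "s \<notin> q" using q(3)[of 1] by simp
  ultimately show ?thesis using that q by blast
qed


section \<open>Substitution, evaluation and derivatives\<close>

lemma Var_power: "Var i ^ k = single (single i k) 1"
  by (induction k) (auto simp: Var_def mult_single single_add[symmetric])

lemma single_eq_prod_Var:
  "single m c = Const (c::'a::comm_ring_1) * (\<Prod>i\<in>keys m. Var i ^ lookup m i)"
proof -
  have *: "(\<Prod>i\<in>A. Var i ^ lookup m i) = (single (\<Sum>i\<in>A. single i (lookup m i)) 1 :: 'a mpoly)" for A
    by (induction A rule: infinite_finite_induct) (auto simp: Var_power mult_single)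
  have "(\<Sum>i\<in>keys m. single i (lookup m i)) = m"
    by (rule poly_mapping_eqI) (auto simp: lookup_sum lookup_single when_def in_keys_iff)
  then show ?thesis by (simp add: *)
qed

lemma mpoly_induct [consumes 1, case_names Const Var add mult]:
  fixes f :: "'a::comm_ring_1 mpoly"
  assumes "f \<in> polys n" and "\<And>c. P (Const c)" and "\<And>i. i \<le> n \<Longrightarrow> P (Var i)"
    and add: "\<And>f g. f \<in> polys n \<Longrightarrow> g \<in> polys n \<Longrightarrow> P f \<Longrightarrow> P g \<Longrightarrow> P (f + g)"
    and mult: "\<And>f g. f \<in> polys n \<Longrightarrow> g \<in> polys n \<Longrightarrow> P f \<Longrightarrow> P g \<Longrightarrow> P (f * g)"
  shows "P f"
proof -
  define Q where "Q f \<longleftrightarrow> f \<in> polys n \<and> P f" for f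
  have Q1: "Q 1" "Q 0" using assms(2)[of 1] assms(2)[of 0] by (auto simp: Q_def)
  have Qadd: "Q f \<Longrightarrow> Q g \<Longrightarrow> Q (f + g)" and Qmult: "Q f \<Longrightarrow> Q g \<Longrightarrow> Q (f * g)" for f g
    using add mult by (auto simp: Q_def)
  have Qpow: "Q f \<Longrightarrow> Q (f ^ k)" for f k by (induction k) (auto intro: Q1 Qmult)
  have Qprod: "(\<And>x. x \<in> A \<Longrightarrow> Q (h x)) \<Longrightarrow> Q (prod h A)" for h and A :: "nat set"
    by (induction A rule: infinite_finite_induct) (auto intro: Q1 Qmult)
  have Qsum: "(\<And>x. x \<in> A \<Longrightarrow> Q (h x)) \<Longrightarrow> Q (sum h A)" for h and A :: "(nat \<Rightarrow>\<^sub>0 nat) set"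
    by (induction A rule: infinite_finite_induct) (auto intro: Q1 Qadd)
  have "Q (single m (lookup f m))" if "m \<in> keys f" for m
  proof -
    have "Q (Var i)" if "i \<in> keys m" for i
    proof -
      have "i \<le> n" using that \<open>m \<in> keys f\<close> assms(1) by (auto simp: polys_iff)
      then show ?thesis by (simp add: Q_def assms(3))
    qed
    then show ?thesis unfolding single_eq_prod_Var[of m]
      by (intro Qmult Qprod Qpow) (auto simp: Q_def assms(2))
  qed
  then have "Q f" by (subst mpoly_expand) (rule Qsum)
  then show ?thesis by (simp add: Q_def)
qed

text \<open>The homomorphism given by the universal property of polynomial rings, with a separate
  map on coefficients so that evaluation at a point and substitution of polynomials are instances of
  one notion.\<close>

definition insertion :: "('a \<Rightarrow> 'b) \<Rightarrow> (nat \<Rightarrow> 'b) \<Rightarrow> 'a::comm_ring_1 mpoly \<Rightarrow> 'b::comm_ring_1" where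
  "insertion h s f = (\<Sum>m\<in>keys f. h (lookup f m) * (\<Prod>i\<in>keys m. s i ^ lookup m i))"

lemma insertion_hom:
  assumes h: "comm_ring_hom h"
  shows "comm_ring_hom (insertion h s)"
    and insertion_Const: "insertion h s (Const c) = h c"
    and insertion_Var: "insertion h s (Var i) = s i"
proof -
  interpret h: comm_ring_hom h by fact
  let ?v = "\<lambda>m. \<Prod>i\<in>keys m. s i ^ lookup m i"
  have v_add: "?v (a + b) = ?v a * ?v b" for a b
  proof -
    have wide: "?v m = (\<Prod>i\<in>keys a \<union> keys b. s i ^ lookup m i)" if "keys m \<subseteq> keys a \<union> keys b" for m
      using that by (intro prod.mono_neutral_left) (auto simp: in_keys_iff)
    have "?v (a + b) = (\<Prod>i\<in>keys a \<union> keys b. s i ^ lookup (a + b) i)"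
      by (rule wide) (simp add: keys_plus_nat)
    also have "\<dots> = ?v a * ?v b"
      by (simp add: lookup_add power_add prod.distrib wide[of a] wide[of b])
    finally show ?thesis .
  qed
  have wide: "insertion h s f = (\<Sum>m\<in>A. h (lookup f m) * ?v m)" if "finite A" "keys f \<subseteq> A" for f A
    unfolding insertion_def using that by (intro sum.mono_neutral_left) (auto simp: in_keys_iff)
  have add: "insertion h s (f + g) = insertion h s f + insertion h s g" for f g
  proof -
    have "insertion h s (f + g) = (\<Sum>m\<in>keys f \<union> keys g. h (lookup (f + g) m) * ?v m)"
      by (rule wide) (use Poly_Mapping.keys_add[of f g] in auto)
    also have "\<dots> = insertion h s f + insertion h s g"
      by (simp add: lookup_add h.hom_add distrib_right sum.distrib wide[of "keys f \<union> keys g"])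
    finally show ?thesis .
  qed
  have sng: "insertion h s (single m c) = h c * ?v m" for m c
    by (subst wide[of "{m}"]) (auto split: if_splits)
  have zero: "insertion h s 0 = 0" by (simp add: insertion_def)
  have sum: "insertion h s (sum f A) = (\<Sum>x\<in>A. insertion h s (f x))" for f and A :: "(nat \<Rightarrow>\<^sub>0 nat) set"
    by (induction A rule: infinite_finite_induct) (auto simp: zero add)
  have mult: "insertion h s (f * g) = insertion h s f * insertion h s g" for f g
    unfolding mult_expand[of f g] sum sng v_add h.hom_mult
    by (simp add: insertion_def sum_product mult_ac)
  have one: "insertion h s 1 = 1"
    using sng[of 0 1] by (simp add: h.hom_one)
  show "comm_ring_hom (insertion h s)"
    by unfold_locales (auto simp: add mult zero one)
  show "insertion h s (Const c) = h c" by (simp add: Const_def sng)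
  show "insertion h s (Var i) = s i" by (simp add: Var_def sng h.hom_one)
qed

lemma comm_ring_hom_id: "comm_ring_hom (\<lambda>x. x)"
  by unfold_locales auto

lemma comm_ring_hom_Const: "comm_ring_hom (Const :: 'a::comm_ring_1 \<Rightarrow> 'a mpoly)"
  by unfold_locales auto

abbreviation eval_at :: "(nat \<Rightarrow> 'a) \<Rightarrow> 'a::comm_ring_1 mpoly \<Rightarrow> 'a" where
  "eval_at \<equiv> insertion (\<lambda>x. x)"

abbreviation subst_vars :: "(nat \<Rightarrow> 'a mpoly) \<Rightarrow> 'a::comm_ring_1 mpoly \<Rightarrow> 'a mpoly" where
  "subst_vars \<equiv> insertion Const"

interpretation eval: comm_ring_hom "eval_at a" for a :: "nat \<Rightarrow> 'a::comm_ring_1"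
  by (rule insertion_hom[OF comm_ring_hom_id])

interpretation subst: comm_ring_hom "subst_vars s" for s :: "nat \<Rightarrow> 'a::comm_ring_1 mpoly"
  by (rule insertion_hom[OF comm_ring_hom_Const])

lemma eval_simps [simp]: "eval_at a (Const c) = c" "eval_at a (Var i) = a i"
  by (simp_all add: insertion_Const insertion_Var comm_ring_hom_id)

lemma subst_simps [simp]: "subst_vars s (Const c) = Const c" "subst_vars s (Var i) = s i"
  by (simp_all add: insertion_Const insertion_Var comm_ring_hom_Const)

lemma lookup_map_hom: "h 0 = 0 \<Longrightarrow> lookup (Poly_Mapping.map h f) m = h (lookup f m)"
  by (simp add: map.rep_eq when_def)

lemma map_hom:
  assumes h: "comm_ring_hom h"
  shows "comm_ring_hom (Poly_Mapping.map h :: 'a::comm_ring_1 mpoly \<Rightarrow> 'b::comm_ring_1 mpoly)"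
proof -
  interpret h: comm_ring_hom h by fact
  note lk = lookup_map_hom[of h, OF h.hom_zero]
  let ?m = "Poly_Mapping.map h :: 'a mpoly \<Rightarrow> 'b mpoly"
  have add: "?m (f + g) = ?m f + ?m g" for f g
    by (rule poly_mapping_eqI) (simp add: lk lookup_add h.hom_add)
  have zero: "?m 0 = 0" by (rule poly_mapping_eqI) (simp add: lk)
  have sng: "?m (single m c) = single m (h c)" for m c
    by (rule poly_mapping_eqI) (simp add: lk lookup_single when_def)
  have sum: "?m (sum f A) = (\<Sum>x\<in>A. ?m (f x))" for f and A :: "(nat \<Rightarrow>\<^sub>0 nat) set"
    by (induction A rule: infinite_finite_induct) (auto simp: zero add)
  have mult: "?m (f * g) = ?m f * ?m g" for f g
  proof -
    have "?m f * ?m g = (\<Sum>a\<in>keys f. single a (h (lookup f a))) * (\<Sum>b\<in>keys g. single b (h (lookup g b)))"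
      using mpoly_expand[of f] mpoly_expand[of g] by (metis (no_types, lifting) sng sum sum.cong)
    also have "\<dots> = ?m (f * g)"
      by (simp add: mult_expand[of f g] sum sng sum_product mult_single h.hom_mult)
    finally show ?thesis by simp
  qed
  have one: "?m 1 = 1" using sng[of 0 1] by (simp add: h.hom_one)
  show ?thesis by unfold_locales (auto simp: add mult zero one)
qed

lemma keys_map_hom: "h 0 = 0 \<Longrightarrow> keys (Poly_Mapping.map h f) \<subseteq> keys f"
  by (auto simp: in_keys_iff lookup_map_hom)

lemma map_forms: "h 0 = 0 \<Longrightarrow> f \<in> forms n i \<Longrightarrow> Poly_Mapping.map h f \<in> forms n i"
  using keys_map_hom[of h f] by (auto simp: forms_def polys_iff)

lemma map_polys: "h 0 = 0 \<Longrightarrow> f \<in> polys n \<Longrightarrow> Poly_Mapping.map h f \<in> polys n"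
  using keys_map_hom[of h f] by (auto simp: polys_iff)

section \<open>Partial derivatives\<close>

lemma partial_deriv_map:
  assumes "comm_ring_hom h"
  shows "partial_deriv i (Poly_Mapping.map h f) = Poly_Mapping.map h (partial_deriv i f)"
proof -
  interpret h: comm_ring_hom h by fact
  show ?thesis
    by (rule poly_mapping_eqI) (simp add: lookup_map_hom lookup_partial_deriv h.hom_mult h.hom_add h.hom_one h.hom_of_nat)
qed

lemma partial_deriv_add: "partial_deriv i (f + g) = partial_deriv i f + partial_deriv i g"
  by (rule poly_mapping_eqI) (simp add: lookup_partial_deriv lookup_add algebra_simps)

lemma partial_deriv_zero [simp]: "partial_deriv i 0 = 0"
  by (rule poly_mapping_eqI) (simp add: lookup_partial_deriv)

lemma partial_deriv_sum: "partial_deriv i (sum f A) = (\<Sum>x\<in>A. partial_deriv i (f x))"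
  by (induction A rule: infinite_finite_induct) (auto simp: partial_deriv_add)

lemma partial_deriv_single:
  "partial_deriv i (single m c) = single (m - single i 1) (of_nat (lookup m i) * c)"
  by (simp add: partial_deriv_def)

lemma partial_deriv_Const [simp]: "partial_deriv i (Const c) = 0"
  by (simp add: Const_def partial_deriv_single)

lemma partial_deriv_Var: "partial_deriv i (Var j) = (if i = j then 1 else 0)"
  by (simp add: Var_def partial_deriv_single lookup_single when_def)

text \<open>Subtraction of exponents is truncated, so the exponent of \<open>i\<close> has to be
  positive. In the product rule the remaining case carries the coefficient 0.\<close>

lemma monom_minus_add:
  "lookup a i \<noteq> 0 \<Longrightarrow> (a - single i 1) + b = (a + b) - single i (1::nat)"
  by (rule poly_mapping_eqI) (auto simp: lookup_add lookup_minus lookup_single when_def)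

lemma partial_deriv_mult:
  fixes f g :: "'a::comm_ring_1 mpoly"
  shows "partial_deriv i (f * g) = f * partial_deriv i g + g * partial_deriv i f"
proof -
  have sng: "partial_deriv i (single (a + b) (c * d)) =
      single a c * partial_deriv i (single b d) + single b d * partial_deriv i (single a c)"
    for a b and c d :: 'a
  proof -
    have 1: "single a c * partial_deriv i (single b d) = single (a + b - single i 1) (of_nat (lookup b i) * (c * d))"
      using monom_minus_add[of b i a]
      by (cases "lookup b i = 0") (simp_all add: partial_deriv_single mult_single add.commute mult_ac)
    have 2: "single b d * partial_deriv i (single a c) = single (a + b - single i 1) (of_nat (lookup a i) * (c * d))"
      using monom_minus_add[of a i b]
      by (cases "lookup a i = 0") (simp_all add: partial_deriv_single mult_single add.commute mult_ac)
    show ?thesis unfolding 1 2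
      by (simp add: partial_deriv_single lookup_add single_add[symmetric] distrib_right add.commute)
  qed
  let ?F = "\<lambda>a. single a (lookup f a)" and ?G = "\<lambda>b. single b (lookup g b)"
  have "partial_deriv i (f * g) = (\<Sum>a\<in>keys f. \<Sum>b\<in>keys g. ?F a * partial_deriv i (?G b) + ?G b * partial_deriv i (?F a))"
    by (simp add: mult_expand[of f g] partial_deriv_sum sng)
  also have "\<dots> = (\<Sum>a\<in>keys f. ?F a) * (\<Sum>b\<in>keys g. partial_deriv i (?G b)) +
      (\<Sum>b\<in>keys g. ?G b) * (\<Sum>a\<in>keys f. partial_deriv i (?F a))"
    by (simp add: sum.distrib sum_product) (rule sum.swap)
  also have "(\<Sum>b\<in>keys g. partial_deriv i (?G b)) = partial_deriv i g"
    using mpoly_expand[of g] by (simp add: partial_deriv_sum[symmetric])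
  also have "(\<Sum>a\<in>keys f. partial_deriv i (?F a)) = partial_deriv i f"
    using mpoly_expand[of f] by (simp add: partial_deriv_sum[symmetric])
  finally show ?thesis using mpoly_expand[of f] mpoly_expand[of g] by simp
qed

lemma keys_partial_deriv: "m \<in> keys (partial_deriv i f) \<Longrightarrow> m + single i 1 \<in> keys f"
  by (auto simp: in_keys_iff lookup_partial_deriv)

lemma partial_deriv_polys: "f \<in> polys n \<Longrightarrow> partial_deriv i f \<in> polys n"
  using keys_partial_deriv[of _ i f] by (fastforce simp: polys_iff keys_plus_nat)

lemma partial_deriv_forms: "f \<in> forms n d \<Longrightarrow> partial_deriv i f \<in> forms n (d - 1)"
  using keys_partial_deriv[of _ i f] partial_deriv_polys[of f n i] by (fastforce simp: forms_def)

lemma euler_identity: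
  fixes f :: "'a::comm_ring_1 mpoly"
  assumes "f \<in> forms n (int d)"
  shows "(\<Sum>i\<le>n. Var i * partial_deriv i f) = of_nat d * f"
proof -
  have sng: "(\<Sum>i\<le>n. Var i * partial_deriv i (single m (lookup f m))) = of_nat d * single m (lookup f m)"
    if m: "m \<in> keys f" for m
  proof -
    have "Var i * partial_deriv i (single m (lookup f m)) = Const (of_nat (lookup m i)) * single m (lookup f m)" for i
    proof (cases "lookup m i = 0")
      case False
      then have "single i 1 + (m - single i 1) = m"
        using monom_minus_add[of m i "single i 1"] by (simp add: add.commute)
      then show ?thesis by (simp add: Var_def partial_deriv_single mult_single)
    qed (simp add: partial_deriv_single)
    then have "(\<Sum>i\<le>n. Var i * partial_deriv i (single m (lookup f m))) =
        of_nat (\<Sum>i\<le>n. lookup m i) * single m (lookup f m)"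
      by (simp add: sum_distrib_right Const_of_nat del: Const_mult_single)
    also have "(\<Sum>i\<le>n. lookup m i) = d"
      using assms m mon_degree_wide[of "{..n}" m] by (auto simp: forms_iff polys_iff)
    finally show ?thesis .
  qed
  have "(\<Sum>i\<le>n. Var i * partial_deriv i f) =
      (\<Sum>i\<le>n. \<Sum>m\<in>keys f. Var i * partial_deriv i (single m (lookup f m)))"
    by (subst mpoly_expand[of f]) (simp add: partial_deriv_sum sum_distrib_left)
  also have "\<dots> = (\<Sum>m\<in>keys f. of_nat d * single m (lookup f m))"
    by (subst sum.swap) (simp add: sng)
  also have "\<dots> = of_nat d * f"
    by (subst (3) mpoly_expand[of f]) (simp add: sum_distrib_left)
  finally show ?thesis .
qed


section \<open>Counting monomials\<close>

text \<open>Stars and bars: reading off the exponents along an enumeration of \<open>S\<close>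
  identifies monomials with lists of prescribed length and sum.\<close>

lemma card_monomials_eq:
  assumes "finite S"
  shows "finite {m. keys m \<subseteq> S \<and> mon_degree m = k}"
    and "card {m. keys m \<subseteq> S \<and> mon_degree m = k} = (k + card S - 1) choose k"
proof -
  let ?M = "{m. keys m \<subseteq> S \<and> mon_degree m = k}"
  let ?L = "{l::nat list. length l = card S \<and> sum_list l = k}"
  define xs where "xs = sorted_list_of_set S"
  have xs: "set xs = S" "distinct xs" "length xs = card S"
    using assms by (auto simp: xs_def)
  let ?h = "\<lambda>m. map (lookup m) xs"
  have "bij_betw ?h ?M ?L"
  proof (rule bij_betwI')
    fix m m' assume m: "m \<in> ?M" "m' \<in> ?M"
    show "(?h m = ?h m') = (m = m')"
    proof
      assume eq: "?h m = ?h m'"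
      show "m = m'"
      proof (rule poly_mapping_eqI)
        fix i
        have "i \<notin> keys m" "i \<notin> keys m'" if "i \<notin> S" using m that by auto
        then show "lookup m i = lookup m' i"
          using eq xs(1) by (cases "i \<in> S") (auto simp: in_keys_iff)
      qed
    qed simp
  next
    fix m assume m: "m \<in> ?M"
    have "sum_list (?h m) = (\<Sum>i\<in>S. lookup m i)"
      using xs by (metis sum_list_distinct_conv_sum_set)
    then show "?h m \<in> ?L" using m xs mon_degree_wide[OF assms, of m] by auto
  next
    fix l assume l: "l \<in> ?L"
    define m where "m = (\<Sum>j<length xs. single (xs ! j) (l ! j))"
    have lk: "lookup m (xs ! j) = l ! j" if "j < length xs" for j
      using that xs by (simp add: m_def lookup_sum lookup_single when_def nth_eq_iff_index_eq)
    have "lookup m i = 0" if "i \<notin> S" for i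
      using that xs by (auto simp: m_def lookup_sum lookup_single when_def intro!: sum.neutral)
    then have sub: "keys m \<subseteq> S" by (auto simp: in_keys_iff)
    have h: "?h m = l" using lk l xs by (auto intro: nth_equalityI)
    have "sum_list (?h m) = (\<Sum>i\<in>S. lookup m i)"
      using xs by (metis sum_list_distinct_conv_sum_set)
    then have "mon_degree m = k" using sub mon_degree_wide[OF assms, of m] h l by auto
    then show "\<exists>m\<in>?M. l = ?h m" using sub h by blast
  qed
  then have bij: "card ?M = card ?L" "finite ?M \<longleftrightarrow> finite ?L"
    by (auto simp: bij_betw_same_card bij_betw_finite)
  have "?L \<subseteq> {l. set l \<subseteq> {..k} \<and> length l = card S}"
    using member_le_sum_list by fastforce
  moreover have "finite {l. set l \<subseteq> {..k} \<and> length l = card S}"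
    by (rule finite_lists_length_eq) simp
  ultimately show "finite ?M" using bij finite_subset by blast
  show "card ?M = (k + card S - 1) choose k"
    using bij card_length_sum_list[of "card S" k] by simp
qed

definition monomials :: "nat \<Rightarrow> nat \<Rightarrow> (nat \<Rightarrow>\<^sub>0 nat) set" where
  "monomials n k = {m. keys m \<subseteq> {..n} \<and> mon_degree m = k}"

lemma finite_monomials [simp]: "finite (monomials n k)"
  and card_monomials: "card (monomials n k) = (n + k) choose n"
proof -
  show "finite (monomials n k)" using card_monomials_eq(1)[of "{..n}" k] by (simp add: monomials_def)
  show "card (monomials n k) = (n + k) choose n"
    using card_monomials_eq(2)[of "{..n}" k] binomial_symmetric[of n "n + k"]
    by (simp add: monomials_def add.commute)
qed

lemma forms_expand:
  assumes "f \<in> forms n (int k)"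
  shows "f = (\<Sum>m\<in>monomials n k. Const (lookup f m) * single m 1)"
proof -
  have "keys f \<subseteq> monomials n k" using assms by (auto simp: forms_iff polys_iff monomials_def)
  then have "(\<Sum>m\<in>keys f. single m (lookup f m)) = (\<Sum>m\<in>monomials n k. single m (lookup f m))"
    by (intro sum.mono_neutral_left) (auto simp: in_keys_iff)
  then show ?thesis using mpoly_expand[of f] by simp
qed

interpretation mpv: vector_space "\<lambda>(c::'a::field) (f::'a mpoly). Const c * f"
  by unfold_locales (auto simp: algebra_simps)

text \<open>Formulated for an indexed family, because the forms to be counted arise from pairs of a
  zero and a monomial. Injectivity of the family comes from independence, tested on a relation with
  coefficients 1 and -1.\<close>

lemma independent_forms_card_le:
  fixes h :: "'x \<Rightarrow> 'a::field mpoly"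
  assumes fin: "finite A" and h: "\<And>x. x \<in> A \<Longrightarrow> h x \<in> forms n (int k)"
    and ind: "\<And>c. (\<Sum>x\<in>A. Const (c x) * h x) = 0 \<Longrightarrow> \<forall>x\<in>A. c x = 0"
  shows "card A \<le> (n + k) choose n"
proof -
  have inj: "inj_on h A"
  proof (rule inj_onI, rule ccontr)
    fix x y assume xy: "x \<in> A" "y \<in> A" "h x = h y" "x \<noteq> y"
    define c where "c = (\<lambda>z. if z = x then 1 else if z = y then - 1 else (0::'a))"
    have "(\<Sum>z\<in>A. Const (c z) * h z) = (\<Sum>z\<in>{x, y}. Const (c z) * h z)"
      using xy fin by (intro sum.mono_neutral_right) (auto simp: c_def)
    also have "\<dots> = 0" using xy by (simp add: c_def)
    finally show False using ind[of c] xy by (auto simp: c_def)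
  qed
  have "mpv.independent (h ` A)"
  proof (rule mpv.independent_if_scalars_zero)
    fix u x assume u: "(\<Sum>x\<in>h ` A. Const (u x) * x) = 0" and x: "x \<in> h ` A"
    have "(\<Sum>x\<in>A. Const (u (h x)) * h x) = 0" using u by (simp add: sum.reindex[OF inj])
    then show "u x = 0" using ind[of "\<lambda>x. u (h x)"] x by auto
  qed (use fin in simp)
  moreover have "h ` A \<subseteq> mpv.span ((\<lambda>m. single m 1) ` monomials n k)"
  proof safe
    fix x assume "x \<in> A"
    show "h x \<in> mpv.span ((\<lambda>m. single m 1) ` monomials n k)"
      by (subst forms_expand[OF h[OF \<open>x \<in> A\<close>]])
        (intro mpv.span_sum mpv.span_scale mpv.span_base, simp)
  qed
  ultimately have "card (h ` A) \<le> card ((\<lambda>m. single m (1::'a)) ` monomials n k)"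
    using mpv.independent_span_bound by (metis finite_imageI finite_monomials)
  also have "\<dots> \<le> card (monomials n k)" by (rule card_image_le) simp
  finally show ?thesis by (simp add: card_image[OF inj] card_monomials)
qed

section \<open>Weighted orders\<close>

definition wdeg :: "(nat \<Rightarrow> nat) \<Rightarrow> (nat \<Rightarrow>\<^sub>0 nat) \<Rightarrow> nat" where
  "wdeg w m = (\<Sum>i\<in>keys m. w i * lookup m i)"

lemma wdeg_wide: "finite A \<Longrightarrow> keys m \<subseteq> A \<Longrightarrow> wdeg w m = (\<Sum>i\<in>A. w i * lookup m i)"
  unfolding wdeg_def by (rule sum.mono_neutral_left) (auto simp: in_keys_iff)

lemma wdeg_simps [simp]:
  "wdeg w 0 = 0" "wdeg w (a + b) = wdeg w a + wdeg w b" "wdeg w (single i k) = w i * k"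
proof -
  have "wdeg w (a + b) = (\<Sum>i\<in>keys a \<union> keys b. w i * lookup (a + b) i)"
    by (rule wdeg_wide) (auto simp: keys_plus_nat)
  also have "\<dots> = wdeg w a + wdeg w b"
    by (simp add: lookup_add sum.distrib wdeg_wide[of "keys a \<union> keys b"] distrib_left)
  finally show "wdeg w (a + b) = wdeg w a + wdeg w b" .
qed (auto simp: wdeg_def)

lemma wdeg_ge_mon_degree:
  assumes "\<And>i. d \<le> w i" shows "d * mon_degree m \<le> wdeg w m"
  using assms by (auto simp: wdeg_def mon_degree_def sum_distrib_left intro!: sum_mono)

lemma mon_degree_eq_0_iff: "mon_degree m = 0 \<longleftrightarrow> m = 0"
  by (auto simp: mon_degree_def poly_mapping_eq_iff fun_eq_iff in_keys_iff)

text \<open>A multiplicative filtration: with all weights 1 it is given by the powers of the maximal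
  ideal at the origin. Unequal weights let one tangent direction count half as much as the
  others.\<close>

definition wge :: "(nat \<Rightarrow> nat) \<Rightarrow> nat \<Rightarrow> 'a::comm_ring_1 mpoly \<Rightarrow> bool" where
  "wge w k f \<longleftrightarrow> (\<forall>m\<in>keys f. k \<le> wdeg w m)"

lemma wge_simps [simp]: "wge w k 0" "wge w 0 f"
  by (auto simp: wge_def)

lemma wge_add: "wge w k f \<Longrightarrow> wge w k g \<Longrightarrow> wge w k (f + g)"
  by (auto simp: wge_def elim: keys_addE)

lemma wge_uminus: "wge w k f \<Longrightarrow> wge w k (- f)"
  by (auto simp: wge_def)

lemma wge_sum: "(\<And>x. x \<in> A \<Longrightarrow> wge w k (f x)) \<Longrightarrow> wge w k (sum f A)"
  by (induction A rule: infinite_finite_induct) (auto intro: wge_add)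

lemma wge_mult: "wge w k f \<Longrightarrow> wge w l g \<Longrightarrow> wge w (k + l) (f * g)"
  by (fastforce simp: wge_def elim!: keys_multE intro: add_mono)

lemma wge_mult_left: "wge w l g \<Longrightarrow> wge w l (f * g)"
  using wge_mult[of w 0 f l g] by simp

lemma wge_power: "wge w k f \<Longrightarrow> wge w (l * k) (f ^ l)"
  by (induction l) (auto intro: wge_mult)

lemma lookup_mult_0: "lookup (f * g) 0 = lookup f 0 * lookup (g :: 'a::comm_ring_1 mpoly) 0"
proof -
  have *: "a + b = 0 \<longleftrightarrow> a = 0 \<and> b = 0" for a b :: "nat \<Rightarrow>\<^sub>0 nat"
    by (auto simp: poly_mapping_eq_iff fun_eq_iff lookup_add)
  have "lookup (f * g) 0 = (\<Sum>a\<in>keys f. \<Sum>b\<in>keys g. if a = 0 \<and> b = 0 then lookup f a * lookup g b else 0)"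
    unfolding mult_expand[of f g] lookup_sum lookup_single when_def * ..
  also have "\<dots> = (\<Sum>a\<in>keys f. if a = 0 then \<Sum>b\<in>keys g. if b = 0 then lookup f a * lookup g b else 0 else 0)"
    by (intro sum.cong) auto
  also have "\<dots> = lookup f 0 * lookup g 0"
    by (auto simp: in_keys_iff)
  finally show ?thesis .
qed

text \<open>The polynomial \<open>u\<close> is a unit in the local ring at the origin. A monomial of
  least weight in \<open>g\<close> survives in \<open>u * g\<close>, multiplied by the constant term
  of \<open>u\<close>, because every other contribution to it would need a lighter monomial of
  \<open>g\<close>.\<close>

lemma wge_cancel:
  fixes u g :: "'a::field mpoly"
  assumes w: "\<And>i. 1 \<le> w i" and u: "lookup u 0 \<noteq> 0" and ug: "wge w k (u * g)"
  shows "wge w k g"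
proof (rule ccontr)
  assume "\<not> wge w k g"
  then obtain b0 where b0: "b0 \<in> keys g" "wdeg w b0 < k" by (auto simp: wge_def not_le)
  define b where "b = arg_min_on (wdeg w) (keys g)"
  have "keys g \<noteq> {}" using b0 by blast
  then have b: "b \<in> keys g" "\<And>x. x \<in> keys g \<Longrightarrow> wdeg w b \<le> wdeg w x"
    unfolding b_def
    by (rule arg_min_if_finite(1)[OF finite_keys], rule arg_min_least[OF finite_keys])
  have pos: "0 < wdeg w a" if "a \<noteq> 0" for a
    using wdeg_ge_mon_degree[of 1 w a] w mon_degree_eq_0_iff[of a] that by auto
  have *: "a + c = b \<longleftrightarrow> a = 0 \<and> c = b" if "c \<in> keys g" for a c
    using b(2)[OF that] pos[of a] by (cases "a = 0") auto
  have "lookup (u * g) b = (\<Sum>a\<in>keys u. \<Sum>c\<in>keys g. if a + c = b then lookup u a * lookup g c else 0)"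
    unfolding mult_expand[of u g] lookup_sum lookup_single when_def ..
  also have "\<dots> = (\<Sum>a\<in>keys u. \<Sum>c\<in>keys g. if a = 0 \<and> c = b then lookup u a * lookup g c else 0)"
    by (intro sum.cong refl) (simp add: *)
  also have "\<dots> = (\<Sum>a\<in>keys u. if a = 0 then \<Sum>c\<in>keys g. if c = b then lookup u a * lookup g c else 0 else 0)"
    by (intro sum.cong) auto
  also have "\<dots> = lookup u 0 * lookup g b"
    by (auto simp: in_keys_iff)
  finally have "b \<in> keys (u * g)" using u b(1) by (simp add: in_keys_iff)
  then show False using ug b(2)[OF b0(1)] b0(2) by (auto simp: wge_def)
qed


section \<open>Ideals generated by finitely many forms\<close>

lemma genideal_image_repr:
  fixes g :: "'x \<Rightarrow> 'a::comm_ring_1 mpoly"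
  assumes fin: "finite T" and g: "g ` T \<subseteq> polys n" and f: "f \<in> genideal (mpoly_ring n) (g ` T)"
  obtains A where "\<And>t. A t \<in> polys n" "f = (\<Sum>t\<in>T. A t * g t)"
proof -
  define J where "J = {f. \<exists>A. (\<forall>t. A t \<in> polys n) \<and> f = (\<Sum>t\<in>T. A t * g t)}"
  have "ideal J (mpoly_ring n)"
    unfolding ideal_iff
  proof (intro conjI ballI)
    show "J \<subseteq> polys n" using g by (auto simp: J_def intro!: sum_polys)
    show "0 \<in> J" unfolding J_def by (auto intro!: exI[of _ "\<lambda>_. 0"])
  next
    fix x y :: "'a mpoly" assume "x \<in> J" "y \<in> J"
    then obtain A B where "\<And>t. A t \<in> polys n" "x = (\<Sum>t\<in>T. A t * g t)"
      "\<And>t. B t \<in> polys n" "y = (\<Sum>t\<in>T. B t * g t)" by (auto simp: J_def)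
    then show "x + y \<in> J"
      by (auto simp: J_def sum.distrib distrib_right intro!: exI[of _ "\<lambda>t. A t + B t"])
  next
    fix x y :: "'a mpoly" assume "x \<in> J" "y \<in> polys n"
    then obtain A where "\<And>t. A t \<in> polys n" "x = (\<Sum>t\<in>T. A t * g t)" by (auto simp: J_def)
    then show "y * x \<in> J" using \<open>y \<in> polys n\<close>
      by (auto simp: J_def sum_distrib_left mult.assoc intro!: exI[of _ "\<lambda>t. y * A t"])
  qed
  moreover have "g t \<in> J" if "t \<in> T" for t
  proof -
    have "g t = (\<Sum>s\<in>T. (if s = t then 1 else 0) * g s)"
      using fin that by (simp add: if_distrib[of "\<lambda>x. x * _"] cong: if_cong)
    then show ?thesis unfolding J_def by (auto intro!: exI[of _ "\<lambda>s. if s = t then 1 else 0"])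
  qed
  ultimately have "f \<in> J" using genideal_mpoly(3)[OF g] f by blast
  then show ?thesis using that by (auto simp: J_def)
qed

lemma genideal_forms_repr:
  fixes g :: "'x \<Rightarrow> 'a::comm_ring_1 mpoly"
  assumes fin: "finite T" and g: "\<And>t. t \<in> T \<Longrightarrow> g t \<in> forms n (int (d t))"
    and f: "f \<in> genideal (mpoly_ring n) (g ` T)" "f \<in> forms n (int i)"
  obtains A where "\<And>t. t \<in> T \<Longrightarrow> A t \<in> forms n (int i - int (d t))" "f = (\<Sum>t\<in>T. A t * g t)"
proof -
  have gp: "g ` T \<subseteq> polys n" using g forms_polys by blast
  obtain A where A: "\<And>t. A t \<in> polys n" "f = (\<Sum>t\<in>T. A t * g t)"
    using genideal_image_repr[OF fin gp f(1)] by blast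
  \<comment> \<open>For \<open>d t > i\<close> the coefficient is 0, the only form of the then
    negative degree \<open>int i - int (d t)\<close>.\<close>
  define B where "B t = (if d t \<le> i then hcomp (i - d t) (A t) else 0)" for t
  have "f = hcomp i f" using hcomp_of_form[OF f(2)] by simp
  also have "\<dots> = (\<Sum>t\<in>T. hcomp i (A t * g t))" by (simp add: A(2) hcomp_sum)
  also have "\<dots> = (\<Sum>t\<in>T. B t * g t)"
    by (intro sum.cong refl) (simp add: hcomp_mult_form[OF g A(1)] B_def)
  finally have "f = (\<Sum>t\<in>T. B t * g t)" .
  moreover have "B t \<in> forms n (int i - int (d t))" for t
    using hcomp_forms[OF A(1)[of t], of "i - d t"]
    by (auto simp: B_def of_nat_diff intro: forms_closed(1))
  ultimately show ?thesis using that by blast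
qed

lemma genideal_homogeneous:
  fixes S :: "'a::comm_ring_1 mpoly set"
  assumes "\<And>f. f \<in> S \<Longrightarrow> \<exists>d. f \<in> forms n d"
  shows "homogeneous_ideal n (genideal (mpoly_ring n) S)"
proof -
  have S: "S \<subseteq> polys n" using assms forms_polys by blast
  let ?I = "genideal (mpoly_ring n) S"
  let ?T = "{f \<in> ?I. \<exists>d. f \<in> forms n d}"
  have I: "ideal ?I (mpoly_ring n)" "S \<subseteq> ?I" using genideal_mpoly[OF S] by auto
  have T: "?T \<subseteq> polys n" using forms_polys by blast
  have "S \<subseteq> ?T" using I(2) assms by blast
  then have "S \<subseteq> genideal (mpoly_ring n) ?T" using genideal_mpoly(2)[OF T] by blast
  then have "?I \<subseteq> genideal (mpoly_ring n) ?T"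
    using genideal_mpoly(3)[OF S genideal_mpoly(1)[OF T]] by blast
  moreover have "genideal (mpoly_ring n) ?T \<subseteq> ?I" using genideal_mpoly(3)[OF T I(1)] by blast
  ultimately show ?thesis using I(1) unfolding homogeneous_ideal_def by blast
qed

text \<open>Pigeonhole: a monomial of degree above the sum of the exponents \<open>N i\<close> is
  divisible by some \<open>Var i ^ N i\<close>.\<close>

lemma ideal_contains_high_degrees:
  fixes J :: "'a::comm_ring_1 mpoly set"
  assumes J: "ideal J (mpoly_ring n)" and pow: "\<And>i. i \<le> n \<Longrightarrow> \<exists>N. Var i ^ N \<in> J"
  obtains c where "\<And>i. c \<le> i \<Longrightarrow> forms n (int i) \<subseteq> J"
proof -
  note Jf = ideal_facts[OF J]
  obtain N where N: "\<And>i. i \<le> n \<Longrightarrow> Var i ^ N i \<in> J" using pow by metis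
  have mono: "single m x \<in> J" if m: "keys m \<subseteq> {..n}" "(\<Sum>i\<le>n. N i) < mon_degree m" for m x
  proof -
    have "\<exists>i\<le>n. N i \<le> lookup m i"
    proof (rule ccontr)
      assume "\<not> ?thesis"
      then have "(\<Sum>i\<le>n. lookup m i) \<le> (\<Sum>i\<le>n. N i)" by (intro sum_mono) (meson atMost_iff nle_le)
      then show False using m mon_degree_wide[of "{..n}" m] by simp
    qed
    then obtain i where i: "i \<le> n" "N i \<le> lookup m i" by blast
    have "single i (N i) + (m - single i (N i)) = m"
      using i by (intro poly_mapping_eqI) (auto simp: lookup_add lookup_minus lookup_single when_def)
    then have "single m x = single (m - single i (N i)) x * Var i ^ N i"
      by (simp add: Var_power mult_single add.commute)
    moreover have "keys (m - single i (N i)) \<subseteq> {..n}"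
      using m(1) by (auto simp: in_keys_iff lookup_minus subset_iff)
    ultimately show ?thesis using Jf(4) N[OF i(1)] single_polys by metis
  qed
  have "forms n (int i) \<subseteq> J" if "Suc (\<Sum>i\<le>n. N i) \<le> i" for i
  proof safe
    fix f :: "'a mpoly" assume f: "f \<in> forms n (int i)"
    show "f \<in> J"
      by (subst mpoly_expand, rule ideal_sum[OF J])
        (use f that mono in \<open>auto simp: forms_iff polys_iff\<close>)
  qed
  then show ?thesis using that by blast
qed

text \<open>A weak projective Nullstellensatz. If no power of \<open>Var i\<close> lay in the ideal,
  a homogeneous prime over the ideal avoiding \<open>Var i\<close> would be a common zero.\<close>

lemma genideal_contains_high_degrees:
  fixes S :: "'a::field mpoly set"
  assumes S: "\<And>f. f \<in> S \<Longrightarrow> \<exists>d. f \<in> forms n d"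
    and empty: "proj_zeros n S = {}"
  obtains c where "\<And>i. c \<le> i \<Longrightarrow> forms n (int i) \<subseteq> genideal (mpoly_ring n) S"
proof -
  let ?J = "genideal (mpoly_ring n) S"
  have Sp: "S \<subseteq> polys n" using S forms_polys by blast
  have "\<exists>N. Var i ^ N \<in> ?J" if i: "i \<le> n" for i
  proof (rule ccontr)
    assume "\<not> ?thesis"
    then obtain q where q: "homogeneous_ideal n q" "primeideal q (mpoly_ring n)" "?J \<subseteq> q" "Var i \<notin> q"
      using homogeneous_prime_avoiding[OF genideal_homogeneous[OF S] Var_polys[OF i]] by blast
    then have "q \<in> proj_zeros n S"
      using genideal_mpoly(2)[OF Sp] i unfolding proj_zeros_def proj_space_def by blast
    then show False using empty by blast
  qed
  then show ?thesis using ideal_contains_high_degrees[OF genideal_mpoly(1)[OF Sp]] that by blast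
qed

section \<open>A bound for the multiplicities of zeros\<close>

text \<open>Every use of the generation hypothesis \<open>c\<close> splits off a factor \<open>l\<close> or moves one step up the
  filtration at the cost of \<open>\<alpha>\<close> degrees, and the latter happens only \<open>t\<close> times.\<close>

lemma reduce_modulo_filtration:
  fixes G :: "'a::comm_ring_1 mpoly set"
  assumes G: "finite G" "G \<subseteq> forms n (int \<alpha>)" and l: "l \<in> forms n (int d)"
    and c: "\<And>i. c \<le> i \<Longrightarrow> forms n (int i) \<subseteq> genideal (mpoly_ring n) (insert l G)"
    and F0: "polys n \<subseteq> F 0" and Fadd: "\<And>t f g. f \<in> F t \<Longrightarrow> g \<in> F t \<Longrightarrow> f + g \<in> F t"
    and Fz: "\<And>t. 0 \<in> F t" and FG: "\<And>t f g. f \<in> F t \<Longrightarrow> g \<in> G \<Longrightarrow> f * g \<in> F (Suc t)"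
    and i: "\<alpha> * t + c \<le> i" and f: "f \<in> forms n (int i)"
  shows "\<exists>h\<in>forms n (int i - int d). f - l * h \<in> F t"
  using i f
proof (induction t arbitrary: i f)
  case 0
  show ?case using 0 F0 forms_polys by (intro bexI[of _ 0]) (auto intro: forms_closed)
next
  case (Suc t)
  \<comment> \<open>The option type keeps \<open>l\<close> apart from the members of
    \<open>G\<close>: \<open>l\<close> may itself belong to \<open>G\<close>, and the degree of a
    generator must be a function of its index.\<close>
  let ?T = "insert None (Some ` G)"
  define g where "g = (\<lambda>x. case x of None \<Rightarrow> l | Some y \<Rightarrow> y)"
  define e where "e = (\<lambda>x. case x of None \<Rightarrow> d | Some (y::'a mpoly) \<Rightarrow> \<alpha>)"
  have im: "g ` ?T = insert l G" by (auto simp: g_def image_iff)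
  have g: "t \<in> ?T \<Longrightarrow> g t \<in> forms n (int (e t))" for t using G l by (auto simp: g_def e_def)
  have "f \<in> genideal (mpoly_ring n) (g ` ?T)" using c[of i] Suc.prems unfolding im by auto
  then obtain A where A: "\<And>t. t \<in> ?T \<Longrightarrow> A t \<in> forms n (int i - int (e t))" "f = (\<Sum>t\<in>?T. A t * g t)"
    using genideal_forms_repr[of ?T g n e, OF _ g _ Suc.prems(2)] G(1) by blast
  have f: "f = A None * l + (\<Sum>y\<in>G. A (Some y) * y)"
    using G(1) by (simp add: A(2) sum.reindex g_def)
  have "\<exists>h\<in>forms n (int i - int \<alpha> - int d). A (Some y) - l * h \<in> F t" if "y \<in> G" for y
  proof -
    have "A (Some y) \<in> forms n (int (i - \<alpha>))"
      using A(1)[of "Some y"] that Suc.prems(1) by (auto simp: e_def of_nat_diff)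
    then show ?thesis using Suc.IH[of "i - \<alpha>" "A (Some y)"] Suc.prems(1) by (auto simp: of_nat_diff)
  qed
  then obtain h where h: "\<And>y. y \<in> G \<Longrightarrow> h y \<in> forms n (int i - int \<alpha> - int d)"
    "\<And>y. y \<in> G \<Longrightarrow> A (Some y) - l * h y \<in> F t" by metis
  define H where "H = A None + (\<Sum>y\<in>G. h y * y)"
  have "h y * y \<in> forms n (int i - int d)" if "y \<in> G" for y
    using forms_closed(6)[OF h(1)[OF that], of y "int \<alpha>"] G that by (auto simp: algebra_simps)
  moreover have "A None \<in> forms n (int i - int d)" using A(1)[of None] by (simp add: e_def)
  ultimately have "H \<in> forms n (int i - int d)"
    unfolding H_def by (intro forms_closed sum_forms) auto
  moreover have "f - l * H = (\<Sum>y\<in>G. (A (Some y) - l * h y) * y)"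
    by (simp add: f H_def algebra_simps sum_distrib_left sum_subtractf)
  moreover have "sum u G' \<in> F (Suc t)" if "\<And>y. y \<in> G' \<Longrightarrow> u y \<in> F (Suc t)" for u and G' :: "'a mpoly set"
    using that by (induction G' rule: infinite_finite_induct) (auto intro: Fz Fadd)
  ultimately show ?case using h(2) FG by (intro bexI[of _ H]) auto
qed

text \<open>The forms used for testing have a large degree, but only forms of degree
  \<open>b\<close> are to be counted. Splitting off \<open>l\<close> repeatedly brings every form of
  degree \<open>b + s * d\<close> down to degree \<open>b\<close>.\<close>

lemma reduce_modulo_filtration_iter:
  fixes l :: "'a::comm_ring_1 mpoly"
  assumes step: "\<And>i f. b \<le> i \<Longrightarrow> f \<in> forms n (int i) \<Longrightarrow> \<exists>h\<in>forms n (int i - int d). f - l * h \<in> N"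
    and Nadd: "\<And>f g. f \<in> N \<Longrightarrow> g \<in> N \<Longrightarrow> f + g \<in> N" and Nmul: "\<And>f. f \<in> N \<Longrightarrow> l * f \<in> N"
    and Nz: "0 \<in> N" and f: "f \<in> forms n (int (b + s * d))"
  shows "\<exists>h\<in>forms n (int b). f - l ^ s * h \<in> N"
  using f
proof (induction s arbitrary: f)
  case 0
  then show ?case by (intro bexI[of _ f]) (auto simp: Nz)
next
  case (Suc s)
  obtain h where h: "h \<in> forms n (int (b + Suc s * d) - int d)" "f - l * h \<in> N"
    using step[OF _ Suc.prems] by auto
  then have "h \<in> forms n (int (b + s * d))" by simp
  then obtain h' where h': "h' \<in> forms n (int b)" "h - l ^ s * h' \<in> N" using Suc.IH by blast
  have "f - l ^ Suc s * h' = (f - l * h) + l * (h - l ^ s * h')" by (simp add: algebra_simps)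
  also have "\<dots> \<in> N" using h h' Nadd Nmul by blast
  finally show ?case using h' by blast
qed


section \<open>Simultaneous local expansion at all zeros\<close>

lemma lookup_subst_0:
  fixes f :: "'a::comm_ring_1 mpoly"
  assumes "f \<in> polys n" "\<And>i. i \<le> n \<Longrightarrow> lookup (s i) 0 = p i"
  shows "lookup (subst_vars s f) 0 = eval_at p f"
  using assms(1)
  by (induction rule: mpoly_induct)
    (simp_all add: assms(2) subst.hom_add subst.hom_mult eval.hom_add eval.hom_mult lookup_add
      lookup_mult_0, simp add: Const_def)

lemma wge_1:
  assumes "\<And>i. 1 \<le> w i" "lookup f 0 = 0" shows "wge w 1 f"
  unfolding wge_def
proof
  fix m assume "m \<in> keys f"
  then have "m \<noteq> 0" using assms(2) by (auto simp: in_keys_iff)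
  then show "1 \<le> wdeg w m"
    using wdeg_ge_mon_degree[of 1 w m] assms(1) mon_degree_eq_0_iff[of m] by auto
qed

text \<open>Modulo polynomials of weighted order \<open>2 * k\<close> at all points of
  \<open>Q\<close>, every form of a suitable large degree is a power of \<open>l\<close> times a
  form of degree \<open>\<alpha> * k + c\<close>. So the forms of that degree must separate the
  local monomials of weight below \<open>2 * k\<close> at all points at once, and this bounds the
  number of such monomials. By \<open>Gw\<close> each factor from \<open>G\<close> raises the order
  by 2. The forms \<open>e x\<close> separate the points, \<open>s x\<close> is a local chart, and
  \<open>lam x\<close> lifts the local coordinates to linear forms.\<close>

lemma zeros_count_le:
  fixes p :: "'q \<Rightarrow> nat \<Rightarrow> 'a::field" and e :: "'q \<Rightarrow> 'a mpoly"
  assumes finQ: "finite Q" and G: "finite G" "G \<subseteq> forms n (int \<alpha>)"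
    and zeros: "\<And>q. q \<in> proj_zeros n G \<Longrightarrow> \<exists>x\<in>Q. \<forall>f\<in>q. eval_at (p x) f = 0"
    and d: "1 \<le> d" and e: "\<And>x. x \<in> Q \<Longrightarrow> e x \<in> forms n (int d)"
    and ep: "\<And>x y. x \<in> Q \<Longrightarrow> y \<in> Q \<Longrightarrow> eval_at (p x) (e y) = 0 \<longleftrightarrow> x \<noteq> y"
    and s: "\<And>x i. x \<in> Q \<Longrightarrow> i \<le> n \<Longrightarrow> lookup (s x i) 0 = p x i"
    and i0: "\<And>x. x \<in> Q \<Longrightarrow> i0 x \<le> n"
    and lam: "\<And>x i. x \<in> Q \<Longrightarrow> i \<le> n \<Longrightarrow> lam x i \<in> forms n 1"
      "\<And>x i. x \<in> Q \<Longrightarrow> i \<le> n \<Longrightarrow> subst_vars (s x) (lam x i) = (if i = i0 x then 1 else Var i)"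
    and w: "\<And>x i. x \<in> Q \<Longrightarrow> 1 \<le> w x i"
    and Gw: "\<And>x g. x \<in> Q \<Longrightarrow> g \<in> G \<Longrightarrow> wge (w x) 2 (subst_vars (s x) g)"
  obtains c where
    "\<And>k. (\<Sum>x\<in>Q. card {b. keys b \<subseteq> {..n} - {i0 x} \<and> wdeg (w x) b < 2 * k}) \<le> (n + (\<alpha> * k + c)) choose n"
proof -
  define l where "l = (\<Sum>y\<in>Q. e y)"
  have l: "l \<in> forms n (int d)" unfolding l_def using e by (intro sum_forms) auto
  have lp: "eval_at (p x) l \<noteq> 0" if "x \<in> Q" for x
  proof -
    have "eval_at (p x) l = (\<Sum>y\<in>Q. eval_at (p x) (e y))" by (simp add: l_def eval.hom_sum)
    also have "\<dots> = (\<Sum>y\<in>{x}. eval_at (p x) (e y))"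
      using that finQ ep by (intro sum.mono_neutral_right) auto
    finally show ?thesis using ep that by simp
  qed
  have "proj_zeros n (insert l G) = {}"
    using zeros lp unfolding proj_zeros_def by fastforce
  \<comment> \<open>The constant \<open>c\<close> depends on \<open>l\<close> and \<open>G\<close>
    only and is fixed before \<open>k\<close>, as the asymptotic comparison requires.\<close>
  then obtain c where c: "\<And>i. c \<le> i \<Longrightarrow> forms n (int i) \<subseteq> genideal (mpoly_ring n) (insert l G)"
    using genideal_contains_high_degrees[of "insert l G" n] l G(2) by blast
  have "(\<Sum>x\<in>Q. card {b. keys b \<subseteq> {..n} - {i0 x} \<and> wdeg (w x) b < 2 * k}) \<le> (n + (\<alpha> * k + c)) choose n" for k
  proof -
    define F where "F t = {f \<in> polys n. \<forall>x\<in>Q. wge (w x) (2 * t) (subst_vars (s x) f)}" for t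
    have Fadd: "f \<in> F t \<Longrightarrow> g \<in> F t \<Longrightarrow> f + g \<in> F t" for f g t
      by (auto simp: F_def subst.hom_add wge_add)
    have Fz: "0 \<in> F t" for t by (simp add: F_def)
    have Fmul: "f \<in> F t \<Longrightarrow> g \<in> polys n \<Longrightarrow> g * f \<in> F t" for f g t
      by (auto simp: F_def subst.hom_mult intro: wge_mult_left)
    have FG: "f \<in> F t \<Longrightarrow> g \<in> G \<Longrightarrow> f * g \<in> F (Suc t)" for f g t
      using G(2) forms_polys Gw wge_mult[of _ "2 * t" _ 2]
      by (fastforce simp: F_def subst.hom_mult)
    have F0: "polys n \<subseteq> F 0" by (auto simp: F_def)
    define b where "b = \<alpha> * k + c"
    \<comment> \<open>The test forms use degree \<open>2 * k * d\<close> for a power of a separating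
      form and less than \<open>2 * k\<close> for a local monomial. Since \<open>1 \<le> d\<close>,
      \<open>S \<le> S * d \<le> M\<close> leaves room for both.\<close>
    define S where "S = 2 * k * d + 2 * k"
    define M where "M = b + S * d"
    have M: "2 * k * d + 2 * k \<le> M" using d by (simp add: M_def S_def trans_le_add2)
    have step: "\<exists>h\<in>forms n (int i - int d). f - l * h \<in> F k"
      if "b \<le> i" "f \<in> forms n (int i)" for i f
      using reduce_modulo_filtration[of G n \<alpha> l d c F k i f] G l c F0 Fadd Fz FG that
      unfolding b_def by blast
    have red: "\<exists>h\<in>forms n (int b). f - l ^ S * h \<in> F k" if "f \<in> forms n (int M)" for f
      using reduce_modulo_filtration_iter[of b n d l "F k" f S] step Fadd Fmul Fz that
        forms_polys[OF l] unfolding M_def by blast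
    define B where "B x = {b. keys b \<subseteq> {..n} - {i0 x} \<and> wdeg (w x) b < 2 * k}" for x
    have Bdeg: "mon_degree \<beta> < 2 * k" if "x \<in> Q" "\<beta> \<in> B x" for x \<beta>
      using wdeg_ge_mon_degree[of 1 "w x" \<beta>] w that by (fastforce simp: B_def)
    have finB: "finite (B x)" if "x \<in> Q" for x
    proof (rule finite_subset)
      show "B x \<subseteq> (\<Union>j<2 * k. monomials n j)"
        using Bdeg[OF that] by (auto simp: B_def monomials_def)
    qed auto
    \<comment> \<open>The power of \<open>e x\<close> is a unit at \<open>x\<close> and has order at
      least \<open>2 * k\<close> at the other points. The factors \<open>lam x i\<close> reproduce
      the monomial \<open>\<beta>\<close> at \<open>x\<close>; the last factor becomes 1 in the
      chart and only fills up the degree to \<open>M\<close>.\<close>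
    define fam where "fam z = (case z of (x, \<beta>) \<Rightarrow> e x ^ (2 * k) *
      ((\<Prod>i\<in>keys \<beta>. lam x i ^ lookup \<beta> i) * lam x (i0 x) ^ (M - 2 * k * d - mon_degree \<beta>)))" for z
    have fam: "fam z \<in> forms n (int M)" if zQ: "z \<in> Sigma Q B" for z
    proof -
      obtain x \<beta> where z: "z = (x, \<beta>)" "x \<in> Q" "\<beta> \<in> B x" using zQ by (cases z) auto
      have "(\<Prod>i\<in>keys \<beta>. lam x i ^ lookup \<beta> i) \<in> forms n (\<Sum>i\<in>keys \<beta>. int (lookup \<beta> i) * 1)"
        using z lam(1) by (intro prod_forms forms_closed) (auto simp: B_def)
      moreover have "(\<Sum>i\<in>keys \<beta>. int (lookup \<beta> i) * 1) = int (mon_degree \<beta>)"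
        by (simp add: mon_degree_def)
      moreover have "lam x (i0 x) ^ j \<in> forms n (int j * 1)" for j
        using lam(1) i0 z by (intro forms_closed) auto
      moreover have "e x ^ (2 * k) \<in> forms n (int (2 * k) * int d)"
        using e z by (intro forms_closed) auto
      ultimately have "fam z \<in> forms n (int (2 * k) * int d + (int (mon_degree \<beta>) +
          int (M - 2 * k * d - mon_degree \<beta>) * 1))"
        unfolding z fam_def by (auto intro!: forms_closed)
      also have "int (2 * k) * int d + (int (mon_degree \<beta>) + int (M - 2 * k * d - mon_degree \<beta>) * 1) = int M"
        using M Bdeg[OF z(2,3)] by (simp add: of_nat_diff)
      finally show ?thesis .
    qed
    obtain h where h: "\<And>z. z \<in> Sigma Q B \<Longrightarrow> h z \<in> forms n (int b)"
      "\<And>z. z \<in> Sigma Q B \<Longrightarrow> fam z - l ^ S * h z \<in> F k"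
      using red[OF fam] by metis
    have own: "subst_vars (s x) (fam (x, \<beta>)) = subst_vars (s x) (e x) ^ (2 * k) * single \<beta> 1"
      if "x \<in> Q" "\<beta> \<in> B x" for x \<beta>
    proof -
      have "i \<le> n \<and> i \<noteq> i0 x" if "i \<in> keys \<beta>" for i
        using \<open>\<beta> \<in> B x\<close> that by (auto simp: B_def)
      then have "(\<Prod>i\<in>keys \<beta>. subst_vars (s x) (lam x i) ^ lookup \<beta> i) = (\<Prod>i\<in>keys \<beta>. Var i ^ lookup \<beta> i)"
        using lam(2)[OF that(1)] by (intro prod.cong refl) simp
      then show ?thesis using lam(2)[OF that(1) i0[OF that(1)]]
        by (simp add: fam_def subst.hom_mult subst.hom_power subst.hom_prod single_eq_prod_Var[of \<beta>])
    qed
    have other: "wge (w x) (2 * k) (subst_vars (s x) (fam (y, \<beta>)))"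
      if "x \<in> Q" "y \<in> Q" "x \<noteq> y" for x y \<beta>
    proof -
      have "lookup (subst_vars (s x) (e y)) 0 = 0"
        using lookup_subst_0[OF forms_polys[OF e[OF that(2)]] s] ep that by simp
      then have "wge (w x) (2 * k * 1) (subst_vars (s x) (e y) ^ (2 * k))"
        using w that by (intro wge_power wge_1) auto
      then show ?thesis
        using wge_mult[of "w x" "2 * k" _ 0] by (simp add: fam_def subst.hom_mult subst.hom_power)
    qed
    have "card (Sigma Q B) \<le> (n + b) choose n"
    proof (rule independent_forms_card_le[where h = h])
      show "finite (Sigma Q B)" using finQ finB by auto
      show "h z \<in> forms n (int b)" if "z \<in> Sigma Q B" for z using h(1) that .
      fix c assume c0: "(\<Sum>z\<in>Sigma Q B. Const (c z) * h z) = 0"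
      have Fsum: "sum u A' \<in> F k" if "\<And>z. z \<in> A' \<Longrightarrow> u z \<in> F k" for u and A' :: "('q \<times> (nat \<Rightarrow>\<^sub>0 nat)) set"
        using that by (induction A' rule: infinite_finite_induct) (auto intro: Fz Fadd)
      \<comment> \<open>A relation among the forms \<open>h z\<close> of small degree, multiplied by
        \<open>l ^ S\<close>, becomes a relation among the test forms modulo
        \<open>F k\<close>.\<close>
      have "(\<Sum>z\<in>Sigma Q B. Const (c z) * fam z) =
          (\<Sum>z\<in>Sigma Q B. Const (c z) * (fam z - l ^ S * h z)) + l ^ S * (\<Sum>z\<in>Sigma Q B. Const (c z) * h z)"
        by (simp add: algebra_simps sum_distrib_left sum_subtractf)
      also have "\<dots> \<in> F k"
        using h(2) Fmul by (auto simp: c0 intro!: Fsum)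
      finally have inF: "(\<Sum>z\<in>Sigma Q B. Const (c z) * fam z) \<in> F k" .
      show "\<forall>z\<in>Sigma Q B. c z = 0"
      proof safe
        fix x \<beta> assume x: "x \<in> Q" and \<beta>: "\<beta> \<in> B x"
        define g where "g = (\<Sum>\<beta>\<in>B x. Const (c (x, \<beta>)) * single \<beta> 1)"
        define u where "u = subst_vars (s x) (e x) ^ (2 * k)"
        define rest where "rest = (\<Sum>y\<in>Q - {x}. \<Sum>\<beta>\<in>B y. Const (c (y, \<beta>)) * subst_vars (s x) (fam (y, \<beta>)))"
        have "subst_vars (s x) (\<Sum>z\<in>Sigma Q B. Const (c z) * fam z) =
            (\<Sum>z\<in>Sigma Q B. Const (c z) * subst_vars (s x) (fam z))"
          by (simp add: subst.hom_sum subst.hom_mult)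
        also have "\<dots> = (\<Sum>y\<in>Q. \<Sum>\<beta>\<in>B y. Const (c (y, \<beta>)) * subst_vars (s x) (fam (y, \<beta>)))"
          using finQ finB by (subst sum.Sigma) (auto simp: case_prod_unfold)
        also have "\<dots> = (\<Sum>\<beta>\<in>B x. Const (c (x, \<beta>)) * subst_vars (s x) (fam (x, \<beta>))) + rest"
          using x finQ by (simp add: rest_def sum.remove[of Q x])
        also have "(\<Sum>\<beta>\<in>B x. Const (c (x, \<beta>)) * subst_vars (s x) (fam (x, \<beta>))) = u * g"
          unfolding g_def u_def sum_distrib_left
          by (intro sum.cong refl) (simp only: own[OF x] mult.left_commute)
        finally have eq: "subst_vars (s x) (\<Sum>z\<in>Sigma Q B. Const (c z) * fam z) = u * g + rest" .
        \<comment> \<open>The test forms of the other points have order at least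
          \<open>2 * k\<close> at \<open>x\<close>, so \<open>u * g\<close> does as well. Cancelling
          the unit \<open>u\<close> leaves \<open>g\<close>, whose monomials all have weight below
          \<open>2 * k\<close>; hence its coefficients vanish.\<close>
        have "wge (w x) (2 * k) (u * g + rest)" using inF x unfolding F_def eq[symmetric] by blast
        moreover have "wge (w x) (2 * k) (- rest)"
          unfolding rest_def using other[OF x]
          by (intro wge_uminus wge_sum wge_mult_left) auto
        ultimately have "wge (w x) (2 * k) (u * g)" using wge_add by fastforce
        moreover have "lookup u 0 \<noteq> 0"
        proof -
          have "lookup (v ^ j) 0 = lookup v 0 ^ j" for v :: "'a mpoly" and j
            by (induction j) (auto simp: lookup_mult_0)
          then show ?thesis unfolding u_def
            using lookup_subst_0[OF forms_polys[OF e[OF x]] s[OF x]] ep[OF x x] by simp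
        qed
        ultimately have g: "wge (w x) (2 * k) g" using wge_cancel w[OF x] by blast
        have "lookup g \<beta> = c (x, \<beta>)"
          using \<beta> finB[OF x] by (simp add: g_def lookup_sum lookup_single when_def)
        then have "\<beta> \<in> keys g" if "c (x, \<beta>) \<noteq> 0" using that by (simp add: in_keys_iff)
        then show "c (x, \<beta>) = 0"
          using g \<beta> unfolding wge_def B_def by fastforce
      qed
    qed
    then show ?thesis using finQ finB by (simp add: b_def B_def)
  qed
  then show ?thesis using that by blast
qed


section \<open>Rational points and local coordinates\<close>

definition point_ideal :: "nat \<Rightarrow> (nat \<Rightarrow> 'a::field) \<Rightarrow> 'a mpoly set" where
  "point_ideal n a = genideal (mpoly_ring n)
     {Const (a i) * Var j - Const (a j) * Var i | i j. i \<le> n \<and> j \<le> n}"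

lemma point_ideal:
  shows "ideal (point_ideal n a) (mpoly_ring n)"
    and "i \<le> n \<Longrightarrow> j \<le> n \<Longrightarrow> Const (a i) * Var j - Const (a j) * Var i \<in> point_ideal n a"
    and "ideal J (mpoly_ring n) \<Longrightarrow>
      (\<And>i j. i \<le> n \<Longrightarrow> j \<le> n \<Longrightarrow> Const (a i) * Var j - Const (a j) * Var i \<in> J) \<Longrightarrow> point_ideal n a \<subseteq> J"
proof -
  have S: "{Const (a i) * Var j - Const (a j) * Var i | i j. i \<le> n \<and> j \<le> n} \<subseteq> polys n" by auto
  show "ideal (point_ideal n a) (mpoly_ring n)"
    unfolding point_ideal_def by (rule genideal_mpoly(1)[OF S])
  show "i \<le> n \<Longrightarrow> j \<le> n \<Longrightarrow> Const (a i) * Var j - Const (a j) * Var i \<in> point_ideal n a"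
    unfolding point_ideal_def using genideal_mpoly(2)[OF S] by blast
  show "point_ideal n a \<subseteq> J" if "ideal J (mpoly_ring n)"
    "\<And>i j. i \<le> n \<Longrightarrow> j \<le> n \<Longrightarrow> Const (a i) * Var j - Const (a j) * Var i \<in> J"
    unfolding point_ideal_def using that by (intro genideal_mpoly(3)[OF S]) auto
qed

lemma point_ideal_eval:
  fixes a :: "nat \<Rightarrow> 'a::field"
  assumes "f \<in> point_ideal n a" shows "eval_at a f = 0"
proof -
  have "ideal {f \<in> polys n. eval_at a f = 0} (mpoly_ring n)"
    by (auto simp: ideal_iff eval.hom_add eval.hom_mult)
  then have "point_ideal n a \<subseteq> {f \<in> polys n. eval_at a f = 0}"
    by (rule point_ideal(3)) (auto simp: eval.hom_minus eval.hom_mult mult.commute)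
  then show ?thesis using assms by blast
qed

lemma point_ideal_scale_subset:
  assumes "\<And>i. i \<le> n \<Longrightarrow> b i = c * a i"
  shows "point_ideal n b \<subseteq> point_ideal n a"
proof (rule point_ideal(3)[OF point_ideal(1)])
  fix i j assume ij: "i \<le> n" "j \<le> n"
  have "Const (b i) * Var j - Const (b j) * Var i = Const c * (Const (a i) * Var j - Const (a j) * Var i)"
    using ij by (simp add: assms algebra_simps)
  then show "Const (b i) * Var j - Const (b j) * Var i \<in> point_ideal n a"
    using ideal_facts(4)[OF point_ideal(1) point_ideal(2)[OF ij]] Const_polys by metis
qed

lemma point_ideal_scale:
  fixes c :: "'a::field"
  assumes "c \<noteq> 0" "\<And>i. i \<le> n \<Longrightarrow> b i = c * a i"
  shows "point_ideal n b = point_ideal n a"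
proof
  show "point_ideal n a \<subseteq> point_ideal n b"
    by (rule point_ideal_scale_subset[of _ _ "inverse c"]) (use assms in auto)
qed (use point_ideal_scale_subset assms in blast)

lemma rational_point_normalize:
  assumes "rational_point n q" "j \<le> n" "Var j \<notin> q"
  obtains a where "a j = 1" "q = point_ideal n a"
proof -
  obtain a where a: "\<exists>i\<le>n. a i \<noteq> 0" "q = point_ideal n a"
    using assms(1) by (auto simp: rational_point_def point_ideal_def)
  have "a j \<noteq> 0"
  proof
    assume "a j = 0"
    obtain i where i: "i \<le> n" "a i \<noteq> 0" using a by blast
    have "Const (inverse (a i)) * (Const (a i) * Var j - Const (a j) * Var i) \<in> q"
      unfolding a(2) by (intro ideal_facts(4)[OF point_ideal(1)] point_ideal(2) i assms) simp
    also have "Const (inverse (a i)) * (Const (a i) * Var j - Const (a j) * Var i) = Var j"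
      using i \<open>a j = 0\<close> by (simp add: mult.assoc[symmetric] flip: Const_simps(4))
    finally show False using assms by simp
  qed
  then have "q = point_ideal n (\<lambda>i. a i / a j)"
    unfolding a(2) by (intro point_ideal_scale[of "a j"]) auto
  then show ?thesis using \<open>a j \<noteq> 0\<close> by (intro that) auto
qed

text \<open>The forms \<open>Var i - Const (b i) * Var j\<close> vanish at \<open>b\<close> because
  \<open>b j = 1\<close>. If all of them vanished at \<open>a\<close> too, then \<open>a\<close>
  would be \<open>a j\<close> times \<open>b\<close>, that is, the same point.\<close>

lemma separating_form:
  fixes a b :: "nat \<Rightarrow> 'a::field"
  assumes j: "j \<le> n" "b j = 1" and a: "\<exists>i\<le>n. a i \<noteq> 0" and ne: "point_ideal n a \<noteq> point_ideal n b"
  obtains f where "f \<in> forms n 1" "eval_at b f = 0" "eval_at a f \<noteq> 0"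
proof -
  have "\<exists>i\<le>n. a i \<noteq> a j * b i"
  proof (rule ccontr)
    assume eq: "\<not> ?thesis"
    then have "a j \<noteq> 0" using a by auto
    then show False using ne eq point_ideal_scale[of "a j" n a b] by auto
  qed
  then obtain i where i: "i \<le> n" "a i \<noteq> a j * b i" by blast
  have 1: "eval_at b (Var i - Const (b i) * Var j) = 0"
    using j by (simp add: eval.hom_minus eval.hom_mult)
  have 2: "eval_at a (Var i - Const (b i) * Var j) \<noteq> 0"
    using i by (simp add: eval.hom_minus eval.hom_mult mult.commute)
  have "Var i - Const (b i) * Var j \<in> forms n 1"
    using i j by (intro forms_closed Var_forms) auto
  then show ?thesis using that 1 2 by blast
qed

text \<open>Local coordinates at the point \<open>p\<close> of the affine chart \<open>X\<^sub>i\<^sub>0 = 1\<close>; the tangent direction \<open>v\<close>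
  becomes the coordinate axis of the variable \<open>i1\<close>.\<close>

definition chart :: "(nat \<Rightarrow> 'a::field) \<Rightarrow> nat \<Rightarrow> (nat \<Rightarrow> 'a) \<Rightarrow> nat \<Rightarrow> nat \<Rightarrow> 'a mpoly" where
  "chart p i0 v i1 i = (if i = i0 then 1 else if i = i1 then Const (p i1) + Var i1
     else Const (p i) + Const (v i) * Var i1 + Var i)"

text \<open>Linear forms that invert the chart: pulled back along \<open>chart\<close> they become
  the local coordinates, and 1 for the index \<open>i0\<close>. Being homogeneous, they can be
  multiplied into test forms of prescribed degree.\<close>

definition chart_form :: "(nat \<Rightarrow> 'a::field) \<Rightarrow> nat \<Rightarrow> (nat \<Rightarrow> 'a) \<Rightarrow> nat \<Rightarrow> nat \<Rightarrow> 'a mpoly" where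
  "chart_form p i0 v i1 i = (if i = i0 then Var i0 else if i = i1 then Var i1 - Const (p i1) * Var i0
     else Var i - Const (p i) * Var i0 - Const (v i) * (Var i1 - Const (p i1) * Var i0))"

lemma lookup_Const: "lookup (Const c) m = (if m = 0 then c else 0)"
  by (simp add: Const_def lookup_single when_def)

lemma lookup_Var: "lookup (Var i) m = (if m = single i 1 then 1 else 0)"
  by (simp add: Var_def lookup_single when_def)

lemma single_1_neq_0 [simp]: "single i (1::nat) \<noteq> 0" "0 \<noteq> single i (1::nat)"
  by (metis lookup_single_eq lookup_zero zero_neq_one)+

lemma single_1_eq_iff [simp]: "single i (1::nat) = single j 1 \<longleftrightarrow> i = j"
  by (metis lookup_single_eq lookup_single_not_eq zero_neq_one)

lemmas single_Suc_0_simps [simp] = single_1_neq_0[unfolded One_nat_def] single_1_eq_iff[unfolded One_nat_def]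

lemma chart_simps:
  assumes "p i0 = 1" "i0 \<noteq> i1"
  shows "lookup (chart p i0 v i1 i) 0 = p i"
    and "lookup (chart p i0 v i1 i) (single i1 1) = (if i = i0 then 0 else if i = i1 then 1 else v i)"
    and "subst_vars (chart p i0 v i1) (chart_form p i0 v i1 i) = (if i = i0 then 1 else Var i)"
proof -
  show "lookup (chart p i0 v i1 i) 0 = p i"
    using assms by (auto simp: chart_def lookup_add lookup_Const lookup_Var lookup_one)
  show "lookup (chart p i0 v i1 i) (single i1 1) = (if i = i0 then 0 else if i = i1 then 1 else v i)"
    using assms by (auto simp: chart_def lookup_add lookup_Const lookup_Var lookup_one when_def)
  show "subst_vars (chart p i0 v i1) (chart_form p i0 v i1 i) = (if i = i0 then 1 else Var i)"
    using assms
    by (auto simp: chart_form_def subst.hom_minus subst.hom_mult, auto simp: chart_def algebra_simps)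
qed

lemma chart_form_forms:
  assumes "i0 \<le> n" "i1 \<le> n" "i \<le> n" shows "chart_form p i0 v i1 i \<in> forms n 1"
  using assms by (simp add: chart_form_def forms_closed(4,5) Var_forms)

text \<open>The chain rule at the origin. A coefficient of degree 1 is a first derivative evaluated
  at 0, so products are handled by the Leibniz rule.\<close>

lemma lookup_subst_linear:
  fixes f :: "'a::comm_ring_1 mpoly"
  assumes f: "f \<in> polys n" and s: "\<And>i. i \<le> n \<Longrightarrow> lookup (s i) 0 = p i"
  shows "lookup (subst_vars s f) (single j 1) =
    (\<Sum>i\<le>n. eval_at p (partial_deriv i f) * lookup (s i) (single j 1))"
proof -
  have lin: "lookup g (single j 1) = lookup (partial_deriv j g) 0" for g :: "'a mpoly"
    by (simp add: lookup_partial_deriv)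
  show ?thesis using f
  proof (induction rule: mpoly_induct)
    case (Const c) show ?case by (simp add: lookup_Const)
  next
    case (Var i)
    then show ?case by (simp add: partial_deriv_Var if_distrib[of "eval_at p"]
          if_distrib[of "\<lambda>x. x * _"] cong: if_cong)
  next
    case (add f g)
    then show ?case
      by (simp add: subst.hom_add partial_deriv_add eval.hom_add lookup_add distrib_right sum.distrib)
  next
    case (mult f g)
    have f0: "lookup (subst_vars s f) 0 = eval_at p f" "lookup (subst_vars s g) 0 = eval_at p g"
      using lookup_subst_0 mult.hyps s by blast+
    have "lookup (subst_vars s (f * g)) (single j 1) =
        eval_at p f * lookup (subst_vars s g) (single j 1) + eval_at p g * lookup (subst_vars s f) (single j 1)"
      by (simp only: lin subst.hom_mult partial_deriv_mult lookup_add lookup_mult_0 f0)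
    also have "\<dots> = (\<Sum>i\<le>n. eval_at p (partial_deriv i (f * g)) * lookup (s i) (single j 1))"
      unfolding mult.IH
      by (simp add: partial_deriv_mult eval.hom_add eval.hom_mult sum_distrib_left sum.distrib algebra_simps)
    finally show ?case .
  qed
qed

section \<open>Counting weighted monomials\<close>

lemma finite_weighted:
  assumes "\<And>i. 1 \<le> w i" shows "finite {b. keys b \<subseteq> {..n} - {i0} \<and> wdeg w b < k}"
proof (rule finite_subset)
  show "{b. keys b \<subseteq> {..n} - {i0} \<and> wdeg w b < k} \<subseteq> (\<Union>j<k. monomials n j)"
  proof
    fix b assume b: "b \<in> {b. keys b \<subseteq> {..n} - {i0} \<and> wdeg w b < k}"
    have "mon_degree b \<le> wdeg w b" using wdeg_ge_mon_degree[of 1 w b] assms by simp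
    then show "b \<in> (\<Union>j<k. monomials n j)" using b by (auto simp: monomials_def)
  qed
qed auto

lemma drop_variable:
  fixes m :: "nat \<Rightarrow>\<^sub>0 nat"
  shows "m = (m - single i0 (lookup m i0)) + single i0 (lookup m i0)"
    "lookup (m - single i0 (lookup m i0)) i = (if i = i0 then 0 else lookup m i)"
    "keys (m - single i0 (lookup m i0)) = keys m - {i0}"
proof -
  show lk: "lookup (m - single i0 (lookup m i0)) i = (if i = i0 then 0 else lookup m i)" for i
    by (simp add: lookup_minus lookup_single when_def)
  show "m = (m - single i0 (lookup m i0)) + single i0 (lookup m i0)"
    by (rule poly_mapping_eqI) (simp add: lk lookup_add lookup_single when_def)
  show "keys (m - single i0 (lookup m i0)) = keys m - {i0}"
    by (auto simp: in_keys_iff lk split: if_splits)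
qed

text \<open>Dehomogenising with respect to \<open>i0\<close> is injective in a fixed degree, because
  the total degree determines the lost exponent.\<close>

lemma drop_variable_eq:
  fixes m m' :: "nat \<Rightarrow>\<^sub>0 nat"
  assumes "mon_degree m = mon_degree m'" "\<And>i. i \<noteq> i0 \<Longrightarrow> lookup m i = lookup m' i"
  shows "m = m'"
proof -
  have eq: "m - single i0 (lookup m i0) = m' - single i0 (lookup m' i0)"
    by (rule poly_mapping_eqI) (use assms(2) in \<open>auto simp: drop_variable(2)\<close>)
  have "mon_degree m = mon_degree (m - single i0 (lookup m i0)) + lookup m i0"
    "mon_degree m' = mon_degree (m' - single i0 (lookup m' i0)) + lookup m' i0"
    using drop_variable(1)[of m i0] drop_variable(1)[of m' i0] mon_degree_simps(2,3) by metis+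
  then have "lookup m i0 = lookup m' i0" using assms(1) eq by simp
  then show ?thesis using eq drop_variable(1)[of m i0] drop_variable(1)[of m' i0] by simp
qed

text \<open>Dropping the variable \<open>i0\<close> sends the monomials of degree
  \<open>k - 1\<close> injectively to monomials of degree at most \<open>k - 1\<close>, whose weight
  is at most \<open>2 * k - 2\<close>.\<close>

lemma card_weighted_ge:
  assumes "1 \<le> k"
  shows "(n + (k - 1)) choose n \<le> card {b. keys b \<subseteq> {..n} - {i0} \<and> wdeg (\<lambda>_. 2) b < 2 * k}"
proof -
  let ?B = "{b. keys b \<subseteq> {..n} - {i0} \<and> wdeg (\<lambda>_. 2) b < 2 * k}"
  let ?h = "\<lambda>m::nat \<Rightarrow>\<^sub>0 nat. m - single i0 (lookup m i0)"
  have two: "wdeg (\<lambda>_. 2) b = 2 * mon_degree b" for b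
    by (simp add: wdeg_def mon_degree_def sum_distrib_left)
  have "inj_on ?h (monomials n (k - 1))"
  proof (rule inj_onI)
    fix m m' assume m: "m \<in> monomials n (k - 1)" "m' \<in> monomials n (k - 1)" "?h m = ?h m'"
    have eq: "lookup m i = lookup m' i" if "i \<noteq> i0" for i
      using m(3) drop_variable(2)[of m i0 i] drop_variable(2)[of m' i0 i] that by simp
    show "m = m'" by (rule drop_variable_eq[OF _ eq]) (use m in \<open>auto simp: monomials_def\<close>)
  qed
  moreover have "?h ` monomials n (k - 1) \<subseteq> ?B"
  proof safe
    fix m assume m: "m \<in> monomials n (k - 1)"
    have "mon_degree m = mon_degree (?h m) + lookup m i0"
      using drop_variable(1)[of m i0] mon_degree_simps(2,3) by metis
    moreover have "mon_degree m = k - 1" using m by (simp add: monomials_def)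
    ultimately show "wdeg (\<lambda>_. 2) (?h m) < 2 * k" unfolding two using assms by linarith
    fix i assume "i \<in> keys (?h m)"
    then show "i \<le> n" using m by (auto simp: drop_variable(3) monomials_def)
    show False if "i0 \<in> keys (?h m)" using that by (simp add: drop_variable(3))
  qed
  ultimately have "card (monomials n (k - 1)) \<le> card ?B"
    using card_inj_on_le[of ?h _ ?B] finite_weighted[of "\<lambda>_. 2"] by simp
  then show ?thesis by (simp add: card_monomials)
qed

text \<open>Halving the weight of one variable doubles the number of monomials.\<close>

lemma card_weighted_special_ge:
  assumes "1 \<le> k" "i1 \<le> n" "i0 \<noteq> i1"
  shows "2 * ((n + (k - 1)) choose n) \<le>
    card {b. keys b \<subseteq> {..n} - {i0} \<and> wdeg (\<lambda>i. if i = i1 then 1 else 2) b < 2 * k}"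
proof -
  let ?w = "\<lambda>i. if i = i1 then 1 else (2::nat)"
  let ?B = "{b. keys b \<subseteq> {..n} - {i0} \<and> wdeg ?w b < 2 * k}"
  \<comment> \<open>An exponent \<open>a\<close> of \<open>i1\<close> is turned into
    \<open>2 * a\<close> or \<open>2 * a + 1\<close>. At weight 1 this costs at most one more than
    \<open>a\<close> at weight 2, and \<open>2 * (k - 1) + 1 < 2 * k\<close>.\<close>
  let ?h = "\<lambda>z::(nat \<Rightarrow>\<^sub>0 nat) \<times> nat. (fst z - single i0 (lookup (fst z) i0)) + single i1 (lookup (fst z) i1 + snd z)"
  have lk: "lookup (?h z) i = (if i = i0 then 0 else if i = i1 then 2 * lookup (fst z) i1 + snd z
      else lookup (fst z) i)" for z i
    using assms by (auto simp: lookup_add drop_variable(2) lookup_single when_def)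
  have "inj_on ?h (monomials n (k - 1) \<times> {0, 1})"
  proof (rule inj_onI)
    fix z z' assume z: "z \<in> monomials n (k - 1) \<times> {0, 1}" "z' \<in> monomials n (k - 1) \<times> {0, 1}" "?h z = ?h z'"
    have eq: "lookup (?h z) i = lookup (?h z') i" for i using z(3) by simp
    have i1: "2 * lookup (fst z) i1 + snd z = 2 * lookup (fst z') i1 + snd z'"
      using eq[of i1] unfolding lk using assms by simp
    have "snd z \<in> {0, 1}" "snd z' \<in> {0, 1}" using z by auto
    with i1 have s: "snd z = snd z'" "lookup (fst z) i1 = lookup (fst z') i1" by (auto, presburger+)
    have "lookup (fst z) i = lookup (fst z') i" if "i \<noteq> i0" for i
      using eq[of i] s(2) that unfolding lk by (cases "i = i1") auto
    then have "fst z = fst z'" using z by (intro drop_variable_eq[of _ _ i0]) (auto simp: monomials_def)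
    then show "z = z'" using s by (simp add: prod_eq_iff)
  qed
  moreover have "?h ` (monomials n (k - 1) \<times> {0, 1}) \<subseteq> ?B"
  proof (intro image_subsetI CollectI conjI)
    fix z assume z: "z \<in> monomials n (k - 1) \<times> {0, 1::nat}"
    let ?b = "fst z - single i0 (lookup (fst z) i0)"
    have m: "fst z \<in> monomials n (k - 1)" "snd z \<le> 1" using z by auto
    have "i \<in> {..n} - {i0}" if "i \<in> keys (?h z)" for i
    proof -
      have ne: "lookup (?h z) i \<noteq> 0" using that unfolding in_keys_iff .
      then have "i \<noteq> i0" unfolding lk by auto
      moreover have "i \<le> n"
      proof (cases "i = i1")
        case False
        then have "i \<in> keys (fst z)" using ne \<open>i \<noteq> i0\<close> unfolding lk in_keys_iff by simp
        then show ?thesis using m by (auto simp: monomials_def)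
      qed (use assms in simp)
      ultimately show ?thesis by simp
    qed
    then show "keys (?h z) \<subseteq> {..n} - {i0}" by blast
    have "wdeg ?w ?b + lookup ?b i1 = 2 * mon_degree ?b"
    proof -
      let ?K = "insert i1 (keys ?b)"
      have "wdeg ?w ?b + lookup ?b i1 = (\<Sum>i\<in>?K. ?w i * lookup ?b i) + (\<Sum>i\<in>?K. if i = i1 then lookup ?b i1 else 0)"
        by (subst wdeg_wide[of ?K]) auto
      also have "\<dots> = (\<Sum>i\<in>?K. 2 * lookup ?b i)"
        unfolding sum.distrib[symmetric] by (intro sum.cong) auto
      also have "\<dots> = 2 * mon_degree ?b"
        by (subst mon_degree_wide[of ?K]) (auto simp: sum_distrib_left)
      finally show ?thesis .
    qed
    moreover have "lookup ?b i1 = lookup (fst z) i1" using assms by (simp add: drop_variable(2))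
    moreover have "mon_degree (fst z) = mon_degree ?b + lookup (fst z) i0"
      using drop_variable(1)[of "fst z" i0] mon_degree_simps(2,3) by metis
    moreover have "mon_degree (fst z) = k - 1" using m by (simp add: monomials_def)
    moreover have "wdeg ?w (?h z) = wdeg ?w ?b + (lookup (fst z) i1 + snd z)" by simp
    ultimately show "wdeg ?w (?h z) < 2 * k" using m(2) assms(1) by linarith
  qed
  ultimately have "card (monomials n (k - 1) \<times> {0, 1::nat}) \<le> card ?B"
    by (rule card_inj_on_le) (intro finite_weighted, simp)
  then show ?thesis by (simp add: card_monomials card_cartesian_product)
qed

text \<open>After multiplication by \<open>fact n\<close> the left binomial is at most
  \<open>(n + \<alpha> * k + c) ^ n\<close> and the right one is at least \<open>k ^ n\<close>. The
  quotient of these two powers tends to \<open>\<alpha> ^ n\<close>, whatever \<open>c\<close>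
  is.\<close>

lemma binomial_growth:
  fixes \<alpha> c n :: nat
  assumes "1 \<le> n"
  obtains k where "1 \<le> k" "(n + (\<alpha> * k + c)) choose n < (\<alpha> ^ n + 1) * ((n + (k - 1)) choose n)"
proof -
  have upper: "fact n * ((n + N) choose n) \<le> (n + N) ^ n" for N
    using binomial_fact_pow[of "n + N" n] by (simp add: mult.commute)
  have lower: "k ^ m \<le> fact m * ((m + (k - 1)) choose m)" if "1 \<le> k" for k m :: nat
  proof (induction m)
    case (Suc m)
    have "k ^ Suc m \<le> (m + k) * (fact m * ((m + (k - 1)) choose m))"
      using Suc by (simp add: mult_mono)
    also have "\<dots> = fact m * (Suc (m + (k - 1)) * ((m + (k - 1)) choose m))"
      using that by simp
    also have "\<dots> = fact m * (Suc m * (Suc (m + (k - 1)) choose Suc m))"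
      by (simp only: Suc_times_binomial)
    finally show ?case by (simp add: algebra_simps)
  qed simp
  have "(\<lambda>k. (real \<alpha> + real (n + c) / real k) ^ n) \<longlonglongrightarrow> (real \<alpha> + 0) ^ n"
    by (intro tendsto_intros lim_const_over_n)
  then have "\<forall>\<^sub>F k in sequentially. (real \<alpha> + real (n + c) / real k) ^ n < real \<alpha> ^ n + 1"
    by (rule order_tendstoD) simp
  then obtain k where k: "1 \<le> k" "(real \<alpha> + real (n + c) / real k) ^ n < real \<alpha> ^ n + 1"
    using eventually_ge_at_top[of "1::nat"] eventually_happens
    by (metis (mono_tags, lifting) eventually_conj trivial_limit_sequentially)
  have "real k * (real \<alpha> + real (n + c) / real k) = real (n + (\<alpha> * k + c))"
    using k(1) by (subst distrib_left) simp
  then have "real (n + (\<alpha> * k + c)) ^ n = (real k * (real \<alpha> + real (n + c) / real k)) ^ n"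
    by simp
  also have "\<dots> < real k ^ n * (real \<alpha> ^ n + 1)"
    using k by (simp add: power_mult_distrib)
  finally have "real ((n + (\<alpha> * k + c)) ^ n) < real ((\<alpha> ^ n + 1) * k ^ n)" by (simp add: algebra_simps)
  then have lt: "(n + (\<alpha> * k + c)) ^ n < (\<alpha> ^ n + 1) * k ^ n" by linarith
  have "fact n * ((n + (\<alpha> * k + c)) choose n) \<le> (n + (\<alpha> * k + c)) ^ n" by (rule upper)
  also have "\<dots> < (\<alpha> ^ n + 1) * k ^ n" by (rule lt)
  also have "\<dots> \<le> (\<alpha> ^ n + 1) * (fact n * ((n + (k - 1)) choose n))"
    by (rule mult_le_mono2[OF lower[OF k(1)]])
  also have "\<dots> = fact n * ((\<alpha> ^ n + 1) * ((n + (k - 1)) choose n))" by (rule mult.left_commute)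
  finally have "(n + (\<alpha> * k + c)) choose n < (\<alpha> ^ n + 1) * ((n + (k - 1)) choose n)"
    by (simp only: nat_mult_less_cancel1[OF fact_gt_zero])
  then show ?thesis using that k(1) by blast
qed


section \<open>Transversality of the intersection\<close>

text \<open>Rows of the Jacobian matrix belong to directions of differentiation and columns to
  forms, so a relation among the rows is a tangent vector annihilated by all gradients.\<close>

lemma det_zero_left_kernel:
  fixes M :: "nat \<Rightarrow> nat \<Rightarrow> 'a::field"
  assumes "det (mat n n (\<lambda>(i, k). M i k)) = 0"
  obtains u where "\<exists>i<n. u i \<noteq> 0" "\<And>k. k < n \<Longrightarrow> (\<Sum>i<n. M i k * u i) = 0"
proof -
  let ?A = "transpose_mat (mat n n (\<lambda>(i, k). M i k))"
  have A: "?A \<in> carrier_mat n n" by simp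
  have "det ?A = 0" using assms det_transpose[of "mat n n (\<lambda>(i, k). M i k)" n] by simp
  then obtain v where v: "v \<in> carrier_vec n" "v \<noteq> 0\<^sub>v n" "?A *\<^sub>v v = 0\<^sub>v n"
    using det_0_iff_vec_prod_zero_field[OF A] by blast
  have "\<exists>i<n. v $ i \<noteq> 0" using v(1,2) by (metis eq_vecI carrier_vecD index_zero_vec)
  moreover have "(\<Sum>i<n. M i k * v $ i) = 0" if k: "k < n" for k
  proof -
    have "(?A *\<^sub>v v) $ k = (\<Sum>i<n. M i k * v $ i)"
      using v(1) k by (simp add: scalar_prod_def atLeast0LessThan)
    then show ?thesis using v(3) k by simp
  qed
  ultimately show ?thesis using that by blast
qed

text \<open>If the determinant vanished at \<open>a\<close>, this zero would contribute twice the
  count of an ordinary zero. Together with the other \<open>\<alpha> ^ n - 1\<close> zeros this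
  gives \<open>\<alpha> ^ n + 1\<close> times the ordinary count, which exceeds the bound of
  \<open>zeros_count_le\<close> for a suitable \<open>k\<close>.\<close>

lemma transversal_zeros:
  fixes Gs :: "'a::field mpoly list"
  assumes n: "1 \<le> n" and len: "length Gs = n" and Gs: "set Gs \<subseteq> forms n (int \<alpha>)"
    and card: "card (proj_zeros n (set Gs)) = \<alpha> ^ n" "2 \<le> \<alpha>"
    and rat: "\<forall>q\<in>proj_zeros n (set Gs). rational_point n q"
    and a: "point_ideal n a \<in> proj_zeros n (set Gs)" "a 0 = 1"
  shows "eval_at a (det (mat n n (\<lambda>(i, k). partial_deriv (Suc i) (Gs ! k)))) \<noteq> 0"
proof
  let ?J = "mat n n (\<lambda>(i, k). partial_deriv (Suc i) (Gs ! k))"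
  assume "eval_at a (det ?J) = 0"
  moreover have "map_mat (eval_at a) ?J = mat n n (\<lambda>(i, k). eval_at a (partial_deriv (Suc i) (Gs ! k)))"
    by (rule eq_matI) auto
  ultimately have "det (mat n n (\<lambda>(i, k). eval_at a (partial_deriv (Suc i) (Gs ! k)))) = 0"
    using eval.hom_det[of a ?J] by simp
  then obtain u where u: "\<exists>i<n. u i \<noteq> 0"
    "\<And>k. k < n \<Longrightarrow> (\<Sum>i<n. eval_at a (partial_deriv (Suc i) (Gs ! k)) * u i) = 0"
    by (rule det_zero_left_kernel) blast
  then obtain i' where i': "i' < n" "u i' \<noteq> 0" by blast
  define j1 where "j1 = Suc i'"
  \<comment> \<open>Normalised for the chart \<open>X_0 = 1\<close>: the coordinate 0 does not move,
    and the coordinate \<open>j1\<close> moves with speed 1, so that it can serve as the parameter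
    along the tangent direction.\<close>
  define v where "v i = (if i = 0 then 0 else u (i - 1) / u i')" for i
  have v: "v 0 = 0" "v j1 = 1" using i' by (auto simp: v_def j1_def)
  have ker: "(\<Sum>i\<le>n. eval_at a (partial_deriv i g) * v i) = 0" if g: "g \<in> set Gs" for g
  proof -
    obtain k where k: "k < n" "g = Gs ! k" using g len by (auto simp: in_set_conv_nth)
    have "(\<Sum>i\<le>n. eval_at a (partial_deriv i g) * v i) = (\<Sum>i<n. eval_at a (partial_deriv (Suc i) g) * v (Suc i))"
      by (subst sum.atMost_shift) (simp add: v)
    also have "\<dots> = (\<Sum>i<n. eval_at a (partial_deriv (Suc i) g) * u i) / u i'"
      by (simp add: v_def sum_divide_distrib)
    finally show ?thesis using u(2) k by simp
  qed
  define Q where "Q = proj_zeros n (set Gs)"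
  define q0 where "q0 = point_ideal n a"
  have q0: "q0 \<in> Q" using a by (simp add: Q_def q0_def)
  have cQ: "card Q = \<alpha> ^ n" using card by (simp add: Q_def)
  have "\<alpha> ^ 1 \<le> \<alpha> ^ n" using n card(2) by (intro power_increasing) auto
  then have cQ2: "2 \<le> card Q" using cQ card(2) by simp
  \<comment> \<open>An infinite set would have \<open>card\<close> equal to 0.\<close>
  then have finQ: "finite Q" by (metis card.infinite not_numeral_le_zero)
  \<comment> \<open>Each zero gets an affine chart together with coordinates normalised in it. The
    point \<open>q0\<close> is assigned the chart \<open>X_0 = 1\<close> and the coordinates
    \<open>a\<close>, in which \<open>v\<close> was computed.\<close>
  have "\<exists>P. fst P \<le> n \<and> snd P (fst P) = 1 \<and> x = point_ideal n (snd P) \<and> (x = q0 \<longrightarrow> P = (0, a))"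
    if x: "x \<in> Q" for x
  proof (cases "x = q0")
    case True then show ?thesis using a by (intro exI[of _ "(0, a)"]) (simp add: q0_def)
  next
    case False
    obtain j where "j \<le> n" "Var j \<notin> x" using x by (auto simp: Q_def proj_zeros_def proj_space_def)
    then obtain b where "b j = 1" "x = point_ideal n b"
      using rational_point_normalize[of n x j] rat x by (auto simp: Q_def)
    then show ?thesis using \<open>j \<le> n\<close> False by (intro exI[of _ "(j, b)"]) auto
  qed
  then obtain P where P: "\<And>x. x \<in> Q \<Longrightarrow> fst (P x) \<le> n" "\<And>x. x \<in> Q \<Longrightarrow> snd (P x) (fst (P x)) = 1"
    "\<And>x. x \<in> Q \<Longrightarrow> x = point_ideal n (snd (P x))" "P q0 = (0, a)"
    using q0 by metis
  define i0 where "i0 x = fst (P x)" for x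
  define p where "p x = snd (P x)" for x
  have i0: "x \<in> Q \<Longrightarrow> i0 x \<le> n" and p1: "x \<in> Q \<Longrightarrow> p x (i0 x) = 1"
    and xp: "x \<in> Q \<Longrightarrow> x = point_ideal n (p x)" for x
    using P by (auto simp: i0_def p_def)
  have pq0: "i0 q0 = 0" "p q0 = a" using P(4) by (auto simp: i0_def p_def)
  \<comment> \<open>At points other than \<open>q0\<close> any index different from
    \<open>i0 x\<close> will do: the direction used there is 0, so the chart is a plain
    translation.\<close>
  define i1 where "i1 x = (if x = q0 then j1 else if i0 x = 0 then 1 else 0)" for x
  have i1: "i1 x \<le> n" "i0 x \<noteq> i1 x" if "x \<in> Q" for x
    using n i' that by (auto simp: i1_def j1_def pq0)
  define w where "w x = (if x = q0 then (\<lambda>i. if i = j1 then 1 else 2) else (\<lambda>_. 2::nat))" for x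
  define s where "s x = chart (p x) (i0 x) (if x = q0 then v else (\<lambda>_. 0)) (i1 x)" for x
  define lam where "lam x = chart_form (p x) (i0 x) (if x = q0 then v else (\<lambda>_. 0)) (i1 x)" for x
  have s0: "lookup (s x i) 0 = p x i" if "x \<in> Q" for x i
    unfolding s_def by (rule chart_simps(1)) (use p1 i1 that in auto)
  have "\<exists>f. f \<in> forms n 1 \<and> eval_at (p y) f = 0 \<and> eval_at (p x) f \<noteq> 0"
    if "x \<in> Q" "y \<in> Q" "x \<noteq> y" for x y
  proof -
    have "\<exists>i\<le>n. p x i \<noteq> 0" using i0 p1 that by (intro exI[of _ "i0 x"]) auto
    moreover have "point_ideal n (p x) \<noteq> point_ideal n (p y)" using xp that by metis
    ultimately show ?thesis
      using separating_form[of "i0 y" n "p y" "p x"] i0[OF that(2)] p1[OF that(2)] by metis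
  qed
  then obtain sep where sep: "\<And>x y. x \<in> Q \<Longrightarrow> y \<in> Q \<Longrightarrow> x \<noteq> y \<Longrightarrow>
    sep x y \<in> forms n 1 \<and> eval_at (p y) (sep x y) = 0 \<and> eval_at (p x) (sep x y) \<noteq> 0" by metis
  \<comment> \<open>One linear factor for each other zero gives degree \<open>card Q - 1\<close>.
    This is positive because there are at least two zeros.\<close>
  define e where "e x = (\<Prod>y\<in>Q - {x}. sep x y)" for x
  define d where "d = card Q - 1"
  have e: "e x \<in> forms n (int d)" if "x \<in> Q" for x
  proof -
    have "e x \<in> forms n (\<Sum>y\<in>Q - {x}. 1)" unfolding e_def using sep that by (intro prod_forms) auto
    then show ?thesis using that finQ by (simp add: d_def)
  qed
  have ep: "eval_at (p x) (e y) = 0 \<longleftrightarrow> x \<noteq> y" if "x \<in> Q" "y \<in> Q" for x y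
    using that sep finQ by (auto simp: e_def eval.hom_prod)
  have Gw: "wge (w x) 2 (subst_vars (s x) g)" if x: "x \<in> Q" and g: "g \<in> set Gs" for x g
    unfolding wge_def
  proof
    fix m assume m: "m \<in> keys (subst_vars (s x) g)"
    have gp: "g \<in> polys n" using g Gs forms_polys by blast
    have "g \<in> x" using x g by (auto simp: Q_def proj_zeros_def)
    then have "eval_at (p x) g = 0" using point_ideal_eval xp[OF x] by metis
    then have "lookup (subst_vars (s x) g) 0 = 0" using lookup_subst_0[OF gp s0[OF x]] by simp
    then have "m \<noteq> 0" using m by (auto simp: in_keys_iff)
    then have m0: "1 \<le> mon_degree m" using mon_degree_eq_0_iff[of m] by (cases "mon_degree m") auto
    show "2 \<le> wdeg (w x) m"
    proof (cases "x = q0")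
      case False
      then show ?thesis using m0 wdeg_ge_mon_degree[of 2 "w x" m] by (simp add: w_def)
    next
      case True
      show ?thesis
      proof (rule ccontr)
        \<comment> \<open>A nonconstant monomial of weight below 2 at \<open>q0\<close> can only be
          the variable \<open>j1\<close>. Its coefficient is the derivative of \<open>g\<close>
          along \<open>v\<close>, which vanishes by \<open>ker\<close>.\<close>
        assume less: "\<not> 2 \<le> wdeg (w x) m"
        have "mon_degree m \<le> wdeg (w x) m" using wdeg_ge_mon_degree[of 1 "w x" m] by (simp add: w_def)
        then have m1: "mon_degree m = 1" using less m0 by linarith
        obtain j where j: "j \<in> keys m" using \<open>m \<noteq> 0\<close> by (metis keys_eq_empty equals0I)
        have "lookup m j \<noteq> 0" using j by (simp add: in_keys_iff)
        then have "m = (m - single j 1) + single j 1"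
          by (intro poly_mapping_eqI) (auto simp: lookup_add lookup_minus lookup_single when_def)
        then obtain b where b: "m = b + single j 1" by blast
        then have "mon_degree b = 0" using m1 by simp
        then have mj: "m = single j 1" using b by (simp add: mon_degree_eq_0_iff)
        then have "j = j1" using less by (auto simp: True w_def split: if_splits)
        then have mj: "m = single (i1 x) 1" using mj by (simp add: True i1_def)
        have "lookup (subst_vars (s x) g) (single (i1 x) 1) =
            (\<Sum>i\<le>n. eval_at (p x) (partial_deriv i g) * lookup (s x i) (single (i1 x) 1))"
          by (rule lookup_subst_linear[OF gp s0[OF x]])
        also have "\<dots> = (\<Sum>i\<le>n. eval_at a (partial_deriv i g) * v i)"
        proof (intro sum.cong refl)
          fix i
          have "lookup (s x i) (single (i1 x) 1) = v i"
            unfolding s_def chart_simps(2)[of "p x" "i0 x" "i1 x", OF p1[OF x] i1(2)[OF x]] using v by (auto simp: True pq0 i1_def)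
          then show "eval_at (p x) (partial_deriv i g) * lookup (s x i) (single (i1 x) 1) =
              eval_at a (partial_deriv i g) * v i" by (simp add: True pq0)
        qed
        also have "\<dots> = 0" using ker[OF g] .
        finally show False using m mj by (simp add: in_keys_iff)
      qed
    qed
  qed
  have lamf: "x \<in> Q \<Longrightarrow> i \<le> n \<Longrightarrow> lam x i \<in> forms n 1" for x i
    unfolding lam_def using i0 i1 by (intro chart_form_forms) auto
  have lams: "x \<in> Q \<Longrightarrow> subst_vars (s x) (lam x i) = (if i = i0 x then 1 else Var i)" for x i
    unfolding lam_def s_def by (rule chart_simps(3)) (use p1 i1 in auto)
  have zer: "\<exists>x\<in>Q. \<forall>f\<in>q. eval_at (p x) f = 0" if "q \<in> proj_zeros n (set Gs)" for q
  proof (rule bexI[of _ q])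
    show q: "q \<in> Q" using that by (simp add: Q_def)
    show "\<forall>f\<in>q. eval_at (p q) f = 0" using point_ideal_eval[of _ n "p q"] xp[OF q] by simp
  qed
  obtain c where c: "\<And>k. (\<Sum>x\<in>Q. card {b. keys b \<subseteq> {..n} - {i0 x} \<and> wdeg (w x) b < 2 * k})
      \<le> (n + (\<alpha> * k + c)) choose n"
  proof (rule zeros_count_le[of Q "set Gs" n \<alpha> p d e s i0 lam w])
    show "1 \<le> d" using cQ2 by (simp add: d_def)
    show "1 \<le> w x i" for x i by (simp add: w_def)
  qed (use finQ Gs zer e ep s0 i0 lamf lams Gw that in auto)
  obtain k where k: "1 \<le> k" "(n + (\<alpha> * k + c)) choose n < (\<alpha> ^ n + 1) * ((n + (k - 1)) choose n)"
    using binomial_growth[OF n] by blast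
  let ?C = "(n + (k - 1)) choose n"
  \<comment> \<open>The singular zero counts twice and the remaining \<open>\<alpha> ^ n - 1\<close>
    zeros count once.\<close>
  have "(\<alpha> ^ n + 1) * ?C = (\<Sum>x\<in>Q. if x = q0 then 2 * ?C else ?C)"
  proof -
    have "(\<Sum>x\<in>Q. if x = q0 then 2 * ?C else ?C) = 2 * ?C + (\<Sum>x\<in>Q - {q0}. ?C)"
      using q0 finQ by (simp add: sum.remove[of Q q0])
    also have "\<dots> = (card (Q - {q0}) + 2) * ?C" by simp
    also have "card (Q - {q0}) + 2 = \<alpha> ^ n + 1" using q0 finQ cQ cQ2 by (simp add: card_Diff_singleton)
    finally show ?thesis by simp
  qed
  also have "\<dots> \<le> (\<Sum>x\<in>Q. card {b. keys b \<subseteq> {..n} - {i0 x} \<and> wdeg (w x) b < 2 * k})"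
  proof (intro sum_mono)
    fix x assume x: "x \<in> Q"
    show "(if x = q0 then 2 * ?C else ?C) \<le> card {b. keys b \<subseteq> {..n} - {i0 x} \<and> wdeg (w x) b < 2 * k}"
      using card_weighted_ge[OF k(1), of n "i0 x"] card_weighted_special_ge[OF k(1) i1[OF x]]
      by (auto simp: w_def i1_def)
  qed
  finally show False using c[of k] k(2) by linarith
qed


section \<open>Dimensions in the coordinate ring\<close>

text \<open>Lists mirror \<open>combine\<close>, \<open>Span\<close> and \<open>independent\<close>
  of the quotient ring. As \<open>map2\<close> cuts off the longer list, equality of lengths is
  demanded wherever coefficients are quantified.\<close>

definition lin_comb :: "'a::comm_ring_1 list \<Rightarrow> 'a mpoly list \<Rightarrow> 'a mpoly" where
  "lin_comb cs fs = sum_list (map2 (\<lambda>c f. Const c * f) cs fs)"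

definition indep_mod :: "'a::comm_ring_1 mpoly set \<Rightarrow> 'a mpoly list \<Rightarrow> bool" where
  "indep_mod I fs \<longleftrightarrow> (\<forall>cs. length cs = length fs \<longrightarrow> lin_comb cs fs \<in> I \<longrightarrow> set cs \<subseteq> {0})"

definition spans_mod :: "'a::comm_ring_1 mpoly set \<Rightarrow> 'a mpoly list \<Rightarrow> 'a mpoly set \<Rightarrow> bool" where
  "spans_mod I fs V \<longleftrightarrow> (\<forall>v\<in>V. \<exists>cs. length cs = length fs \<and> v - lin_comb cs fs \<in> I)"

definition poly_subspace :: "nat \<Rightarrow> 'a::comm_ring_1 mpoly set \<Rightarrow> bool" where
  "poly_subspace n V \<longleftrightarrow> V \<subseteq> polys n \<and> 0 \<in> V \<and> (\<forall>f\<in>V. \<forall>g\<in>V. f + g \<in> V) \<and> (\<forall>c. \<forall>f\<in>V. Const c * f \<in> V)"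

lemma lin_comb_simps [simp]:
  "lin_comb [] fs = 0" "lin_comb cs [] = 0" "lin_comb (c # cs) (f # fs) = Const c * f + lin_comb cs fs"
  by (simp_all add: lin_comb_def)

lemma poly_subspace_lin_comb:
  "poly_subspace n V \<Longrightarrow> set fs \<subseteq> V \<Longrightarrow> lin_comb cs fs \<in> V"
  by (induction cs fs rule: list_induct2') (auto simp: poly_subspace_def)

lemma poly_subspace_polys: "poly_subspace n (polys n)"
  by (simp add: poly_subspace_def)

lemma poly_subspace_forms: "poly_subspace n (forms n i)"
  using forms_polys by (auto simp: poly_subspace_def intro: forms_closed)

lemma lin_comb_mult: "lin_comb cs (map ((*) g) fs) = g * lin_comb cs fs"
  by (induction cs fs rule: list_induct2') (auto simp: algebra_simps)

text \<open>Properness keeps the constants distinct modulo \<open>I\<close>. The image of K in the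
  quotient is therefore a subfield, over which dimensions can be taken.\<close>

locale proper_ideal =
  fixes n :: nat and I :: "'a::field mpoly set"
  assumes I: "ideal I (mpoly_ring n)" and one: "1 \<notin> I"
begin

abbreviation "R \<equiv> coord_ring n I"
abbreviation "K \<equiv> base_field n I"
abbreviation "cls \<equiv> residue_class n I"

lemmas If = ideal_facts[OF I]

lemma Const_mem: "Const c \<in> I \<longleftrightarrow> c = 0"
proof
  assume "Const c \<in> I"
  then have "Const (inverse c) * Const c \<in> I" using If(4) Const_polys by blast
  then show "c = 0" using one by (cases "c = 0") (auto simp flip: Const_simps(4))
qed (use If in simp)

lemma cring_R: "cring R"
  unfolding coord_ring_def by (rule ideal.quotient_is_cring[OF I cring_mpoly_ring])

sublocale R: cring R by (rule cring_R)

lemma cls_hom: "cls \<in> Ring.ring_hom (mpoly_ring n) R"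
  using ideal.rcos_ring_hom[OF I] unfolding coord_ring_def residue_class_def by simp

lemma cls_carrier: "f \<in> polys n \<Longrightarrow> cls f \<in> carrier R"
  using ring_hom_memE(1)[OF cls_hom] by simp

lemma cls_simps:
  assumes "f \<in> polys n" "g \<in> polys n"
  shows "cls (f * g) = cls f \<otimes>\<^bsub>R\<^esub> cls g" "cls (f + g) = cls f \<oplus>\<^bsub>R\<^esub> cls g"
  using ring_hom_memE[OF cls_hom] assms by simp_all

lemma cls_one: "cls 1 = \<one>\<^bsub>R\<^esub>"
  using ring_hom_memE(4)[OF cls_hom] by simp

lemma cls_eq_iff:
  assumes "f \<in> polys n" "g \<in> polys n" shows "cls f = cls g \<longleftrightarrow> f - g \<in> I"
proof -
  interpret P: cring "mpoly_ring n :: 'a mpoly ring" by (rule cring_mpoly_ring)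
  have "\<ominus>\<^bsub>mpoly_ring n\<^esub> g = - g"
    using P.minus_equality[of "- g" g] assms by simp
  then have "f \<ominus>\<^bsub>mpoly_ring n\<^esub> g = f - g" by (simp add: a_minus_def)
  moreover have "f \<ominus>\<^bsub>mpoly_ring n\<^esub> g \<in> I \<longleftrightarrow> cls f = cls g"
    unfolding residue_class_def by (rule P.quotient_eq_iff_same_a_r_cos[OF I assms])
  ultimately show ?thesis by simp
qed

lemma zero_R: "\<zero>\<^bsub>R\<^esub> = cls 0"
proof -
  have "cls 0 \<oplus>\<^bsub>R\<^esub> cls 0 = cls 0" using cls_simps(2)[of 0 0] by simp
  then show ?thesis using R.add.r_cancel_one'[of "cls 0" "cls 0"] cls_carrier[of 0] by simp
qed

lemma cls_eq_0_iff: "f \<in> polys n \<Longrightarrow> cls f = \<zero>\<^bsub>R\<^esub> \<longleftrightarrow> f \<in> I"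
  by (simp add: zero_R cls_eq_iff)

lemma carrier_R: "carrier R = cls ` polys n"
  by (auto simp: coord_ring_def FactRing_def A_RCOSETS_def' residue_class_def)

lemma subfield_K: "subfield K R"
proof -
  interpret P: cring "mpoly_ring n :: 'a mpoly ring" by (rule cring_mpoly_ring)
  have "subcring (Const ` UNIV) (mpoly_ring n :: 'a mpoly ring)"
  proof (rule P.subcringI')
    show "subring (Const ` UNIV) (mpoly_ring n :: 'a mpoly ring)"
    proof (rule P.subringI)
      fix h assume "h \<in> range (Const :: 'a \<Rightarrow> _)"
      then obtain c where c: "h = Const c" by blast
      have "\<ominus>\<^bsub>mpoly_ring n\<^esub> h = Const (- c)"
        using P.minus_equality[of "Const (- c)" h] c by simp
      then show "\<ominus>\<^bsub>mpoly_ring n\<^esub> h \<in> range Const" by blast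
    next
      show "\<one>\<^bsub>mpoly_ring n\<^esub> \<in> range (Const :: 'a \<Rightarrow> _)"
        using Const_simps(2) by (metis mpoly_ring_sel(2) rangeI)
    next
      fix g h assume "g \<in> range (Const :: 'a \<Rightarrow> _)" "h \<in> range (Const :: 'a \<Rightarrow> _)"
      then obtain a b :: 'a where "g = Const a" "h = Const b" by blast
      then have "g * h = Const (a * b)" "g + h = Const (a + b)" by simp_all
      then show "g \<otimes>\<^bsub>mpoly_ring n\<^esub> h \<in> range Const" "g \<oplus>\<^bsub>mpoly_ring n\<^esub> h \<in> range Const"
        by (simp_all del: Const_simps)
    qed auto
  qed
  moreover have "Units (mpoly_ring n \<lparr>carrier := Const ` UNIV\<rparr>) = Const ` UNIV - {\<zero>\<^bsub>mpoly_ring n\<^esub> :: 'a mpoly}"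
    (is "?U = _")
  proof
    show "?U \<subseteq> Const ` UNIV - {\<zero>\<^bsub>mpoly_ring n\<^esub>}" by (auto simp: Units_def)
    show "Const ` UNIV - {\<zero>\<^bsub>mpoly_ring n\<^esub>} \<subseteq> ?U"
    proof
      fix h assume "h \<in> Const ` UNIV - {\<zero>\<^bsub>mpoly_ring n\<^esub> :: 'a mpoly}"
      then obtain c :: 'a where c: "h = Const c" "h \<noteq> 0" by auto
      then have "c \<noteq> 0" by auto
      then have "Const (inverse c) * Const c = 1" by (simp flip: Const_simps(4))
      then have "Const (inverse c) * h = 1" "h * Const (inverse c) = 1"
        using c(1) by (simp_all add: mult.commute)
      then show "h \<in> ?U" using c(1) by (auto simp: Units_def)
    qed
  qed
  ultimately have "subfield (Const ` UNIV) (mpoly_ring n :: 'a mpoly ring)" by (rule P.subfieldI)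
  moreover have "ring_hom_ring (mpoly_ring n) R cls"
    by (rule ring_hom_ringI2[OF P.ring_axioms R.ring_axioms cls_hom])
  moreover have "\<one>\<^bsub>R\<^esub> \<noteq> \<zero>\<^bsub>R\<^esub>" using cls_eq_0_iff[of 1] one cls_one by auto
  ultimately show ?thesis unfolding base_field_def
    by (metis ring_hom_ring.img_is_subfield(2))
qed

lemma combine_cls:
  assumes "set fs \<subseteq> polys n"
  shows "R.combine (map (\<lambda>c. cls (Const c)) cs) (map cls fs) = cls (lin_comb cs fs)"
  using assms
proof (induction fs arbitrary: cs)
  case (Cons f fs)
  have "lin_comb cs fs \<in> polys n" for cs
    using poly_subspace_lin_comb[OF poly_subspace_polys] Cons.prems by auto
  then show ?case using Cons by (cases cs) (auto simp: zero_R cls_simps)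
qed (simp add: zero_R)

lemma K_list:
  assumes "set Ks \<subseteq> K" obtains cs where "Ks = map (\<lambda>c. cls (Const c)) cs"
proof -
  have "\<forall>x\<in>set Ks. \<exists>c. x = cls (Const c)" using assms by (auto simp: base_field_def)
  then obtain g where g: "\<forall>x\<in>set Ks. x = cls (Const (g x))" by (rule bchoice[THEN exE])
  have "map (\<lambda>c. cls (Const c)) (map g Ks) = map (\<lambda>x. x) Ks"
    unfolding map_map by (rule map_cong) (use g in auto)
  then show ?thesis using that[of "map g Ks"] by simp
qed

lemma indep_modD:
  assumes "indep_mod I fs" "set fs \<subseteq> polys n" shows "R.independent K (map cls fs)"
proof (rule ccontr)
  assume dep: "\<not> ?thesis"
  have "set (map cls fs) \<subseteq> carrier R" using assms(2) carrier_R by auto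
  then obtain Ks where Ks: "length Ks = length (map cls fs)" "R.combine Ks (map cls fs) = \<zero>\<^bsub>R\<^esub>"
    "set Ks \<subseteq> K" "set Ks \<noteq> {\<zero>\<^bsub>R\<^esub>}"
    using R.dependent_imp_non_trivial_combine[OF subfield_K _ dep] by metis
  obtain cs where cs: "Ks = map (\<lambda>c. cls (Const c)) cs" using K_list Ks(3) by blast
  have "lin_comb cs fs \<in> polys n"
    using poly_subspace_lin_comb[OF poly_subspace_polys] assms by auto
  then have "lin_comb cs fs \<in> I" using Ks(2) combine_cls[OF assms(2), of cs] cs cls_eq_0_iff by simp
  then have "set cs \<subseteq> {0}" using assms(1) Ks(1) cs by (simp add: indep_mod_def)
  then have "set Ks \<subseteq> {\<zero>\<^bsub>R\<^esub>}" by (auto simp: cs zero_R)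
  then have "set Ks = {}" using Ks(4) by (metis subset_singletonD)
  then have "fs = []" using Ks(1) by simp
  then show False using dep by simp
qed

lemma mem_Span_iff:
  assumes "set fs \<subseteq> polys n" "v \<in> polys n"
  shows "cls v \<in> R.Span K (map cls fs) \<longleftrightarrow> (\<exists>cs. length cs = length fs \<and> v - lin_comb cs fs \<in> I)"
proof -
  have lc: "lin_comb cs fs \<in> polys n" for cs
    using poly_subspace_lin_comb[OF poly_subspace_polys] assms by auto
  have "set (map cls fs) \<subseteq> carrier R" using assms(1) carrier_R by auto
  from R.Span_mem_iff_length_version[OF subfield_K this]
  have "cls v \<in> R.Span K (map cls fs) \<longleftrightarrow>
      (\<exists>Ks. set Ks \<subseteq> K \<and> length Ks = length fs \<and> cls v = R.combine Ks (map cls fs))" by simp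
  also have "\<dots> \<longleftrightarrow> (\<exists>cs. length cs = length fs \<and> cls v = cls (lin_comb cs fs))"
  proof safe
    fix Ks assume "set Ks \<subseteq> K" "length Ks = length fs" "cls v = R.combine Ks (map cls fs)"
    then show "\<exists>cs. length cs = length fs \<and> cls v = cls (lin_comb cs fs)"
      using K_list[of Ks] combine_cls[OF assms(1)] by (metis length_map)
  next
    fix cs assume "length cs = length fs" "cls v = cls (lin_comb cs fs)"
    then show "\<exists>Ks. set Ks \<subseteq> K \<and> length Ks = length fs \<and> cls v = R.combine Ks (map cls fs)"
      by (intro exI[of _ "map (\<lambda>c. cls (Const c)) cs"]) (auto simp: combine_cls[OF assms(1)] base_field_def)
  qed
  finally show ?thesis by (simp add: cls_eq_iff[OF assms(2) lc])
qed

text \<open>The list \<open>Us\<close> may be dependent. Discarding redundant vectors leaves an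
  independent list with the same span, to which the exchange bound applies.\<close>

lemma Span_length:
  assumes "set Us \<subseteq> carrier R" "R.independent K Ws" "set Ws \<subseteq> R.Span K Us"
  shows "length Ws \<le> length Us"
proof -
  have "\<exists>Vs. R.independent K Vs \<and> R.Span K Vs = R.Span K Us \<and> length Vs \<le> length Us"
    using assms(1)
  proof (induction Us)
    case Nil
    have "R.independent K []" by (rule R.li_Nil)
    then show ?case by blast
  next
    case (Cons u Us)
    then obtain Vs where Vs: "R.independent K Vs" "R.Span K Vs = R.Span K Us" "length Vs \<le> length Us"
      by auto
    show ?case
    proof (cases "u \<in> R.Span K Us")
      case True
      then have "R.Span K (u # Us) = R.Span K Us"
        using R.Span_base_incl[OF subfield_K] R.mono_Span_subset[OF subfield_K]
        by (metis Cons.prems insert_subset list.simps(15) subset_antisym)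
      then show ?thesis using Vs by (metis le_SucI length_Cons)
    next
      case False
      then have "R.Span K (u # Vs) = R.Span K (u # Us)" "R.independent K (u # Vs)"
        using R.li_Cons[of u K Vs] Cons(2) Vs by auto
      then show ?thesis using Vs(3) by (metis length_Cons Suc_le_mono)
    qed
  qed
  then show ?thesis using R.independent_length_le[OF subfield_K assms(2)] assms(3) by fastforce
qed

lemma indep_length_le:
  assumes "indep_mod I fs" "set fs \<subseteq> V" "V \<subseteq> polys n" "spans_mod I gs V" "set gs \<subseteq> polys n"
  shows "length fs \<le> length gs"
proof -
  have "cls v \<in> R.Span K (map cls gs)" if "v \<in> V" for v
    using that assms(3,4) mem_Span_iff[OF assms(5), of v] unfolding spans_mod_def by blast
  then have "set (map cls fs) \<subseteq> R.Span K (map cls gs)" using assms(2) by (auto simp del: R.Span.simps)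
  moreover have "set (map cls gs) \<subseteq> carrier R" using assms(5) carrier_R by auto
  moreover have "R.independent K (map cls fs)" using indep_modD assms by blast
  ultimately show ?thesis using Span_length by (metis length_map)
qed

lemma dim_eq_length:
  assumes "indep_mod I fs" "set fs \<subseteq> V" "poly_subspace n V" "spans_mod I fs V"
  shows "R.dim K (cls ` V) = length fs"
proof -
  have V: "V \<subseteq> polys n" using assms(3) by (simp add: poly_subspace_def)
  then have fs: "set fs \<subseteq> polys n" using assms by blast
  have "R.Span K (map cls fs) = cls ` V"
  proof
    show "cls ` V \<subseteq> R.Span K (map cls fs)"
    proof (rule image_subsetI)
      fix v assume "v \<in> V"
      then show "cls v \<in> R.Span K (map cls fs)"
        using assms(4) V mem_Span_iff[OF fs, of v] unfolding spans_mod_def by blast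
    qed
    show "R.Span K (map cls fs) \<subseteq> cls ` V"
    proof
      fix x assume x: "x \<in> R.Span K (map cls fs)"
      then have "x \<in> carrier R"
        using R.Span_in_carrier[of K "map cls fs"] fs carrier_R subfield_K
          subringE(1)[OF subfieldE(1)[OF subfield_K]] by auto
      then obtain v where v: "v \<in> polys n" "x = cls v" using carrier_R by auto
      obtain cs where "v - lin_comb cs fs \<in> I" using x v mem_Span_iff[OF fs] by blast
      moreover have "lin_comb cs fs \<in> V" using poly_subspace_lin_comb assms by blast
      ultimately show "x \<in> cls ` V" using v V cls_eq_iff by (metis imageI subsetD)
    qed
  qed
  then have "R.dimension (length (map cls fs)) K (cls ` V)"
    using R.dimensionI[OF subfield_K indep_modD[OF assms(1) fs]] by blast
  then show ?thesis using R.dimI[OF subfield_K] by (simp add: over_def)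
qed

text \<open>Take an independent list in \<open>V\<close> of greatest length; the spanning list
  \<open>gs\<close> bounds the lengths. A vector that cannot be appended satisfies a relation in
  which its own coefficient is nonzero, so it lies in the span.\<close>

lemma basis_exists:
  assumes V: "poly_subspace n V" and gs: "spans_mod I gs V" "set gs \<subseteq> polys n"
  obtains fs where "indep_mod I fs" "set fs \<subseteq> V" "spans_mod I fs V" "R.dim K (cls ` V) = length fs"
proof -
  have Vp: "V \<subseteq> polys n" using V by (simp add: poly_subspace_def)
  let ?P = "\<lambda>k. \<exists>fs. indep_mod I fs \<and> set fs \<subseteq> V \<and> length fs = k"
  have "?P 0" by (auto simp: indep_mod_def)
  moreover have "\<And>k. ?P k \<Longrightarrow> k \<le> length gs" using indep_length_le[OF _ _ Vp gs] by blast
  ultimately obtain k where k: "?P k" "\<And>l. ?P l \<Longrightarrow> l \<le> k"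
    using GreatestI_nat[of ?P 0 "length gs"] Greatest_le_nat[of ?P _ "length gs"] by blast
  then obtain fs where fs: "indep_mod I fs" "set fs \<subseteq> V" "length fs = k" by blast
  have "spans_mod I fs V"
    unfolding spans_mod_def
  proof
    fix v assume v: "v \<in> V"
    have "\<not> indep_mod I (v # fs)"
    proof
      assume "indep_mod I (v # fs)"
      then have "?P (Suc k)" using fs v by (intro exI[of _ "v # fs"]) auto
      then show False using k(2) by fastforce
    qed
    then obtain cs where cs: "length cs = Suc (length fs)" "lin_comb cs (v # fs) \<in> I" "\<not> set cs \<subseteq> {0}"
      by (auto simp: indep_mod_def)
    then obtain c ds where c: "cs = c # ds" "length ds = length fs" by (cases cs) auto
    have "c \<noteq> 0"
    proof
      assume "c = 0"
      then have "set ds \<subseteq> {0}" using fs(1) cs(2) c by (auto simp: indep_mod_def)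
      then show False using cs(3) c \<open>c = 0\<close> by simp
    qed
    have "lin_comb (map (\<lambda>d. - inverse c * d) ds) fs = Const (- inverse c) * lin_comb ds fs"
      by (induction ds fs rule: list_induct2') (auto simp: algebra_simps)
    then have "v - lin_comb (map (\<lambda>d. - inverse c * d) ds) fs = Const (inverse c) * lin_comb cs (v # fs)"
      using \<open>c \<noteq> 0\<close> by (simp add: c distrib_left mult.assoc[symmetric] flip: Const_simps(4))
    also have "\<dots> \<in> I" using cs(2) If(4) by simp
    finally show "\<exists>cs. length cs = length fs \<and> v - lin_comb cs fs \<in> I"
      using c(2) by (metis length_map)
  qed
  then show ?thesis using that fs dim_eq_length[OF fs(1,2) V] by blast
qed

end


section \<open>Monomial bases and values of the Hilbert function\<close>

context proper_ideal
begin

lemma monomial_list: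
  obtains ms where "set ms = monomials n k" "distinct ms" "length ms = (n + k) choose n"
  using finite_distinct_list[OF finite_monomials] by (metis card_monomials distinct_card)

lemma lin_comb_monomials:
  assumes "distinct ms"
  shows "lin_comb (map (lookup f) ms) (map (\<lambda>m. single m 1) ms) = (\<Sum>m\<in>set ms. single m (lookup f m))"
  using assms by (induction ms) auto

lemma monomials_span:
  assumes "set ms = monomials n k" "distinct ms"
  shows "spans_mod I (map (\<lambda>m. single m 1) ms) (forms n (int k))"
  unfolding spans_mod_def
proof
  fix v :: "'a mpoly" assume v: "v \<in> forms n (int k)"
  have "v = lin_comb (map (lookup v) ms) (map (\<lambda>m. single m 1) ms)"
    using forms_expand[OF v] by (simp add: lin_comb_monomials assms)
  then show "\<exists>cs. length cs = length (map (\<lambda>m. single m 1) ms) \<and>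
      v - lin_comb cs (map (\<lambda>m. single m 1) ms) \<in> I"
    using If(2) by (intro exI[of _ "map (lookup v) ms"]) simp
qed

lemma monomials_forms: "set ms \<subseteq> monomials n k \<Longrightarrow> set (map (\<lambda>m. single m 1) ms) \<subseteq> forms n (int k)"
  using single_forms[of _ n] by (fastforce simp: monomials_def)

lemma lookup_lin_comb_monomials:
  assumes "distinct ms" "length cs = length ms" "j < length ms"
  shows "lookup (lin_comb cs (map (\<lambda>m. single m 1) ms)) (ms ! j) = cs ! j"
proof -
  have "lookup (lin_comb cs (map (\<lambda>m. single m 1) ms)) x = (\<Sum>i<length ms. if ms ! i = x then cs ! i else 0)" for x
    using assms(2)
  proof (induction ms arbitrary: cs)
    case (Cons m ms)
    then obtain d ds where ds: "cs = d # ds" "length ds = length ms" by (cases cs) auto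
    show ?case unfolding ds(1) using Cons.IH[OF ds(2)]
      by (simp add: lookup_add lookup_single when_def sum.lessThan_Suc_shift del: sum.lessThan_Suc cong: if_cong)
  qed simp
  also have "(\<Sum>i<length ms. if ms ! i = ms ! j then cs ! i else 0) = (\<Sum>i<length ms. if i = j then cs ! i else 0)"
    using assms by (intro sum.cong refl) (auto simp: nth_eq_iff_index_eq)
  finally show ?thesis using assms(3) by simp
qed

lemma HF_scheme_eq: "HF_scheme n I i = R.dim K (cls ` forms n i)"
proof -
  have "carrier R \<inter> cls ` forms n i = cls ` forms n i"
    using forms_polys carrier_R by blast
  then show ?thesis by (simp add: HF_scheme_def HF_def coord_ring_piece_def)
qed

lemma HF_scheme_neg: "i < 0 \<Longrightarrow> HF_scheme n I i = 0"
proof -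
  assume i: "i < 0"
  have "R.dim K (cls ` forms n i) = length ([] :: 'a mpoly list)"
    by (rule dim_eq_length[OF _ _ poly_subspace_forms])
      (auto simp: indep_mod_def spans_mod_def forms_neg[OF i] If(2))
  then show ?thesis by (simp add: HF_scheme_eq)
qed

lemma forms_basis:
  obtains fs where "indep_mod I fs" "set fs \<subseteq> forms n (int k)" "spans_mod I fs (forms n (int k))"
    "HF_scheme n I (int k) = length fs"
proof -
  obtain ms where ms: "set ms = monomials n k" "distinct ms" using monomial_list by metis
  have "set (map (\<lambda>m. single m 1) ms) \<subseteq> forms n (int k)" using monomials_forms ms by blast
  then have "set (map (\<lambda>m. single m 1) ms) \<subseteq> (polys n :: 'a mpoly set)" using forms_polys by blast
  then show ?thesis
    using basis_exists[OF poly_subspace_forms monomials_span[OF ms]] that by (metis HF_scheme_eq)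
qed

lemma HF_scheme_le_spanning:
  assumes "spans_mod I gs (forms n (int k))" "set gs \<subseteq> polys n"
  shows "HF_scheme n I (int k) \<le> length gs"
proof -
  obtain fs where fs: "indep_mod I fs" "set fs \<subseteq> forms n (int k)" "HF_scheme n I (int k) = length fs"
    using forms_basis[of k] by metis
  have "forms n (int k) \<subseteq> (polys n :: 'a mpoly set)" using forms_polys by blast
  then show ?thesis using indep_length_le[OF fs(1,2) _ assms] fs(3) by simp
qed

lemma HF_scheme_ge_indep:
  assumes "indep_mod I gs" "set gs \<subseteq> forms n (int k)"
  shows "length gs \<le> HF_scheme n I (int k)"
proof -
  obtain fs where fs: "set fs \<subseteq> forms n (int k)" "spans_mod I fs (forms n (int k))"
    "HF_scheme n I (int k) = length fs"
    using forms_basis[of k] by metis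
  have "forms n (int k) \<subseteq> (polys n :: 'a mpoly set)" using forms_polys by blast
  then show ?thesis using indep_length_le[OF assms _ fs(2)] fs by auto
qed

lemma HF_scheme_full:
  assumes "I \<inter> forms n (int k) = {0}"
  shows "HF_scheme n I (int k) = (n + k) choose n"
proof -
  obtain ms where ms: "set ms = monomials n k" "distinct ms" "length ms = (n + k) choose n"
    using monomial_list by metis
  let ?gs = "map (\<lambda>m. single m (1::'a)) ms"
  have gs: "set ?gs \<subseteq> forms n (int k)" using monomials_forms ms by blast
  have "indep_mod I ?gs"
    unfolding indep_mod_def
  proof (intro allI impI)
    fix cs assume cs: "length cs = length ?gs" "lin_comb cs ?gs \<in> I"
    have "lin_comb cs ?gs \<in> forms n (int k)" using poly_subspace_lin_comb[OF poly_subspace_forms gs] .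
    then have "lin_comb cs ?gs = 0" using cs assms by blast
    then have "cs ! j = 0" if "j < length cs" for j
      using lookup_lin_comb_monomials[OF ms(2), of cs j] cs(1) that by simp
    then show "set cs \<subseteq> {0}" by (auto simp: in_set_conv_nth)
  qed
  then have "length ?gs = HF_scheme n I (int k)"
    unfolding HF_scheme_eq using dim_eq_length[OF _ gs poly_subspace_forms monomials_span[OF ms(1,2)]] by simp
  then show ?thesis using ms by simp
qed

text \<open>A nonzero form of \<open>I\<close> makes any monomial occurring in it redundant modulo
  \<open>I\<close>, so one monomial fewer suffices to span.\<close>

lemma HF_scheme_full_iff:
  "HF_scheme n I (int k) = (n + k) choose n \<longleftrightarrow> I \<inter> forms n (int k) = {0}"
proof
  assume full: "HF_scheme n I (int k) = (n + k) choose n"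
  show "I \<inter> forms n (int k) = {0}"
  proof (rule ccontr)
    assume "I \<inter> forms n (int k) \<noteq> {0}"
    moreover have "0 \<in> I \<inter> forms n (int k)" using If(2) forms_closed(1) by blast
    ultimately obtain f where f: "f \<in> I" "f \<in> forms n (int k)" "f \<noteq> 0" by blast
    then obtain m0 where m0: "m0 \<in> keys f" by (metis keys_eq_empty equals0I)
    obtain ms where ms: "set ms = monomials n k" "distinct ms" "length ms = (n + k) choose n"
      using monomial_list by metis
    have m0': "m0 \<in> set ms" using m0 f ms by (auto simp: forms_iff polys_iff monomials_def)
    let ?ms = "remove1 m0 ms"
    let ?gs = "map (\<lambda>m. single m (1::'a)) ?ms"
    have rem: "set ?ms = set ms - {m0}" "distinct ?ms" "length ?ms = length ms - 1"
      using ms m0' by (auto simp: length_remove1)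
    have "set ?gs \<subseteq> forms n (int k)" using monomials_forms[of ?ms k] rem ms by blast
    then have gs: "set ?gs \<subseteq> polys n" using forms_polys by blast
    have "spans_mod I ?gs (forms n (int k))"
      unfolding spans_mod_def
    proof
      fix v :: "'a mpoly" assume v: "v \<in> forms n (int k)"
      define c where "c = lookup v m0 / lookup f m0"
      define u where "u = v - Const c * f"
      have u: "u \<in> forms n (int k)" "lookup u m0 = 0"
        using v f m0 by (auto simp: u_def c_def lookup_minus in_keys_iff intro: forms_closed)
      have "u = (\<Sum>m\<in>set ms. single m (lookup u m))" using forms_expand[OF u(1)] ms(1) by simp
      also have "\<dots> = (\<Sum>m\<in>set ?ms. single m (lookup u m))"
        unfolding rem using u(2) by (intro sum.mono_neutral_right) auto
      also have "\<dots> = lin_comb (map (lookup u) ?ms) ?gs" by (simp only: lin_comb_monomials[OF rem(2)])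
      finally have "v - lin_comb (map (lookup u) ?ms) ?gs = Const c * f" by (simp add: u_def algebra_simps)
      also have "\<dots> \<in> I" using f If(4) by simp
      finally show "\<exists>cs. length cs = length ?gs \<and> v - lin_comb cs ?gs \<in> I"
        by (intro exI[of _ "map (lookup u) ?ms"]) simp
    qed
    then have "HF_scheme n I (int k) \<le> length ms - 1" using HF_scheme_le_spanning gs rem(3) by fastforce
    moreover have "length ms \<noteq> 0" using m0' by auto
    ultimately show False using full ms(3) by linarith
  qed
qed (rule HF_scheme_full)

text \<open>Multiplication by x_0 is injective in degree \<open>k\<close> and carries a basis to an
  independent list.\<close>

lemma HF_scheme_mono_Suc:
  assumes "\<And>f. f \<in> forms n (int k) \<Longrightarrow> Var 0 * f \<in> I \<Longrightarrow> f \<in> I"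
  shows "HF_scheme n I (int k) \<le> HF_scheme n I (int (Suc k))"
proof -
  obtain fs where fs: "indep_mod I fs" "set fs \<subseteq> forms n (int k)" "HF_scheme n I (int k) = length fs"
    using forms_basis[of k] by metis
  let ?gs = "map ((*) (Var 0)) fs"
  have "indep_mod I ?gs"
    unfolding indep_mod_def lin_comb_mult
    using fs(1) assms poly_subspace_lin_comb[OF poly_subspace_forms fs(2)] by (simp add: indep_mod_def)
  moreover have "Var 0 * f \<in> forms n (int (Suc k))" if "f \<in> forms n (int k)" for f :: "'a mpoly"
    using forms_closed(6)[OF Var_forms that, of 0] by simp
  then have "set ?gs \<subseteq> forms n (int (Suc k))" using fs(2) by auto
  ultimately show ?thesis using HF_scheme_ge_indep[of ?gs "Suc k"] fs(3) by simp
qed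

text \<open>Multiplication by x_0 is onto degree \<open>Suc k\<close> and carries a basis to a
  spanning list.\<close>

lemma HF_scheme_antimono_Suc:
  assumes "\<And>f. f \<in> forms n (int (Suc k)) \<Longrightarrow> \<exists>g\<in>forms n (int k). f - Var 0 * g \<in> I"
  shows "HF_scheme n I (int (Suc k)) \<le> HF_scheme n I (int k)"
proof -
  obtain fs where fs: "set fs \<subseteq> forms n (int k)" "spans_mod I fs (forms n (int k))"
    "HF_scheme n I (int k) = length fs"
    using forms_basis[of k] by metis
  let ?gs = "map ((*) (Var 0)) fs"
  have "spans_mod I ?gs (forms n (int (Suc k)))"
    unfolding spans_mod_def
  proof
    fix f :: "'a mpoly" assume f: "f \<in> forms n (int (Suc k))"
    obtain g where g: "g \<in> forms n (int k)" "f - Var 0 * g \<in> I" using assms f by blast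
    obtain cs where cs: "length cs = length fs" "g - lin_comb cs fs \<in> I"
      using fs(2) g(1) by (auto simp: spans_mod_def)
    have "f - lin_comb cs ?gs = (f - Var 0 * g) + Var 0 * (g - lin_comb cs fs)"
      by (simp add: lin_comb_mult algebra_simps)
    also have "\<dots> \<in> I" using g cs If by simp
    finally show "\<exists>cs. length cs = length ?gs \<and> f - lin_comb cs ?gs \<in> I" using cs by auto
  qed
  moreover have "set ?gs \<subseteq> polys n" using fs(1) forms_polys by fastforce
  ultimately show ?thesis using HF_scheme_le_spanning[of ?gs "Suc k"] fs(3) by simp
qed

text \<open>The monomials provide a finite spanning list, so the graded piece has a basis whose
  length is its dimension. Length 0 means that every representing form is 0 modulo
  \<open>I\<close>.\<close>

lemma HF_ideal_zero_iff:
  assumes M: "ideal M R"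
  shows "HF n I M (int k) = 0 \<longleftrightarrow> (\<forall>f\<in>forms n (int k). cls f \<in> M \<longrightarrow> f \<in> I)"
proof -
  interpret M: ideal M R by fact
  let ?V = "{f \<in> forms n (int k). cls f \<in> M}"
  have eq: "M \<inter> coord_ring_piece n I (int k) = cls ` ?V" by (auto simp: coord_ring_piece_def)
  have V: "poly_subspace n ?V"
    unfolding poly_subspace_def
  proof (intro conjI ballI allI)
    show "?V \<subseteq> polys n" using forms_polys by blast
    show "0 \<in> ?V" using forms_closed(1) M.zero_closed zero_R by auto
    show "f + g \<in> ?V" if "f \<in> ?V" "g \<in> ?V" for f g
      using that forms_polys[of f n] forms_polys[of g n] M.a_closed
      by (auto simp: cls_simps intro: forms_closed)
    show "Const c * f \<in> ?V" if "f \<in> ?V" for c f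
      using that forms_polys[of f n] M.I_l_closed[of "cls f" "cls (Const c)"] cls_carrier[of "Const c"]
      by (auto simp: cls_simps intro: forms_closed)
  qed
  obtain ms where ms: "set ms = monomials n k" "distinct ms" using monomial_list by metis
  let ?ms = "map (\<lambda>m. single m (1::'a)) ms"
  have "spans_mod I ?ms ?V" using monomials_span[OF ms] by (auto simp: spans_mod_def)
  moreover have "set ?ms \<subseteq> polys n" using monomials_forms[of ms k] ms forms_polys by blast
  ultimately obtain fs where fs: "indep_mod I fs" "set fs \<subseteq> ?V" "spans_mod I fs ?V"
    "R.dim K (cls ` ?V) = length fs"
    by (rule basis_exists[OF V]) blast
  have HF: "HF n I M (int k) = length fs" using fs(4) by (simp add: HF_def eq)
  show ?thesis
  proof
    assume "HF n I M (int k) = 0"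
    then show "\<forall>f\<in>forms n (int k). cls f \<in> M \<longrightarrow> f \<in> I" using fs(3) HF by (auto simp: spans_mod_def)
  next
    assume "\<forall>f\<in>forms n (int k). cls f \<in> M \<longrightarrow> f \<in> I"
    then have "spans_mod I [] ?V" by (auto simp: spans_mod_def)
    then show "HF n I M (int k) = 0"
      using indep_length_le[OF fs(1,2), of "[]"] V HF by (simp add: poly_subspace_def)
  qed
qed

end


section \<open>Reduced zero-dimensional schemes\<close>

locale reduced_points =
  fixes n :: nat and I :: "'a::field mpoly set"
  assumes closed: "closed_subscheme n I" and reduced: "reduced_scheme n I"
    and zero_dim: "zero_dimensional n I"
    and away: "\<forall>p\<in>closed_points (proj_zeros n I). Var 0 \<notin> p"
begin

lemma hom_I: "homogeneous_ideal n I"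
  using closed by (simp add: closed_subscheme_def)

sublocale proper_ideal n I
proof (rule proper_ideal.intro)
  show "ideal I (mpoly_ring n)" using hom_I by (simp add: homogeneous_ideal_iff)
  obtain q where "q \<in> proj_zeros n I" using zero_dim by (auto simp: zero_dimensional_def)
  then show "1 \<notin> I" by (auto simp: proj_zeros_def proj_space_def primeideal_iff)
qed

lemma hcomp_I: "f \<in> I \<Longrightarrow> hcomp d f \<in> I"
  using hom_I by (simp add: homogeneous_ideal_iff)

lemma power_I: "f \<in> polys n \<Longrightarrow> f ^ k \<in> I \<Longrightarrow> f \<in> I"
  using reduced unfolding reduced_scheme_def by blast

text \<open>In dimension 0 no point specialises properly to another, so every point is closed and
  \<open>away\<close> applies to all of them.\<close>

lemma Var_0_notin: "q \<in> proj_zeros n I \<Longrightarrow> Var 0 \<notin> q"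
  using away zero_dim unfolding closed_points_def zero_dimensional_def by blast

text \<open>The class x_0 is a non-zerodivisor. If \<open>f\<close> is outside \<open>I\<close>,
  saturation yields \<open>i\<close> with \<open>Var i * f\<close> outside \<open>I\<close>, and
  reducedness extends this to all powers. A homogeneous prime over \<open>I\<close> avoiding this
  product is a point of the scheme, thanks to the factor \<open>Var i\<close>. It does not contain
  \<open>f\<close>, hence it contains \<open>Var 0\<close>, which is impossible.\<close>

lemma Var_0_cancel:
  assumes f: "f \<in> polys n" "Var 0 * f \<in> I" shows "f \<in> I"
proof (rule ccontr)
  assume "f \<notin> I"
  then obtain i where i: "i \<le> n" "\<And>k. Var i ^ k * f \<notin> I"
    using closed f(1) unfolding closed_subscheme_def saturated_def by blast
  have s: "Var i * f \<notin> I" "Var i * f \<in> polys n" using i(2)[of 1] i(1) f(1) by auto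
  then have "\<And>k. (Var i * f) ^ k \<notin> I" using power_I by blast
  then obtain q where q: "homogeneous_ideal n q" "primeideal q (mpoly_ring n)" "I \<subseteq> q" "Var i * f \<notin> q"
    using homogeneous_prime_avoiding[OF hom_I s(2)] by blast
  have qi: "ideal q (mpoly_ring n)" using q(1) by (simp add: homogeneous_ideal_iff)
  have "Var i \<notin> q" "f \<notin> q" using q(4) ideal_facts(4,5)[OF qi] i(1) f(1) by auto
  then have "q \<in> proj_zeros n I" using q i(1) by (auto simp: proj_zeros_def proj_space_def)
  then have "Var 0 \<notin> q" by (rule Var_0_notin)
  moreover have "Var 0 * f \<in> q" using q(3) f(2) by blast
  ultimately show False using q(2) \<open>f \<notin> q\<close> f(1) by (auto simp: primeideal_iff)
qed

lemma Var_0_power_cancel: "f \<in> polys n \<Longrightarrow> Var 0 ^ k * f \<in> I \<Longrightarrow> f \<in> I"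
proof (induction k)
  case (Suc k)
  then show ?case using Var_0_cancel[of "Var 0 ^ k * f"] by (auto simp: mult.assoc)
qed simp

lemma HF_scheme_mono: "k \<le> l \<Longrightarrow> HF_scheme n I (int k) \<le> HF_scheme n I (int l)"
proof (induction l rule: dec_induct)
  case (step l)
  have "HF_scheme n I (int l) \<le> HF_scheme n I (int (Suc l))"
    by (rule HF_scheme_mono_Suc) (use Var_0_cancel forms_polys in blast)
  then show ?case using step by simp
qed simp

text \<open>No point of the scheme lies on the hyperplane X_0 = 0, so \<open>I\<close> and
  \<open>Var 0\<close> together generate all forms of high degree. Multiplication by x_0 is
  therefore eventually surjective.\<close>

lemma HF_scheme_eventually_antimono:
  obtains c where "\<And>k. c \<le> k \<Longrightarrow> HF_scheme n I (int (Suc k)) \<le> HF_scheme n I (int k)"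
proof -
  let ?H = "{f \<in> I. \<exists>d. f \<in> forms n d}"
  let ?S = "insert (Var 0) ?H"
  let ?J = "{f + g * Var 0 | f g. f \<in> I \<and> g \<in> polys n}"
  have "homogeneous_ideal n ?J"
    by (rule homogeneous_ideal_add_principal[OF hom_I, of _ 1]) (use Var_forms[of 0 n] in simp)
  then have J: "ideal ?J (mpoly_ring n)" by (simp add: homogeneous_ideal_iff)
  have "proj_zeros n ?S = {}"
  proof (rule ccontr)
    assume "proj_zeros n ?S \<noteq> {}"
    then obtain q where q: "q \<in> proj_space n" "Var 0 \<in> q" "?H \<subseteq> q" by (auto simp: proj_zeros_def)
    then have "ideal q (mpoly_ring n)" by (simp add: proj_space_def homogeneous_ideal_iff)
    then have "genideal (mpoly_ring n) ?H \<subseteq> q" using genideal_mpoly(3)[of ?H n q] If(1) q(3) by blast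
    then have "I \<subseteq> q" using hom_I by (simp add: homogeneous_ideal_def)
    then show False using q Var_0_notin[of q] by (simp add: proj_zeros_def)
  qed
  then obtain c where c: "\<And>i. c \<le> i \<Longrightarrow> forms n (int i) \<subseteq> genideal (mpoly_ring n) ?S"
    using genideal_contains_high_degrees[of ?S n] Var_forms[of 0 n] by blast
  have "f + 0 * Var 0 \<in> ?J" if "f \<in> I" for f using that polys_closed(1) by blast
  moreover have "0 + 1 * Var 0 \<in> ?J" using If(2) polys_closed(2) by blast
  ultimately have "?S \<subseteq> ?J" by (simp add: subset_iff del: mem_Collect_eq) (simp add: mem_Collect_eq)
  then have SJ: "genideal (mpoly_ring n) ?S \<subseteq> ?J"
    using genideal_mpoly(3)[OF _ J, of ?S] If(1) by fastforce
  have "\<exists>g\<in>forms n (int k). f - Var 0 * g \<in> I" if "c \<le> k" "f \<in> forms n (int (Suc k))" for k f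
  proof -
    have "f \<in> ?J" using c[of "Suc k"] that SJ by auto
    then obtain a g where ag: "a \<in> I" "g \<in> polys n" "f = a + g * Var 0" by blast
    have "f = hcomp (Suc k) f" using hcomp_of_form[OF that(2)] by simp
    also have "\<dots> = hcomp (Suc k) a + hcomp k g * Var 0"
      using hcomp_mult_form[of "Var 0" n 1 g "Suc k"] Var_forms[of 0 n] ag by simp
    finally have "f - Var 0 * hcomp k g = hcomp (Suc k) a" by (simp add: mult.commute)
    then show ?thesis using hcomp_I ag hcomp_forms by metis
  qed
  then show ?thesis using that HF_scheme_antimono_Suc by blast
qed

text \<open>A function that is monotone and eventually antimonotone is eventually constant; this
  gives the description in \<open>scheme_degree\<close> its unique value.\<close>

lemma HF_scheme_eventually:
  obtains c where "\<And>k. c \<le> k \<Longrightarrow> HF_scheme n I (int k) = scheme_degree n I"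
proof -
  obtain c where c: "\<And>k. c \<le> k \<Longrightarrow> HF_scheme n I (int (Suc k)) \<le> HF_scheme n I (int k)"
    using HF_scheme_eventually_antimono by blast
  have const: "HF_scheme n I (int k) = HF_scheme n I (int c)" if "c \<le> k" for k
    using that
  proof (induction k rule: dec_induct)
    case (step k)
    then show ?case using c[of k] HF_scheme_mono[of k "Suc k"] by simp
  qed simp
  have ev: "\<forall>\<^sub>F i in at_top. HF_scheme n I i = HF_scheme n I (int c)"
    unfolding eventually_at_top_linorder
  proof (intro exI allI impI)
    fix i assume "int c \<le> i"
    then show "HF_scheme n I i = HF_scheme n I (int c)" using const[of "nat i"] by simp
  qed
  have "scheme_degree n I = HF_scheme n I (int c)"
    unfolding scheme_degree_def
  proof (rule the_equality)
    show "\<forall>\<^sub>F i in at_top. HF_scheme n I i = HF_scheme n I (int c)" by (rule ev)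
    fix d assume "\<forall>\<^sub>F i in at_top. HF_scheme n I i = d"
    from eventually_conj[OF ev this] obtain N where
      "\<And>i. N \<le> i \<Longrightarrow> HF_scheme n I i = HF_scheme n I (int c) \<and> HF_scheme n I i = d"
      unfolding eventually_at_top_linorder by blast
    from this[OF order_refl] show "d = HF_scheme n I (int c)" by simp
  qed
  then show ?thesis using that const by metis
qed

lemma HF_scheme_stable:
  assumes "HF_scheme n I (int \<alpha>) = scheme_degree n I" "\<alpha> \<le> k"
  shows "HF_scheme n I (int k) = scheme_degree n I"
proof -
  obtain c where c: "\<And>k. c \<le> k \<Longrightarrow> HF_scheme n I (int k) = scheme_degree n I"
    using HF_scheme_eventually by blast
  show ?thesis
    using HF_scheme_mono[OF assms(2)] HF_scheme_mono[of k "max c k"] c[of "max c k"] assms(1) by simp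
qed

text \<open>A power of X_0 lifts a nonzero form of \<open>I\<close> to degree \<open>a\<close>
  without annihilating it.\<close>

lemma no_forms_below:
  assumes "I \<inter> forms n (int a) = {0}" "k \<le> a" shows "I \<inter> forms n (int k) = {0}"
proof -
  have "f = 0" if f: "f \<in> I" "f \<in> forms n (int k)" for f
  proof -
    have "Var 0 ^ (a - k) * f \<in> forms n (int (a - k) * 1 + int k)"
      using f Var_forms[of 0 n] by (intro forms_closed) auto
    then have "Var 0 ^ (a - k) * f \<in> forms n (int a)" using assms(2) by (simp add: of_nat_diff)
    moreover have "Var 0 ^ (a - k) * f \<in> I" using f If(4) by simp
    ultimately have "Var 0 ^ (a - k) * f = 0" using assms(1) by blast
    moreover have "Var 0 \<noteq> (0 :: 'a mpoly)" using one If Const_mem by (simp add: Var_def) (metis keys_eq_empty keys_single insert_not_empty zero_neq_one)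
    ultimately show "f = 0" by simp
  qed
  then show ?thesis using If(2) forms_closed(1) by blast
qed

text \<open>From degree \<alpha> on the Hilbert function equals the degree of the scheme. Below
  \<alpha> it is full as soon as \<open>I\<close> has no nonzero form in degree
  \<open>\<alpha> - 1\<close>. The two bounds on the degree decide which entry of the minimum is
  attained.\<close>

lemma generic_position_iff:
  assumes n: "1 \<le> n" and \<alpha>: "1 \<le> \<alpha>"
    and deg: "(n + (\<alpha> - 1)) choose n < scheme_degree n I" "scheme_degree n I < (n + \<alpha>) choose n"
    and HF: "HF_scheme n I (int \<alpha>) = scheme_degree n I"
  shows "generic_position n I \<longleftrightarrow> I \<inter> forms n (int (\<alpha> - 1)) = {0}"
proof
  assume "generic_position n I"
  then have "HF_scheme n I (int (\<alpha> - 1)) = min (scheme_degree n I) (nat (int n + int (\<alpha> - 1)) choose n)"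
    unfolding generic_position_def by blast
  also have "nat (int n + int (\<alpha> - 1)) = n + (\<alpha> - 1)" by linarith
  finally show "I \<inter> forms n (int (\<alpha> - 1)) = {0}" using deg(1) HF_scheme_full_iff[of "\<alpha> - 1"] by simp
next
  assume I0: "I \<inter> forms n (int (\<alpha> - 1)) = {0}"
  show "generic_position n I"
    unfolding generic_position_def
  proof
    fix i
    show "HF_scheme n I i = min (scheme_degree n I) (nat (int n + i) choose n)"
    proof (cases "i < 0")
      case True
      then have "nat (int n + i) < n" using n by linarith
      then show ?thesis using True HF_scheme_neg by (simp add: binomial_eq_0)
    next
      case False
      then obtain k where k: "i = int k" by (metis nonneg_int_cases not_less)
      have nk: "nat (int n + i) = n + k" using k by linarith
      show ?thesis
      proof (cases "k \<le> \<alpha> - 1")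
        case True
        have "HF_scheme n I i = (n + k) choose n"
          unfolding k by (rule HF_scheme_full[OF no_forms_below[OF I0 True]])
        moreover have "(n + k) choose n \<le> (n + (\<alpha> - 1)) choose n"
          using True by (intro binomial_right_mono) simp
        ultimately show ?thesis using deg(1) nk by simp
      next
        case False
        then have "\<alpha> \<le> k" by simp
        moreover from this have "(n + \<alpha>) choose n \<le> (n + k) choose n" by (intro binomial_right_mono) simp
        ultimately show ?thesis using HF_scheme_stable[OF HF, of k] deg(2) nk k by simp
      qed
    qed
  qed
qed

end


section \<open>Jacobian determinants and the different\<close>

text \<open>Columns are indexed by a function, so that replacing one of them is a function update;
  the arguments are not restricted to generators of the ideal.\<close>

definition jac :: "nat \<Rightarrow> (nat \<Rightarrow> 'a::comm_ring_1 mpoly) \<Rightarrow> 'a mpoly" where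
  "jac n v = det (mat n n (\<lambda>(i, k). partial_deriv (Suc i) (v k)))"

lemma signof_Const: "(of_int (sign p) :: 'a::comm_ring_1 mpoly) = Const (of_int (sign p))"
  by (cases p rule: sign_cases) auto

lemma det_polys:
  assumes "A \<in> carrier_mat m m" "\<And>i j. i < m \<Longrightarrow> j < m \<Longrightarrow> A $$ (i, j) \<in> polys n"
  shows "det A \<in> (polys n :: 'a::comm_ring_1 mpoly set)"
  unfolding det_def'[OF assms(1)] signof_Const
proof (intro sum_polys polys_closed(4) prod_polys assms(2))
  show "p i < m" if "p \<in> {p. p permutes {0..<m}}" "i \<in> {0..<m}" for p i
    using that permutes_in_image[of p "{0..<m}" i] by auto
qed auto

lemma jac_formula:
  "jac n v = (\<Sum>p\<in>{p. p permutes {0..<n}}. Const (of_int (sign p)) * (\<Prod>i=0..<n. partial_deriv (Suc i) (v (p i))))"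
proof -
  have "mat n n (\<lambda>(i, k). partial_deriv (Suc i) (v k)) \<in> carrier_mat n n" by simp
  then show ?thesis
    unfolding jac_def det_def'[OF \<open>_ \<in> carrier_mat n n\<close>] signof_Const
  proof (intro sum.cong refl arg_cong2[of _ _ _ _ "(*)"] prod.cong)
    fix p i assume "p \<in> {p. p permutes {0..<n}}" "i \<in> {0..<n}"
    then have "p i < n" using permutes_in_image[of p "{0..<n}" i] by auto
    then show "mat n n (\<lambda>(i, k). partial_deriv (Suc i) (v k)) $$ (i, p i) = partial_deriv (Suc i) (v (p i))"
      using \<open>i \<in> {0..<n}\<close> by simp
  qed
qed

lemma jac_polys: "(\<And>k. k < n \<Longrightarrow> v k \<in> polys n) \<Longrightarrow> jac n v \<in> polys n"
  unfolding jac_def by (rule det_polys) (auto simp: partial_deriv_polys)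

lemma jac_forms:
  assumes "\<And>k. k < n \<Longrightarrow> v k \<in> forms n (d k)"
  shows "jac n v \<in> forms n ((\<Sum>k<n. d k) - int n)"
  unfolding jac_formula
proof (intro sum_forms forms_closed(5))
  fix p assume "p \<in> {p. p permutes {0..<n}}"
  then have p: "p permutes {0..<n}" by simp
  have "(\<Prod>i=0..<n. partial_deriv (Suc i) (v (p i))) \<in> forms n (\<Sum>i=0..<n. d (p i) - 1)"
  proof (intro prod_forms partial_deriv_forms assms)
    show "p i < n" if "i \<in> {0..<n}" for i using that permutes_in_image[OF p, of i] by auto
  qed
  also have "(\<Sum>i=0..<n. d (p i) - 1) = (\<Sum>i=0..<n. d (p i)) - int n" by (simp add: sum_subtractf)
  also have "(\<Sum>i=0..<n. d (p i)) = (\<Sum>k<n. d k)"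
    using sum.permute[OF p, of d] by (simp add: o_def atLeast0LessThan)
  finally show "(\<Prod>i=0..<n. partial_deriv (Suc i) (v (p i))) \<in> forms n ((\<Sum>k<n. d k) - int n)" .
qed

lemma wge_prod: "(\<And>x. x \<in> A \<Longrightarrow> wge w a (f x)) \<Longrightarrow> wge w (card A * a) (prod f A)"
  by (induction A rule: infinite_finite_induct) (auto intro: wge_mult)

lemma jac_wge:
  assumes "\<And>i k. k < n \<Longrightarrow> wge w a (partial_deriv i (v k))"
  shows "wge w (n * a) (jac n v)"
  unfolding jac_formula
proof (intro wge_sum wge_mult_left)
  fix p assume "p \<in> {p. p permutes {0..<n}}"
  then have p: "p permutes {0..<n}" by simp
  have "p i < n" if "i \<in> {0..<n}" for i using that permutes_in_image[OF p, of i] by auto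
  then show "wge w (n * a) (\<Prod>i=0..<n. partial_deriv (Suc i) (v (p i)))"
    using wge_prod[of "{0..<n}" w a "\<lambda>i. partial_deriv (Suc i) (v (p i))"] assms by simp
qed

text \<open>Deleting column \<open>k\<close> removes every occurrence of \<open>f\<close>, so the
  cofactors of the original matrix can be used.\<close>

lemma jac_upd:
  assumes k: "k < n"
  shows "jac n (v(k := f)) =
    (\<Sum>i<n. partial_deriv (Suc i) f * cofactor (mat n n (\<lambda>(i, k). partial_deriv (Suc i) (v k))) i k)"
proof -
  let ?A = "\<lambda>v. mat n n (\<lambda>(i, k). partial_deriv (Suc i) (v k))"
  have "cofactor (?A (v(k := f))) i k = cofactor (?A v) i k" if "i < n" for i
  proof -
    have "mat_delete (?A (v(k := f))) i k = mat_delete (?A v) i k"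
      by (rule eq_matI) (auto simp: mat_delete_def)
    then show ?thesis by (simp add: cofactor_def)
  qed
  then show ?thesis
    unfolding jac_def by (subst laplace_expansion_column[of _ n k]) (use k in auto)
qed

text \<open>As a function of a single argument the Jacobian determinant is a first-order
  differential operator without constant term. This form makes the Leibniz rule available in
  \<open>jac_mem_of_generators\<close>.\<close>

lemma jac_column:
  fixes v :: "nat \<Rightarrow> 'a::comm_ring_1 mpoly"
  assumes k: "k < n" and v: "\<And>j. j < n \<Longrightarrow> v j \<in> polys n"
  obtains C where "\<And>i. i < n \<Longrightarrow> C i \<in> polys n"
    "\<And>f. jac n (v(k := f)) = (\<Sum>i<n. partial_deriv (Suc i) f * C i)"
proof -
  let ?A = "mat n n (\<lambda>(i, k). partial_deriv (Suc i) (v k))"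
  have C: "cofactor ?A i k \<in> polys n" if "i < n" for i
  proof -
    have "mat_delete ?A i k \<in> carrier_mat (n - 1) (n - 1)" by (simp add: mat_delete_def)
    then have "det (mat_delete ?A i k) \<in> polys n"
      by (rule det_polys) (use k that v in \<open>auto simp: mat_delete_def intro!: partial_deriv_polys\<close>)
    then show ?thesis by (simp add: cofactor_def polys_closed)
  qed
  show ?thesis by (rule that[OF C jac_upd[OF k]])
qed

text \<open>Expand each determinant along its replaced column and collect the terms: the product of
  the matrix with its adjugate is the determinant times the identity.\<close>

lemma jac_cramer:
  fixes v :: "nat \<Rightarrow> 'a::comm_ring_1 mpoly"
  assumes i: "i < n"
  shows "jac n v * partial_deriv (Suc i) f =
    (\<Sum>k<n. partial_deriv (Suc i) (v k) * jac n (v(k := f)))"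
proof -
  let ?A = "mat n n (\<lambda>(i, k). partial_deriv (Suc i) (v k))"
  have A: "?A \<in> carrier_mat n n" by simp
  have adj: "(\<Sum>k<n. partial_deriv (Suc i) (v k) * cofactor ?A l k) = (if i = l then jac n v else 0)"
    if l: "l < n" for l
  proof -
    have "(?A * adj_mat ?A) $$ (i, l) = (\<Sum>k<n. partial_deriv (Suc i) (v k) * cofactor ?A l k)"
      using i l by (simp add: adj_mat_def scalar_prod_def atLeast0LessThan)
    then show ?thesis using adj_mat(2)[OF A] i l by (cases "i = l") (auto simp: jac_def)
  qed
  have "(\<Sum>k<n. partial_deriv (Suc i) (v k) * jac n (v(k := f))) =
      (\<Sum>k<n. \<Sum>l<n. partial_deriv (Suc l) f * (partial_deriv (Suc i) (v k) * cofactor ?A l k))"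
    by (intro sum.cong refl) (simp add: jac_upd sum_distrib_left mult.left_commute)
  also have "\<dots> = (\<Sum>l<n. partial_deriv (Suc l) f * (\<Sum>k<n. partial_deriv (Suc i) (v k) * cofactor ?A l k))"
    by (subst sum.swap) (simp add: sum_distrib_left)
  also have "\<dots> = (\<Sum>l<n. if i = l then partial_deriv (Suc l) f * jac n v else 0)"
    by (intro sum.cong refl) (simp add: adj)
  also have "\<dots> = jac n v * partial_deriv (Suc i) f" using i by (simp add: mult.commute)
  finally show ?thesis ..
qed

text \<open>The set \<open>jacobian_minors\<close> admits only increasing choices of columns. Any
  other injective choice is a permutation of an increasing one and contributes a sign.\<close>

lemma jac_sorted:
  fixes v :: "nat \<Rightarrow> 'a::comm_ring_1 mpoly"
  assumes inj: "inj_on c {..<n}"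
  obtains e s where "strict_mono_on {..<n} e" "e ` {..<n} = c ` {..<n}"
    "jac n (\<lambda>k. v (c k)) = Const s * jac n (\<lambda>k. v (e k))"
proof -
  define xs where "xs = sorted_list_of_set (c ` {..<n})"
  have xs: "set xs = c ` {..<n}" "distinct xs" "length xs = n" "sorted_wrt (<) xs"
    using inj by (simp_all add: xs_def card_image)
  define e where "e k = xs ! k" for k
  have e: "strict_mono_on {..<n} e"
    using xs(3,4) by (auto simp: strict_mono_on_def e_def sorted_wrt_iff_nth_less)
  have im: "e ` {..<n} = c ` {..<n}"
    unfolding xs(1)[symmetric] by (auto simp: e_def set_conv_nth xs(3))
  have bij: "bij_betw e {0..<n} (c ` {..<n})" "bij_betw c {0..<n} (c ` {..<n})"
    using im strict_mono_on_imp_inj_on[OF e] inj by (auto simp: bij_betw_def atLeast0LessThan)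
  define p where "p k = (if k < n then inv_into {0..<n} e (c k) else k)" for k
  have "bij_betw (\<lambda>k. inv_into {0..<n} e (c k)) {0..<n} {0..<n}"
    using bij_betw_trans[OF bij(2) bij_betw_inv_into[OF bij(1)]] by (simp add: o_def)
  then have "bij_betw p {0..<n} {0..<n}"
    by (subst bij_betw_cong[of _ _ "\<lambda>k. inv_into {0..<n} e (c k)"]) (auto simp: p_def)
  then have p: "p permutes {0..<n}" by (rule bij_imp_permutes) (simp add: p_def)
  have ep: "e (p k) = c k" if "k < n" for k
    using that im by (simp add: p_def f_inv_into_f atLeast0LessThan)
  have pn: "p k < n" if "k < n" for k using permutes_in_image[OF p, of k] that by auto
  \<comment> \<open>Transposed, because the permutation rule for determinants acts on rows.\<close>
  define A where "A = transpose_mat (mat n n (\<lambda>(i, k). partial_deriv (Suc i) (v (e k))))"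
  have A: "A \<in> carrier_mat n n" by (simp add: A_def)
  have "transpose_mat (mat n n (\<lambda>(i, k). partial_deriv (Suc i) (v (c k)))) = mat n n (\<lambda>(i, j). A $$ (p i, j))"
    by (rule eq_matI) (auto simp: A_def pn ep)
  then have "jac n (\<lambda>k. v (c k)) = det (mat n n (\<lambda>(i, j). A $$ (p i, j)))"
    unfolding jac_def by (metis det_transpose mat_carrier)
  also have "\<dots> = of_int (sign p) * det A" by (rule det_permute_rows[OF A p])
  also have "det A = jac n (\<lambda>k. v (e k))" unfolding A_def jac_def by (rule det_transpose[of _ n]) simp
  finally show ?thesis using that e im by (metis signof_Const)
qed

lemma jac_not_inj:
  assumes "\<not> inj_on c {..<n}" shows "jac n (\<lambda>k. v (c k)) = 0"
proof -
  obtain i j where ij: "i < n" "j < n" "i \<noteq> j" "c i = c j" using assms by (auto simp: inj_on_def)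
  show ?thesis
    unfolding jac_def by (rule det_identical_columns[of _ n i j]) (use ij in \<open>auto intro!: eq_vecI\<close>)
qed

text \<open>Modulo \<open>U\<close>, which contains \<open>I\<close>, the determinant is linear over
  the polynomial ring in each argument from \<open>I\<close>. The admissible entries of a column
  thus form an ideal, and an ideal that contains the generators contains \<open>I\<close>. This is
  the independence of the different from the chosen generators.\<close>

lemma jac_mem_of_generators:
  fixes Fs :: "'a::field mpoly list"
  assumes gens: "I = genideal (mpoly_ring n) (set Fs)" "set Fs \<subseteq> polys n"
    and U: "ideal U (mpoly_ring n)" "I \<subseteq> U" "jacobian_minors n Fs \<subseteq> U"
    and v: "\<And>k. k < n \<Longrightarrow> v k \<in> I"
  shows "jac n v \<in> U"
proof -
  note Uf = ideal_facts[OF U(1)]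
  have I: "ideal I (mpoly_ring n)" "set Fs \<subseteq> I" using genideal_mpoly[OF gens(2)] gens(1) by auto
  note If = ideal_facts[OF I(1)]
  have base: "jac n v \<in> U" if Fsv: "\<And>k. k < n \<Longrightarrow> v k \<in> set Fs" for v
  proof -
    have "\<forall>k. \<exists>c. k < n \<longrightarrow> c < length Fs \<and> v k = Fs ! c"
      using Fsv by (metis in_set_conv_nth)
    then obtain c where c: "\<And>k. k < n \<Longrightarrow> c k < length Fs \<and> v k = Fs ! c k" by metis
    have eq: "jac n v = jac n (\<lambda>k. Fs ! c k)"
      unfolding jac_def by (rule arg_cong[of _ _ det], rule cong_mat) (auto simp: c)
    show ?thesis
    proof (cases "inj_on c {..<n}")
      case False
      then show ?thesis using jac_not_inj[of c n "(!) Fs"] eq Uf(2) by simp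
    next
      case True
      then obtain e s where e: "strict_mono_on {..<n} e" "e ` {..<n} = c ` {..<n}"
        "jac n (\<lambda>k. Fs ! c k) = Const s * jac n (\<lambda>k. Fs ! e k)"
        using jac_sorted[of c n "(!) Fs"] by blast
      have "jac n (\<lambda>k. Fs ! e k) \<in> jacobian_minors n Fs"
        unfolding jacobian_minors_def jac_def mem_Collect_eq
        by (intro exI[of _ e] conjI refl e(1)) (use e(2) c in auto)
      then show ?thesis using eq e(3) U(3) Uf(4) by auto
    qed
  qed
  \<comment> \<open>The columns from \<open>j\<close> on are generators, those before are arbitrary
    elements of \<open>I\<close>; each induction step frees one more column.\<close>
  have "jac n v \<in> U" if "\<And>k. k < n \<Longrightarrow> v k \<in> I" "\<And>k. j \<le> k \<Longrightarrow> k < n \<Longrightarrow> v k \<in> set Fs" for j v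
    using that
  proof (induction j arbitrary: v)
    case 0 then show ?case by (intro base) auto
  next
    case (Suc j)
    show ?case
    proof (cases "j < n")
      case False
      then show ?thesis using Suc.prems by (intro Suc.IH) auto
    next
      case True
      have vp: "\<And>k. k < n \<Longrightarrow> v k \<in> polys n" using Suc.prems(1) If(1) by blast
      obtain C where C: "\<And>i. i < n \<Longrightarrow> C i \<in> polys n"
        "\<And>f. jac n (v(j := f)) = (\<Sum>i<n. partial_deriv (Suc i) f * C i)"
        by (rule jac_column[of j n v, OF True vp]) blast+
      define S where "S = {f \<in> I. jac n (v(j := f)) \<in> U}"
      have "ideal S (mpoly_ring n)"
        unfolding ideal_iff
      proof (intro conjI ballI)
        show "S \<subseteq> polys n" using If(1) by (auto simp: S_def)
        show "0 \<in> S" using If(2) Uf(2) by (simp add: S_def C(2))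
        show "f + g \<in> S" if "f \<in> S" "g \<in> S" for f g
          using that If(3) Uf(3) by (auto simp: S_def C(2) partial_deriv_add distrib_right sum.distrib)
        show "a * f \<in> S" if f: "f \<in> S" and a: "a \<in> polys n" for f a
        proof -
          \<comment> \<open>The second summand of the Leibniz rule is a multiple of
            \<open>f\<close>, hence in \<open>I\<close> and in \<open>U\<close>.\<close>
          have "jac n (v(j := a * f)) = a * jac n (v(j := f)) + f * (\<Sum>i<n. partial_deriv (Suc i) a * C i)"
            unfolding C(2) partial_deriv_mult
            by (simp add: distrib_right sum.distrib sum_distrib_left mult.assoc)
          moreover have "(\<Sum>i<n. partial_deriv (Suc i) a * C i) \<in> polys n"
            using C(1) a partial_deriv_polys by (intro sum_polys polys_closed(4)) auto
          ultimately show ?thesis using f a U(2) If(4) Uf(3,4,5) by (auto simp: S_def)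
        qed
      qed
      moreover have "set Fs \<subseteq> S"
      proof
        fix F assume F: "F \<in> set Fs"
        have "jac n (v(j := F)) \<in> U"
          using Suc.prems F I(2) by (intro Suc.IH) auto
        then show "F \<in> S" using F I(2) by (auto simp: S_def)
      qed
      ultimately have "I \<subseteq> S" using genideal_mpoly(3)[OF gens(2)] gens(1) by blast
      then have "v j \<in> S" using Suc.prems(1) True by blast
      then show ?thesis by (simp add: S_def)
    qed
  qed
  from this[of v n] show ?thesis using v by simp
qed


section \<open>Extension of the base field\<close>

text \<open>The map \<open>\<phi>\<close> is injective and linear over K when L is regarded as a
  K-vector space through \<open>\<phi>\<close>, so it has a linear left inverse.\<close>

lemma field_retraction:
  fixes \<phi> :: "'k::field \<Rightarrow> 'l::field"
  assumes "field_hom \<phi>"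
  obtains \<psi> where "\<psi> 0 = 0" "\<And>x y. \<psi> (x + y) = \<psi> x + \<psi> y" "\<And>c x. \<psi> (\<phi> c * x) = c * \<psi> x" "\<And>c. \<psi> (\<phi> c) = c"
proof -
  interpret \<phi>: field_hom \<phi> by fact
  interpret vector_space_pair "(*) :: 'k \<Rightarrow> 'k \<Rightarrow> 'k" "\<lambda>c (x::'l). \<phi> c * x"
    by unfold_locales (auto simp: algebra_simps \<phi>.hom_add \<phi>.hom_mult)
  have "Vector_Spaces.linear (*) (\<lambda>c x. \<phi> c * x) \<phi>"
    by unfold_locales (auto simp: \<phi>.hom_add \<phi>.hom_mult)
  moreover have "inj \<phi>" by (rule \<phi>.inj_f)
  ultimately obtain \<psi> where \<psi>: "Vector_Spaces.linear (\<lambda>c (x::'l). \<phi> c * x) (*) \<psi>" "\<psi> \<circ> \<phi> = id"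
    using linear_injective_left_inverse by blast
  interpret \<psi>: Vector_Spaces.linear "\<lambda>c (x::'l). \<phi> c * x" "(*)" \<psi> by fact
  show ?thesis
    using that[of \<psi>] \<psi>.zero \<psi>.add \<psi>.scale \<psi>(2) by (simp add: fun_eq_iff)
qed

text \<open>Faithful flatness of a field extension, made explicit. Applying the retraction to all
  coefficients is linear over the polynomials with coefficients in K, so it sends the extended ideal
  back into \<open>I\<close>, and it undoes the extension on \<open>f\<close>.\<close>

lemma ideal_extension_descent:
  fixes I :: "'k::field mpoly set" and \<phi> :: "'k \<Rightarrow> 'l::field"
  assumes \<phi>: "field_hom \<phi>" and I: "ideal I (mpoly_ring n)"
    and f: "Poly_Mapping.map \<phi> f \<in> genideal (mpoly_ring n) (Poly_Mapping.map \<phi> ` I)"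
  shows "f \<in> I"
proof -
  interpret \<phi>: field_hom \<phi> by fact
  obtain \<psi> where \<psi>: "\<psi> 0 = 0" "\<And>x y. \<psi> (x + y) = \<psi> x + \<psi> y" "\<And>c x. \<psi> (\<phi> c * x) = c * \<psi> x" "\<And>c. \<psi> (\<phi> c) = c"
    by (rule field_retraction[OF \<phi>]) blast
  note If = ideal_facts[OF I]
  let ?m = "Poly_Mapping.map \<phi> :: 'k mpoly \<Rightarrow> 'l mpoly" and ?r = "Poly_Mapping.map \<psi> :: 'l mpoly \<Rightarrow> 'k mpoly"
  have lk: "lookup (?m g) x = \<phi> (lookup g x)" "lookup (?r h) x = \<psi> (lookup h x)" for g h x
    by (simp_all add: lookup_map_hom \<psi>(1))
  have add: "?r (g + h) = ?r g + ?r h" for g h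
    by (rule poly_mapping_eqI) (simp add: lk lookup_add \<psi>(2))
  have zero: "?r 0 = 0" by (rule poly_mapping_eqI) (simp add: lk \<psi>(1))
  have rsum: "?r (sum u A) = (\<Sum>x\<in>A. ?r (u x))" for u and A :: "(nat \<Rightarrow>\<^sub>0 nat) set"
    by (induction A rule: infinite_finite_induct) (auto simp: zero add)
  have sng: "?r (single x c) = single x (\<psi> c)" for x c
    by (rule poly_mapping_eqI) (simp add: lk lookup_single when_def \<psi>(1))
  have expand_m: "?m g = (\<Sum>b\<in>keys g. single b (\<phi> (lookup g b)))" for g
    by (rule poly_mapping_eqI)
      (simp add: lk lookup_sum lookup_single when_def not_in_keys_iff_lookup_eq_zero)
  have mult: "?r (h * ?m g) = ?r h * g" for g h
  proof -
    have expand_h: "?r h = (\<Sum>a\<in>keys h. single a (\<psi> (lookup h a)))"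
      by (subst mpoly_expand[of h]) (simp add: rsum sng)
    have "?r (h * ?m g) = ?r ((\<Sum>a\<in>keys h. single a (lookup h a)) * ?m g)" using mpoly_expand[of h] by simp
    also have "\<dots> = (\<Sum>a\<in>keys h. \<Sum>b\<in>keys g. single (a + b) (\<psi> (\<phi> (lookup g b) * lookup h a)))"
      by (simp add: expand_m sum_product mult_single rsum sng mult.commute)
    also have "\<dots> = (\<Sum>a\<in>keys h. single a (\<psi> (lookup h a))) * (\<Sum>b\<in>keys g. single b (lookup g b))"
      unfolding \<psi>(3) sum_product mult_single by (simp only: mult.commute)
    finally show ?thesis using expand_h mpoly_expand[of g] by simp
  qed
  have rp: "?r h \<in> polys n" if "h \<in> polys n" for h using map_polys[of \<psi> h n] \<psi>(1) that by simp
  have mp: "?m g \<in> polys n" if "g \<in> polys n" for g using map_polys[of \<phi> g n] that by simp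
  \<comment> \<open>The coefficientwise retraction is not linear over L; quantifying over all
    multipliers \<open>a\<close> turns the condition into an ideal over L.\<close>
  define J where "J = {h \<in> polys n. \<forall>a\<in>polys n. ?r (a * h) \<in> I}"
  have "ideal J (mpoly_ring n)"
    unfolding ideal_iff
  proof (intro conjI ballI)
    show "a * h \<in> J" if "h \<in> J" "a \<in> polys n" for h a
      using that by (auto simp: J_def simp flip: mult.assoc)
  qed (use If in \<open>auto simp: J_def zero distrib_left add\<close>)
  moreover have "?m ` I \<subseteq> J"
    using If(1,4) mp rp by (auto simp: J_def mult)
  moreover have "?m ` I \<subseteq> polys n" using If(1) mp by blast
  ultimately have "?m f \<in> J" using genideal_mpoly(3)[of "?m ` I" n J] f by blast
  then have "?r (1 * ?m f) \<in> I" unfolding J_def using polys_closed(2) by blast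
  moreover have "?r (?m f) = f" by (rule poly_mapping_eqI) (simp add: lk \<psi>(4))
  ultimately show ?thesis by simp
qed

section \<open>Cancelling the Jacobian determinant modulo the ideal\<close>

context reduced_points
begin

text \<open>If \<open>f\<close> is outside \<open>I\<close>, reducedness and descent keep all powers
  of \<open>Var 0 * f\<close> out of the extended ideal, so some homogeneous prime over L contains
  that ideal and avoids both factors. It is one of the zeros of the forms \<open>Gs\<close>, and
  transversality keeps the determinant out of it as well. This contradicts primality, since the
  product with \<open>f\<close> lies in it.\<close>

lemma jac_cancel:
  fixes \<phi> :: "'a \<Rightarrow> 'l::field"
  assumes n: "1 \<le> n" and \<alpha>: "2 \<le> \<alpha>" and \<phi>: "field_hom \<phi>"
    and Gs: "length Gs = n" "set Gs \<subseteq> I \<inter> forms n (int \<alpha>)"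
    and card: "card (proj_zeros n (Poly_Mapping.map \<phi> ` set Gs)) = \<alpha> ^ n"
    and rat: "\<forall>q\<in>proj_zeros n (Poly_Mapping.map \<phi> ` set Gs). rational_point n q"
    and f: "f \<in> polys n" "jac n ((!) Gs) * f \<in> I"
  shows "f \<in> I"
proof (rule ccontr)
  assume "f \<notin> I"
  interpret \<phi>: field_hom \<phi> by fact
  let ?m = "Poly_Mapping.map \<phi> :: 'a mpoly \<Rightarrow> 'l mpoly"
  have \<phi>c: "comm_ring_hom \<phi>" by unfold_locales
  interpret m: comm_ring_hom ?m by (rule map_hom[OF \<phi>c])
  have mp: "?m g \<in> polys n" if "g \<in> polys n" for g using map_polys[of \<phi> g n] that by simp
  have s: "Var 0 * f \<in> polys n" "Var 0 * f \<notin> I" using f(1) \<open>f \<notin> I\<close> Var_0_cancel by auto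
  \<comment> \<open>Only homogeneous elements are extended, so that the generated ideal is
    homogeneous by construction.\<close>
  let ?S = "?m ` {g \<in> I. \<exists>d. g \<in> forms n d}"
  have Sf: "\<exists>d. g \<in> forms n d" if "g \<in> ?S" for g
  proof -
    obtain h d where "g = ?m h" "h \<in> forms n d" using \<open>g \<in> ?S\<close> by blast
    then show ?thesis using map_forms[of \<phi> h n d] by auto
  qed
  have Sp: "?S \<subseteq> polys n" "?m ` I \<subseteq> polys n" using If(1) mp by auto
  have "genideal (mpoly_ring n) ?S \<subseteq> genideal (mpoly_ring n) (?m ` I)"
    using genideal_mpoly(2)[OF Sp(2)]
    by (intro genideal_mpoly(3)[OF Sp(1) genideal_mpoly(1)[OF Sp(2)]]) auto
  moreover have "?m (Var 0 * f) ^ k \<notin> genideal (mpoly_ring n) (?m ` I)" for k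
    using ideal_extension_descent[OF \<phi> I, of "(Var 0 * f) ^ k"] power_I[OF s(1), of k] s(2)
    by (metis m.hom_power)
  ultimately have nk: "?m (Var 0 * f) ^ k \<notin> genideal (mpoly_ring n) ?S" for k by blast
  obtain q where q: "homogeneous_ideal n q" "primeideal q (mpoly_ring n)"
    "genideal (mpoly_ring n) ?S \<subseteq> q" "?m (Var 0 * f) \<notin> q"
    by (rule homogeneous_prime_avoiding[OF genideal_homogeneous[OF Sf] mp[OF s(1)] nk]) blast
  have qi: "ideal q (mpoly_ring n)" using q(1) by (simp add: homogeneous_ideal_iff)
  have Iq: "?m g \<in> q" if g: "g \<in> I" for g
  proof -
    have "hcomp d g \<in> {g \<in> I. \<exists>d. g \<in> forms n d}" for d
      using hcomp_I[OF g] hcomp_forms[OF If(1)[OF g]] by blast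
    then have "?m (hcomp d g) \<in> q" for d using genideal_mpoly(2)[OF Sp(1)] q(3) by blast
    then have "(\<Sum>d\<le>bound_degree g. ?m (hcomp d g)) \<in> q" by (intro ideal_sum[OF qi])
    then show ?thesis by (metis hcomp_expand m.hom_sum order_refl)
  qed
  have "?m (Var 0) = Var 0" by (simp add: Var_def map_single)
  then have ne: "Var 0 \<notin> q" "?m f \<notin> q"
    using q(4) ideal_facts(4,5)[OF qi] mp[OF f(1)] by (auto simp: m.hom_mult)
  have Gq: "?m ` set Gs \<subseteq> q" using Gs(2) Iq by blast
  then have zq: "q \<in> proj_zeros n (?m ` set Gs)"
    using q(1,2) ne(1) by (auto simp: proj_zeros_def proj_space_def)
  then obtain a where a: "a 0 = 1" "q = point_ideal n a"
    using rational_point_normalize[of n q 0] rat ne(1) by auto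
  have "jac n ((!) Gs) \<in> polys n" using Gs If(1) by (intro jac_polys) (auto simp: subset_iff)
  moreover have "?m (jac n ((!) Gs)) * ?m f \<in> q" using Iq[OF f(2)] by (simp add: m.hom_mult)
  ultimately have "?m (jac n ((!) Gs)) \<in> q"
    using q(2) ne(2) mp f(1) by (auto simp: primeideal_iff)
  then have "eval_at a (?m (jac n ((!) Gs))) = 0" using point_ideal_eval a(2) by blast
  moreover have "?m (jac n ((!) Gs)) = det (mat n n (\<lambda>(i, k). partial_deriv (Suc i) (map ?m Gs ! k)))"
  proof -
    have "map_mat ?m (mat n n (\<lambda>(i, k). partial_deriv (Suc i) (Gs ! k))) =
        mat n n (\<lambda>(i, k). partial_deriv (Suc i) (map ?m Gs ! k))"
      by (rule eq_matI) (auto simp: Gs(1) partial_deriv_map[OF \<phi>c])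
    then show ?thesis unfolding jac_def using m.hom_det by metis
  qed
  moreover have "eval_at a (det (mat n n (\<lambda>(i, k). partial_deriv (Suc i) (map ?m Gs ! k)))) \<noteq> 0"
  proof (rule transversal_zeros[OF n])
    show "set (map ?m Gs) \<subseteq> forms n (int \<alpha>)"
      using Gs(2) map_forms[of \<phi> _ n "int \<alpha>"] by auto
    show "card (proj_zeros n (set (map ?m Gs))) = \<alpha> ^ n" using card by simp
    show "\<forall>q\<in>proj_zeros n (set (map ?m Gs)). rational_point n q" using rat by simp
    show "point_ideal n a \<in> proj_zeros n (set (map ?m Gs))" using zq a(2) by simp
  qed (use Gs \<alpha> a in auto)
  ultimately show False by simp
qed

section \<open>The Hilbert function of the different\<close>

lemma generators_forms:
  assumes "homogeneous_generators n I Fs"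
  shows "set Fs \<subseteq> polys n" "set Fs \<subseteq> I" "I = genideal (mpoly_ring n) (set Fs)"
    "\<And>F. F \<in> set Fs \<Longrightarrow> \<exists>d. F \<in> forms n d"
proof -
  show F: "\<And>F. F \<in> set Fs \<Longrightarrow> \<exists>d. F \<in> forms n d" and I: "I = genideal (mpoly_ring n) (set Fs)"
    using assms by (auto simp: homogeneous_generators_def)
  show p: "set Fs \<subseteq> polys n" using F forms_polys by blast
  show "set Fs \<subseteq> I" using genideal_mpoly(2)[OF p] I by simp
qed

lemma jacobian_minors_polys: "set Fs \<subseteq> polys n \<Longrightarrow> jacobian_minors n Fs \<subseteq> polys n"
  by (fastforce simp: jacobian_minors_def jac_def[symmetric, of n "\<lambda>k. Fs ! _ k"] intro!: jac_polys)

lemma different_ideal: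
  assumes "homogeneous_generators n I Fs"
  shows "ideal (kaehler_different n I Fs) R"
    and "cls ` jacobian_minors n Fs \<subseteq> kaehler_different n I Fs"
    and "ideal M R \<Longrightarrow> cls ` jacobian_minors n Fs \<subseteq> M \<Longrightarrow> kaehler_different n I Fs \<subseteq> M"
proof -
  have "cls ` jacobian_minors n Fs \<subseteq> carrier R"
    using jacobian_minors_polys[OF generators_forms(1)[OF assms]] cls_carrier by blast
  then show "ideal (kaehler_different n I Fs) R"
    "cls ` jacobian_minors n Fs \<subseteq> kaehler_different n I Fs"
    "ideal M R \<Longrightarrow> cls ` jacobian_minors n Fs \<subseteq> M \<Longrightarrow> kaehler_different n I Fs \<subseteq> M"
    unfolding kaehler_different_def
    using R.genideal_ideal R.genideal_self R.genideal_minimal by auto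
qed

lemma ideal_preimage:
  assumes "ideal M R" shows "ideal {f \<in> polys n. cls f \<in> M} (mpoly_ring n)"
    and "I \<subseteq> {f \<in> polys n. cls f \<in> M}"
proof -
  interpret M: ideal M R by fact
  show "ideal {f \<in> polys n. cls f \<in> M} (mpoly_ring n)"
    unfolding ideal_iff
    using M.zero_closed zero_R M.a_closed M.I_l_closed cls_carrier by (auto simp: cls_simps)
  show "I \<subseteq> {f \<in> polys n. cls f \<in> M}"
    using If(1) cls_eq_0_iff M.zero_closed by fastforce
qed

lemma jac_in_different:
  assumes gens: "homogeneous_generators n I Fs" and v: "\<And>k. k < n \<Longrightarrow> v k \<in> I"
  shows "cls (jac n v) \<in> kaehler_different n I Fs"
proof -
  note M = different_ideal[OF gens]
  note g = generators_forms[OF gens]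
  have "jacobian_minors n Fs \<subseteq> {f \<in> polys n. cls f \<in> kaehler_different n I Fs}"
    using M(2) jacobian_minors_polys[OF g(1)] by blast
  then have "jac n v \<in> {f \<in> polys n. cls f \<in> kaehler_different n I Fs}"
    by (rule jac_mem_of_generators[OF g(3,1) ideal_preimage[OF M(1)] _ v])
  then show ?thesis by simp
qed

text \<open>Every nonzero generator has degree above \<open>a\<close>, so the minors have no terms
  of degree below \<open>n * a\<close>. The classes of polynomials with this property form an ideal
  of \<open>R\<close>, which therefore contains the different. Taking the component of degree
  \<open>k\<close> of a representative shows that the class is 0.\<close>

lemma different_vanishes_below:
  assumes gens: "homogeneous_generators n I Fs" and I0: "I \<inter> forms n (int a) = {0}" and k: "k < n * a"
  shows "HF n I (kaehler_different n I Fs) (int k) = 0"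
proof -
  note M = different_ideal[OF gens]
  note g = generators_forms[OF gens]
  \<comment> \<open>With all weights 1, \<open>wge\<close> bounds the ordinary degree from
    below.\<close>
  let ?w = "\<lambda>_::nat. Suc 0"
  have w: "wdeg ?w m = mon_degree m" for m by (simp add: wdeg_def mon_degree_def)
  let ?H = "{f \<in> polys n. wge ?w (n * a) f}"
  have deriv: "wge ?w a (partial_deriv i F)" if F: "F \<in> set Fs" for i F
  proof (cases "F = 0")
    case False
    obtain d where d: "F \<in> forms n d" using g(4) F by blast
    have "int a < d"
    proof (rule ccontr)
      assume "\<not> int a < d"
      moreover have "0 \<le> d" using d False forms_neg[of d n] by (cases "d < 0") auto
      ultimately have "nat d \<le> a" "d = int (nat d)" by auto
      then have "I \<inter> forms n d = {0}" using no_forms_below[OF I0, of "nat d"] by simp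
      then show False using d F g(2) False by blast
    qed
    then show ?thesis
      using partial_deriv_forms[OF d, of i] by (auto simp: wge_def w forms_def)
  qed simp
  have minors: "jacobian_minors n Fs \<subseteq> ?H"
  proof
    fix x assume x: "x \<in> jacobian_minors n Fs"
    then obtain c where c: "c ` {..<n} \<subseteq> {..<length Fs}" "x = jac n (\<lambda>k. Fs ! c k)"
      by (auto simp: jacobian_minors_def jac_def)
    then have "Fs ! c k \<in> set Fs" if "k < n" for k using that by auto
    then have "wge ?w (n * a) x" unfolding c(2) using deriv by (intro jac_wge) auto
    then show "x \<in> ?H" using x jacobian_minors_polys[OF g(1)] by blast
  qed
  have "ideal (cls ` ?H) R"
  proof (rule idealI[OF R.ring_axioms])
    have neg: "inv\<^bsub>add_monoid R\<^esub> (cls f) = cls (- f)" if f: "f \<in> polys n" for f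
    proof -
      have "cls (- f) \<oplus>\<^bsub>R\<^esub> cls f = \<zero>\<^bsub>R\<^esub>"
        using cls_simps(2)[of "- f" f] f by (simp add: zero_R)
      then show ?thesis using R.minus_equality[of "cls (- f)" "cls f"] f cls_carrier by (simp add: a_inv_def)
    qed
    show "subgroup (cls ` ?H) (add_monoid R)"
    proof (rule group.subgroupI[OF R.a_group])
      show "cls ` ?H \<subseteq> carrier (add_monoid R)" using cls_carrier by auto
      have "0 \<in> ?H" by simp
      then show "cls ` ?H \<noteq> {}" by blast
    next
      fix x assume "x \<in> cls ` ?H"
      then obtain f where f: "x = cls f" "f \<in> ?H" by blast
      then have "- f \<in> ?H" by (simp add: wge_uminus polys_closed)
      then show "inv\<^bsub>add_monoid R\<^esub> x \<in> cls ` ?H" using neg f by blast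
    next
      fix x y assume "x \<in> cls ` ?H" "y \<in> cls ` ?H"
      then obtain f g where f: "x = cls f" "f \<in> ?H" "y = cls g" "g \<in> ?H" by blast
      then have "f + g \<in> ?H" by (simp add: wge_add polys_closed)
      moreover have "x \<otimes>\<^bsub>add_monoid R\<^esub> y = cls (f + g)" using f by (simp add: cls_simps)
      ultimately show "x \<otimes>\<^bsub>add_monoid R\<^esub> y \<in> cls ` ?H" by blast
    qed
    fix x y assume "x \<in> cls ` ?H" "y \<in> carrier R"
    then obtain f g where f: "x = cls f" "f \<in> ?H" "y = cls g" "g \<in> polys n" using carrier_R by auto
    then have "g * f \<in> ?H" by (simp add: wge_mult_left polys_closed)
    moreover have "y \<otimes>\<^bsub>R\<^esub> x = cls (g * f)" "x \<otimes>\<^bsub>R\<^esub> y = cls (g * f)"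
      using f by (simp_all add: cls_simps R.m_comm cls_carrier)
    ultimately show "y \<otimes>\<^bsub>R\<^esub> x \<in> cls ` ?H" "x \<otimes>\<^bsub>R\<^esub> y \<in> cls ` ?H" by auto
  qed
  then have MH: "kaehler_different n I Fs \<subseteq> cls ` ?H" using minors by (intro M(3)) auto
  have "f \<in> I" if f: "f \<in> forms n (int k)" "cls f \<in> kaehler_different n I Fs" for f
  proof -
    obtain h where h: "h \<in> polys n" "wge ?w (n * a) h" "cls f = cls h" using MH f(2) by blast
    have "f - h \<in> I" using h f(1) forms_polys cls_eq_iff by blast
    then have "hcomp k (f - h) \<in> I" by (rule hcomp_I)
    moreover have "hcomp k h = 0"
    proof (rule poly_mapping_eqI)
      fix m
      have "m \<notin> keys h" if "mon_degree m = k" using h(2) k that by (auto simp: wge_def w)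
      then show "lookup (hcomp k h) m = lookup 0 m" by (simp add: lookup_hcomp in_keys_iff)
    qed
    ultimately show ?thesis using hcomp_of_form[OF f(1), of k] by simp
  qed
  then show ?thesis using HF_ideal_zero_iff[OF M(1)] by blast
qed

end


section \<open>From a vanishing different to generic position\<close>

lemma int_degree:
  fixes n \<alpha> :: nat
  assumes "1 \<le> n" "2 \<le> \<alpha>"
  shows "int (n * (\<alpha> - 1) - 1) = int n * int \<alpha> - int n - 1"
proof -
  have "1 \<le> n * (\<alpha> - 1)" using assms by simp
  then have "int (n * (\<alpha> - 1) - 1) = int n * int (\<alpha> - 1) - 1" by (subst of_nat_diff) simp_all
  then show ?thesis using assms by (simp add: of_nat_diff algebra_simps)
qed

context reduced_points
begin

lemma different_vanishes_imp:
  fixes \<phi> :: "'a \<Rightarrow> 'l::field"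
  assumes n: "1 \<le> n" and \<alpha>: "2 \<le> \<alpha>" and \<phi>: "field_hom \<phi>"
    and Gs: "length Gs = n" "set Gs \<subseteq> I \<inter> forms n (int \<alpha>)"
    and card: "card (proj_zeros n (Poly_Mapping.map \<phi> ` set Gs)) = \<alpha> ^ n"
    and rat: "\<forall>q\<in>proj_zeros n (Poly_Mapping.map \<phi> ` set Gs). rational_point n q"
    and gens: "homogeneous_generators n I Fs"
    and char: "\<And>d. 1 \<le> d \<Longrightarrow> d < \<alpha> \<Longrightarrow> of_nat d \<noteq> (0::'a)"
    and HF: "HF n I (kaehler_different n I Fs) (int (n * (\<alpha> - 1) - 1)) = 0"
  shows "I \<inter> forms n (int (\<alpha> - 1)) = {0}"
proof (rule ccontr)
  assume "I \<inter> forms n (int (\<alpha> - 1)) \<noteq> {0}"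
  define P where "P d \<longleftrightarrow> (\<exists>F\<in>I. F \<in> forms n (int d) \<and> F \<noteq> 0)" for d
  define d where "d = (LEAST d. P d)"
  have P\<alpha>: "P (\<alpha> - 1)"
    unfolding P_def using \<open>_ \<noteq> {0}\<close> If(2) forms_closed(1)[of n "int (\<alpha> - 1)"] by blast
  have min: "\<not> P e" if "e < d" for e using that not_less_Least unfolding d_def by blast
  have d\<alpha>: "d \<le> \<alpha> - 1" unfolding d_def by (rule Least_le[of P, OF P\<alpha>])
  have "P d" unfolding d_def by (rule LeastI[of P, OF P\<alpha>])
  then obtain F where F: "F \<in> I" "F \<in> forms n (int d)" "F \<noteq> 0" by (auto simp: P_def)
  \<comment> \<open>A nonzero form of degree 0 is a unit and cannot lie in the proper ideal
    \<open>I\<close>.\<close>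
  have d1: "1 \<le> d"
  proof (rule ccontr)
    assume "\<not> 1 \<le> d"
    then have "d = 0" by simp
    moreover have "\<forall>m\<in>keys F. mon_degree m = d" using F(2) unfolding forms_iff by blast
    ultimately have "\<forall>m\<in>keys F. m = 0" by (simp add: mon_degree_eq_0_iff)
    then have "F = Const (lookup F 0)"
      by (intro poly_mapping_eqI) (auto simp: lookup_Const in_keys_iff)
    then show False using F Const_mem[of "lookup F 0"] by auto
  qed
  let ?G = "(!) Gs"
  have G: "?G k \<in> I" "?G k \<in> forms n (int \<alpha>)" if "k < n" for k using that Gs by (auto simp: subset_iff)
  interpret M: ideal "kaehler_different n I Fs" R by (rule different_ideal(1)[OF gens])
  have minor: "jac n (?G(k := F)) \<in> I" if k: "k < n" for k
  proof -
    let ?D = "jac n (?G(k := F))"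
    have v: "(?G(k := F)) j \<in> I" "(?G(k := F)) j \<in> forms n (if j = k then int d else int \<alpha>)" if "j < n" for j
      using F G that by auto
    have D: "?D \<in> forms n ((\<Sum>j<n. if j = k then int d else int \<alpha>) - int n)"
      by (rule jac_forms) (use v in blast)
    have "(\<Sum>j<n. if j = k then int d else int \<alpha>) = int d + (\<Sum>j\<in>{..<n} - {k}. int \<alpha>)"
      using k by (subst sum.remove[of _ k]) auto
    also have "\<dots> = int d + (int n - 1) * int \<alpha>" using k by (simp add: of_nat_diff)
    finally have sum: "(\<Sum>j<n. if j = k then int d else int \<alpha>) = int d + (int n - 1) * int \<alpha>" .
    have Dp: "?D \<in> polys n" using D by (rule forms_polys)
    \<comment> \<open>The determinant has degree \<open>d + (n - 1) * \<alpha> - n\<close>, which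
      falls short of \<open>n * (\<alpha> - 1) - 1\<close> by exactly
      \<open>\<alpha> - 1 - d\<close>.\<close>
    have "Var 0 ^ (\<alpha> - 1 - d) * ?D \<in>
        forms n (int (\<alpha> - 1 - d) * 1 + ((\<Sum>j<n. if j = k then int d else int \<alpha>) - int n))"
      using D Var_forms[of 0 n] by (intro forms_closed) auto
    also have "int (\<alpha> - 1 - d) * 1 + ((\<Sum>j<n. if j = k then int d else int \<alpha>) - int n) = int (n * (\<alpha> - 1) - 1)"
      unfolding sum int_degree[OF n \<alpha>] using d\<alpha> \<alpha> by (simp add: of_nat_diff algebra_simps)
    finally have deg: "Var 0 ^ (\<alpha> - 1 - d) * ?D \<in> forms n (int (n * (\<alpha> - 1) - 1))" .
    have "cls ?D \<in> kaehler_different n I Fs" by (rule jac_in_different[OF gens]) (use v in blast)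
    then have "cls (Var 0 ^ (\<alpha> - 1 - d) * ?D) \<in> kaehler_different n I Fs"
      using Dp M.I_l_closed cls_carrier by (simp add: cls_simps polys_closed)
    then have "Var 0 ^ (\<alpha> - 1 - d) * ?D \<in> I"
      using HF HF_ideal_zero_iff[OF different_ideal(1)[OF gens]] deg by blast
    then show ?thesis using Var_0_power_cancel Dp by blast
  qed
  \<comment> \<open>By minimality of \<open>d\<close>, a derivative of \<open>F\<close> that lies in
    \<open>I\<close> is already 0.\<close>
  have small: "g = 0" if "g \<in> I" "g \<in> forms n (int d - 1)" for g
    using min[of "d - 1"] that d1 by (auto simp: P_def of_nat_diff)
  have Fp: "partial_deriv i F \<in> polys n" for i
    using partial_deriv_polys forms_polys F(2) by blast
  have "partial_deriv (Suc i) F = 0" if i: "i < n" for i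
  proof -
    have "jac n ?G * partial_deriv (Suc i) F = (\<Sum>k<n. partial_deriv (Suc i) (?G k) * jac n (?G(k := F)))"
      by (rule jac_cramer[OF i])
    also have "\<dots> \<in> I"
      using G(1) minor by (intro ideal_sum[OF I] If(4) partial_deriv_polys) (auto intro: If(1))
    finally have "partial_deriv (Suc i) F \<in> I" by (rule jac_cancel[OF n \<alpha> \<phi> Gs card rat Fp])
    then show ?thesis using small partial_deriv_forms[OF F(2)] by blast
  qed
  \<comment> \<open>Cramer's rule reaches only the derivatives with respect to X_1, ..., X_n. Once
    these vanish, Euler's identity forces the remaining one into \<open>I\<close> and hence to 0,
    which leaves \<open>d * F = 0\<close>.\<close>
  then have euler: "Var 0 * partial_deriv 0 F = of_nat d * F"
    using euler_identity[OF F(2)] by (simp add: sum.atMost_shift)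
  then have "Var 0 * partial_deriv 0 F \<in> I" using F(1) If(4) by (simp flip: Const_of_nat)
  then have "partial_deriv 0 F \<in> I" using Var_0_cancel Fp by blast
  then have "partial_deriv 0 F = 0" using small partial_deriv_forms[OF F(2)] by blast
  then have "Const (of_nat d) * F = 0" using euler by (simp add: Const_of_nat)
  moreover have "of_nat d \<noteq> (0::'a)" using char d1 d\<alpha> \<alpha> by simp
  ultimately have "F = 0" using mpv.scale_eq_0_iff by blast
  then show False using F(3) by simp
qed

end

theorem proposition3p10:
  fixes I :: "'k::field mpoly set"
    and \<phi> :: "'k \<Rightarrow> 'l::field"
    and Fs :: "'k mpoly list"
    and n \<alpha> :: nat
  assumes n: "n \<ge> 2"
    and X: "closed_subscheme n I" "reduced_scheme n I" "zero_dimensional n I"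
    and \<alpha>: "\<alpha> > 1"
    and deg: "(n + (\<alpha> - 1)) choose n < scheme_degree n I"
      "scheme_degree n I < (n + \<alpha>) choose n"
    and char: "CHAR('k) = 0 \<or> CHAR('k) > scheme_degree n I"
    and away: "\<forall>p\<in>closed_points (proj_zeros n I). Var 0 \<notin> p"
    and gens: "homogeneous_generators n I Fs"
    and i: "HF_scheme n I (int \<alpha>) = scheme_degree n I"
    and ii: "ring.dim (mpoly_ring n) (Const ` UNIV) (I \<inter> forms n (int \<alpha>)) \<ge> n"
    and L: "field_hom \<phi>"
    and iii: "\<exists>Gs. length Gs = n \<and> set Gs \<subseteq> I \<inter> forms n (int \<alpha>) \<and>
      ring.independent (mpoly_ring n) (Const ` UNIV) Gs \<and>
      card (proj_zeros n (Poly_Mapping.map \<phi> ` set Gs)) = \<alpha> ^ n \<and>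
      (\<forall>q\<in>proj_zeros n (Poly_Mapping.map \<phi> ` set Gs). rational_point n q)"
  shows "generic_position n I \<longleftrightarrow>
    HF n I (kaehler_different n I Fs) (int n * int \<alpha> - int n - 1) = 0"
proof -
  interpret reduced_points n I using X away by unfold_locales
  obtain Gs where Gs: "length Gs = n" "set Gs \<subseteq> I \<inter> forms n (int \<alpha>)"
    "card (proj_zeros n (Poly_Mapping.map \<phi> ` set Gs)) = \<alpha> ^ n"
    "\<forall>q\<in>proj_zeros n (Poly_Mapping.map \<phi> ` set Gs). rational_point n q"
    using iii by blast
  have pos: "0 < n * (\<alpha> - 1)" using n \<alpha> by simp
  have k: "int n * int \<alpha> - int n - 1 = int (n * (\<alpha> - 1) - 1)"
    using int_degree[of n \<alpha>] n \<alpha> by simp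
  \<comment> \<open>The lower bound on the degree implies
    \<open>\<alpha> < scheme_degree n I\<close>, so a positive characteristic exceeds every
    \<open>d < \<alpha>\<close>.\<close>
  have "\<alpha> = Suc (\<alpha> - 1)" using \<alpha> by simp
  also have "\<dots> = Suc (\<alpha> - 1) choose (\<alpha> - 1)" by (rule binomial_Suc_n[symmetric])
  also have "\<dots> \<le> (n + (\<alpha> - 1)) choose (\<alpha> - 1)" using n by (intro binomial_right_mono) simp
  also have "\<dots> = (n + (\<alpha> - 1)) choose n" using binomial_symmetric[of n "n + (\<alpha> - 1)"] by simp
  finally have \<alpha>_less: "\<alpha> < scheme_degree n I" using deg(1) by simp
  have charp: "of_nat d \<noteq> (0::'k)" if "1 \<le> d" "d < \<alpha>" for d
    using char \<alpha>_less that dvd_imp_le[of "CHAR('k)" d] by (auto simp: of_nat_eq_0_iff_char_dvd)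
  have "generic_position n I \<longleftrightarrow> I \<inter> forms n (int (\<alpha> - 1)) = {0}"
    using n \<alpha> deg i by (intro generic_position_iff) auto
  also have "\<dots> \<longleftrightarrow> HF n I (kaehler_different n I Fs) (int (n * (\<alpha> - 1) - 1)) = 0"
  proof
    assume "I \<inter> forms n (int (\<alpha> - 1)) = {0}"
    then show "HF n I (kaehler_different n I Fs) (int (n * (\<alpha> - 1) - 1)) = 0"
      by (rule different_vanishes_below[OF gens]) (use pos in simp)
  next
    assume "HF n I (kaehler_different n I Fs) (int (n * (\<alpha> - 1) - 1)) = 0"
    then show "I \<inter> forms n (int (\<alpha> - 1)) = {0}"
      using n \<alpha> charp by (intro different_vanishes_imp[OF _ _ L Gs gens]) auto
  qed
  finally show ?thesis by (simp only: k)
qed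

end
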